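(* Assume the standing setting described in the context (with $J=I$) and let $\boldsymbol\gamma=(\gamma^i)_{i\in I}\in\mathfrak E_\chi(\boldsymbol A,\boldsymbol a,g)$ be an extremal measure. Then $$\sum_{i\in I}\int W^i_{\boldsymbol\gamma}\,d\gamma^i=\frac12\Bigl[\|\boldsymbol\gamma\|^2_{\mathcal E^+(\boldsymbol A)}+G_\chi(\boldsymbol A,\boldsymbol a,g)\Bigr]$$ and, for every $i\in I$, $$a_i\,W^i_{\boldsymbol\gamma}(x)\ge\Bigl(\int W^i_{\boldsymbol\gamma}\,d\gamma^i\Bigr)\,g(x)\quad\text{for n.e. }x\in A_i.$$ Moreover, these two relations characterize the numbers $\int W^i_{\boldsymbol\gamma}\,d\gamma^i$, $i\in I$, uniquely: if real numbers $\eta_i$, $i\in I$, satisfy $\sum_{i\in I}\eta_i=\frac12[\|\boldsymbol\gamma\|^2_{\mathcal E^+(\boldsymbol A)}+G_\chi(\boldsymbol A,\boldsymbol a,g)]$ and $a_iW^i_{\boldsymbol\gamma}(x)\ge\eta_i g(x)$ for n.e. $x\in A_i$, for all $i\in I$, then $\eta_i=\int W^i_{\boldsymbol\gamma}\,d\gamma^i$ for all $i\in I$.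
   Context: Standing setting. $\mathrm X$ noncompact locally compact Hausdorff; $\mathfrak M$ real Radon measures, vague topology; $S(\nu)$ support. Kernel $\kappa:\mathrm X\times\mathrm X\to[0,\infty]$ lower semicontinuous, symmetric; $\kappa(\nu,\nu_1)=\int\kappa\,d(\nu\otimes\nu_1)$, $\kappa(x,\nu)=\int\kappa(x,y)d\nu(y)$; $\mathcal E$ = measures with $\kappa(\nu,\nu)$ well defined and finite. Assumed: (a) strictly positive definite ($\|\nu\|=\kappa(\nu,\nu)^{1/2}$ a norm on the pre-Hilbert space $\mathcal E$; "strong" refers to it); (b) consistent: every strong Cauchy net in $\mathcal E^+=\{\nu\in\mathcal E:\nu\ge0\}$ converges strongly to each of its vague cluster points; (c) $\kappa(x,y)$ finite, continuous for $x\ne y$; (d) for each $\varepsilon>0$, compact $K$ there is compact $K'$ with $\kappa(x,y)<\varepsilon$ for $x\in K,y\notin K'$; (e) generalized maximum principle with constant $h\ge1$ (for compactly supported $\nu\ge0$ with $M=\sup_{S(\nu)}\kappa(\cdot,\nu)<\infty$, $\kappa(\cdot,\nu)\le hM$ everywhere). $\mathcal E^+_E$: elements of $\mathcal E^+$ concentrated on $E$; interior capacity $C(E)=1/\inf\{\kappa(\nu,\nu):\nu\in\mathcal E^+_E,\nu(E)=1\}$; "n.e." = outside a set of interior capacity zero. Condenser: disjoint countable $I^+,I^-$, $I=I^+\cup I^-$; nonempty closed $A_i$, locally finite, $A_i\cap A_j=\varnothing$ for $i\in I^+,j\in I^-$; $\alpha_i=\pm1$ on $I^\pm$; $A^\pm=\bigcup_{I^\pm}A_i$,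 $A=\bigcup A_i$; $\sup_{A^+\times A^-}\kappa<\infty$. Vector measures $\boldsymbol\mu=(\mu^i)$, $\mu^i\ge0$ concentrated on $A_i$; $R\boldsymbol\mu=\sum\alpha_i\mu^i$; $\mathcal E^+(\boldsymbol A)$ those of finite energy $\sum_{i,j}\alpha_i\alpha_j\kappa(\mu^i,\mu^j)$; $\|\boldsymbol\mu_1-\boldsymbol\mu_2\|_{\mathcal E^+(\boldsymbol A)}:=\|R\boldsymbol\mu_1-R\boldsymbol\mu_2\|$ (strong topology on $\mathcal E^+(\boldsymbol A)$); vague topology on vector measures is componentwise. External field: bounded signed $\chi\in\mathcal E$ with $S(\chi^+)\cap A^-=\varnothing$, $S(\chi^-)\cap A^+=\varnothing$; $G_\chi(\boldsymbol\mu)=\|R\boldsymbol\mu\|^2+2\kappa(\chi,R\boldsymbol\mu)$. The weighted potential of $\boldsymbol\mu\in\mathcal E^+(\boldsymbol A)$ has components $W^i_{\boldsymbol\mu}(x)=\alpha_i\kappa(x,\chi)+\sum_{j}\alpha_i\alpha_j\kappa(x,\mu^j)=\alpha_i\kappa(x,\chi+R\boldsymbol\mu)$ (finite n.e.). $g$ continuous on $A$, $g_{\inf}=\inf_Ag>0$, and for each $i$ either $g|_{A_i}$ bounded or $g^{r_i}\le\kappa(\cdot,\nu_i)$ n.e. on $A_i$ for some $r_i>1,\nu_i\in\mathcal E$. $\boldsymbol a=(a_i)$, $a_i>0$, $\sum a_i<\infty$. For $I^+\subseteq J\subseteq I$: $\mathcal E^+(\boldsymbol A,\boldsymbol a,g,J)=\{\boldsymbol\mu\in\mathcal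 E^+(\boldsymbol A):\int g\,d\mu^i=a_i\ \forall i\in J\}$, $G_\chi(\boldsymbol A,\boldsymbol a,g,J)$ = infimum of $G_\chi$ on it; $J=I$ is dropped from notation; assumed $G_\chi(\boldsymbol A,\boldsymbol a,g)<\infty$. Extremal measures: let $H:=h[\chi^+(\mathrm X)+2g_{\inf}^{-1}\sum_{i\in J}a_i]$. A net $(\boldsymbol\mu_s)$ is minimizing for the $J$-problem if each $\boldsymbol\mu_s\in\mathcal E^+(\boldsymbol A,\boldsymbol a,g,J)$ with $\sum_i\mu^i_s(\mathrm X)\le H$, and $G_\chi(\boldsymbol\mu_s)\to G_\chi(\boldsymbol A,\boldsymbol a,g,J)$. $\tilde{\boldsymbol\gamma}\in\mathcal E^+(\boldsymbol A)$ is extremal if some minimizing net converges to it both strongly and vaguely; $\mathfrak E_\chi(\boldsymbol A,\boldsymbol a,g,J)$ is the set of extremal measures. *)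

theory Defs
  imports "HOL-Probability.Probability"
begin

text \<open>Positive Radon measures are represented as Borel measures (on the whole type)
that are finite on compact sets, outer regular on Borel sets and inner regular
(by compact sets) on open sets.  A real (signed) Radon measure is represented by a
pair (P, N) of positive Radon measures, standing for P - N.\<close>

definition radon :: "'a::topological_space measure \<Rightarrow> bool" where
  "radon M \<longleftrightarrow> sets M = sets borel
     \<and> (\<forall>K. compact K \<longrightarrow> emeasure M K < \<infinity>)
     \<and> (\<forall>B\<in>sets borel. emeasure M B = (INF U\<in>{U. open U \<and> B \<subseteq> U}. emeasure M U))
     \<and> (\<forall>U. open U \<longrightarrow> emeasure M U = (SUP K\<in>{K. compact K \<and> K \<subseteq> U}. emeasure M K))"

definition supp :: "'a::topological_space measure \<Rightarrow> 'a set" where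
  "supp M = {x. \<forall>U. open U \<and> x \<in> U \<longrightarrow> emeasure M U > 0}"

definition concentrated :: "'a measure \<Rightarrow> 'a set \<Rightarrow> bool" where
  "concentrated M E \<longleftrightarrow> (\<exists>N\<in>null_sets M. UNIV - E \<subseteq> N)"

definition Cc :: "('a::topological_space \<Rightarrow> real) set" where
  "Cc = {f. continuous_on UNIV f \<and> (\<exists>K. compact K \<and> (\<forall>x. x \<notin> K \<longrightarrow> f x = 0))}"

definition pot :: "('a \<Rightarrow> 'a \<Rightarrow> ennreal) \<Rightarrow> 'a measure \<Rightarrow> 'a \<Rightarrow> ennreal" where
  "pot \<kappa> \<nu> x = (\<integral>\<^sup>+ y. \<kappa> x y \<partial>\<nu>)"

definition menergy :: "('a \<Rightarrow> 'a \<Rightarrow> ennreal) \<Rightarrow> 'a measure \<Rightarrow> 'a measure \<Rightarrow> ennreal" where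
  "menergy \<kappa> \<mu> \<nu> = (\<integral>\<^sup>+ x. pot \<kappa> \<nu> x \<partial>\<mu>)"

definition Eplus :: "('a::topological_space \<Rightarrow> 'a \<Rightarrow> ennreal) \<Rightarrow> 'a measure set" where
  "Eplus \<kappa> = {\<nu>. radon \<nu> \<and> menergy \<kappa> \<nu> \<nu> < \<infinity>}"

definition inE :: "('a::topological_space \<Rightarrow> 'a \<Rightarrow> ennreal) \<Rightarrow> 'a measure \<Rightarrow> 'a measure \<Rightarrow> bool" where
  "inE \<kappa> P N \<longleftrightarrow> radon P \<and> radon N \<and> menergy \<kappa> P P < \<infinity> \<and> menergy \<kappa> N N < \<infinity>
      \<and> menergy \<kappa> P N < \<infinity>"

definition senergy :: "('a \<Rightarrow> 'a \<Rightarrow> ennreal) \<Rightarrow> 'a measure \<Rightarrow> 'a measure \<Rightarrow> real" where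
  "senergy \<kappa> P N = enn2real (menergy \<kappa> P P) + enn2real (menergy \<kappa> N N)
      - 2 * enn2real (menergy \<kappa> P N)"

definition spot :: "('a \<Rightarrow> 'a \<Rightarrow> ennreal) \<Rightarrow> 'a measure \<Rightarrow> 'a measure \<Rightarrow> 'a \<Rightarrow> ereal" where
  "spot \<kappa> P N x = enn2ereal (pot \<kappa> P x) - enn2ereal (pot \<kappa> N x)"

definition sdist :: "('a \<Rightarrow> 'a \<Rightarrow> ennreal) \<Rightarrow> 'a measure \<Rightarrow> 'a measure \<Rightarrow> real" where
  "sdist \<kappa> \<mu> \<nu> = sqrt (enn2real (menergy \<kappa> \<mu> \<mu>) + enn2real (menergy \<kappa> \<nu> \<nu>)
      - 2 * enn2real (menergy \<kappa> \<mu> \<nu>))"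

definition icap :: "('a::topological_space \<Rightarrow> 'a \<Rightarrow> ennreal) \<Rightarrow> 'a set \<Rightarrow> ennreal" where
  "icap \<kappa> E = inverse (INF \<nu>\<in>{\<nu>. \<nu> \<in> Eplus \<kappa> \<and> concentrated \<nu> E \<and> emeasure \<nu> UNIV = 1}.
                            menergy \<kappa> \<nu> \<nu>)"

definition nearly_everywhere ::
    "('a::topological_space \<Rightarrow> 'a \<Rightarrow> ennreal) \<Rightarrow> 'a set \<Rightarrow> ('a \<Rightarrow> bool) \<Rightarrow> bool" where
  "nearly_everywhere \<kappa> S P \<longleftrightarrow> icap \<kappa> {x\<in>S. \<not> P x} = 0"

text \<open>A net is represented by its image filter.  Vague cluster point of a net of measures.\<close>
definition vague_cluster :: "'a::topological_space measure filter \<Rightarrow> 'a measure \<Rightarrow> bool" where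
  "vague_cluster F \<nu> \<longleftrightarrow> (\<forall>fs. finite fs \<and> fs \<subseteq> Cc \<longrightarrow>
      (\<forall>\<epsilon>>0. \<exists>\<^sub>F \<mu> in F. \<forall>f\<in>fs. \<bar>(\<integral>x. f x \<partial>\<mu>) - (\<integral>x. f x \<partial>\<nu>)\<bar> < \<epsilon>))"

definition strong_cauchy :: "('a \<Rightarrow> 'a \<Rightarrow> ennreal) \<Rightarrow> 'a measure filter \<Rightarrow> bool" where
  "strong_cauchy \<kappa> F \<longleftrightarrow> (\<forall>\<epsilon>>0. \<forall>\<^sub>F (\<mu>, \<nu>) in F \<times>\<^sub>F F. sdist \<kappa> \<mu> \<nu> < \<epsilon>)"

definition lsc :: "('b::topological_space \<Rightarrow> ennreal) \<Rightarrow> bool" where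
  "lsc f \<longleftrightarrow> (\<forall>p c. c < f p \<longrightarrow> (\<forall>\<^sub>F q in nhds p. c < f q))"

definition admissible_kernel :: "('a::t2_space \<Rightarrow> 'a \<Rightarrow> ennreal) \<Rightarrow> real \<Rightarrow> bool" where
  "admissible_kernel \<kappa> h \<longleftrightarrow>
     lsc (\<lambda>(x, y). \<kappa> x y) \<and> (\<forall>x y. \<kappa> x y = \<kappa> y x)
     \<comment> \<open>(a) strictly positive definite\<close>
   \<and> (\<forall>P N. inE \<kappa> P N \<longrightarrow> senergy \<kappa> P N \<ge> 0 \<and> (senergy \<kappa> P N = 0 \<longrightarrow> P = N))
     \<comment> \<open>(b) consistent\<close>
   \<and> (\<forall>F :: 'a measure filter. F \<noteq> bot \<longrightarrow> (\<forall>\<^sub>F \<mu> in F. \<mu> \<in> Eplus \<kappa>) \<longrightarrow> strong_cauchy \<kappa> F \<longrightarrow>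
        (\<forall>\<nu>. radon \<nu> \<longrightarrow> vague_cluster F \<nu> \<longrightarrow>
             \<nu> \<in> Eplus \<kappa> \<and> ((\<lambda>\<mu>. sdist \<kappa> \<mu> \<nu>) \<longlongrightarrow> 0) F))
     \<comment> \<open>(c) finite and continuous off the diagonal\<close>
   \<and> (\<forall>x y. x \<noteq> y \<longrightarrow> \<kappa> x y < \<infinity>)
   \<and> continuous_on {p. fst p \<noteq> snd p} (\<lambda>(x, y). \<kappa> x y)
     \<comment> \<open>(d)\<close>
   \<and> (\<forall>\<epsilon>>0. \<forall>K. compact K \<longrightarrow> (\<exists>K'. compact K' \<and>
        (\<forall>x\<in>K. \<forall>y. y \<notin> K' \<longrightarrow> \<kappa> x y < ennreal \<epsilon>)))
     \<comment> \<open>(e) generalized maximum principle with constant h \<ge> 1\<close>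
   \<and> h \<ge> 1
   \<and> (\<forall>\<nu>. radon \<nu> \<and> compact (supp \<nu>) \<longrightarrow>
        (SUP x\<in>supp \<nu>. pot \<kappa> \<nu> x) < \<infinity> \<longrightarrow>
        (\<forall>x. pot \<kappa> \<nu> x \<le> ennreal h * (SUP x\<in>supp \<nu>. pot \<kappa> \<nu> x)))"

definition alpha :: "'i set \<Rightarrow> 'i \<Rightarrow> real" where
  "alpha Ip i = (if i \<in> Ip then 1 else -1)"

definition condenser ::
    "('a::topological_space \<Rightarrow> 'a \<Rightarrow> ennreal) \<Rightarrow> 'i set \<Rightarrow> 'i set \<Rightarrow> ('i \<Rightarrow> 'a set) \<Rightarrow> bool" where
  "condenser \<kappa> Ip In A \<longleftrightarrow>
     countable (Ip \<union> In) \<and> Ip \<inter> In = {}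
   \<and> (\<forall>i\<in>Ip \<union> In. closed (A i) \<and> A i \<noteq> {})
   \<and> (\<forall>x. \<exists>U. open U \<and> x \<in> U \<and> finite {i\<in>Ip \<union> In. A i \<inter> U \<noteq> {}})
   \<and> (\<forall>i\<in>Ip. \<forall>j\<in>In. A i \<inter> A j = {})
   \<and> (SUP p\<in>(\<Union>i\<in>Ip. A i) \<times> (\<Union>j\<in>In. A j). \<kappa> (fst p) (snd p)) < \<infinity>"

definition blockE ::
    "('a \<Rightarrow> 'a \<Rightarrow> ennreal) \<Rightarrow> 'i set \<Rightarrow> 'i set \<Rightarrow> ('i \<Rightarrow> 'a measure) \<Rightarrow> ('i \<Rightarrow> 'a measure) \<Rightarrow> ennreal" where
  "blockE \<kappa> S T \<mu> \<nu> = (\<Sum>\<^sub>\<infinity>(i, j)\<in>S \<times> T. menergy \<kappa> (\<mu> i) (\<nu> j))"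

text \<open>Mutual energy kappa(R mu, R nu) = sum_{i,j} alpha_i alpha_j kappa(mu^i, nu^j).\<close>
definition vmut ::
    "('a \<Rightarrow> 'a \<Rightarrow> ennreal) \<Rightarrow> 'i set \<Rightarrow> 'i set \<Rightarrow> ('i \<Rightarrow> 'a measure) \<Rightarrow> ('i \<Rightarrow> 'a measure) \<Rightarrow> real" where
  "vmut \<kappa> Ip In \<mu> \<nu> = enn2real (blockE \<kappa> Ip Ip \<mu> \<nu>) + enn2real (blockE \<kappa> In In \<mu> \<nu>)
      - enn2real (blockE \<kappa> Ip In \<mu> \<nu>) - enn2real (blockE \<kappa> In Ip \<mu> \<nu>)"

definition EplusA ::
    "('a::topological_space \<Rightarrow> 'a \<Rightarrow> ennreal) \<Rightarrow> 'i set \<Rightarrow> 'i set \<Rightarrow> ('i \<Rightarrow> 'a set) \<Rightarrow> ('i \<Rightarrow> 'a measure) set" where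
  "EplusA \<kappa> Ip In A = {\<mu>. (\<forall>i\<in>Ip \<union> In. radon (\<mu> i) \<and> concentrated (\<mu> i) (A i))
      \<and> blockE \<kappa> Ip Ip \<mu> \<mu> < \<infinity> \<and> blockE \<kappa> In In \<mu> \<mu> < \<infinity> \<and> blockE \<kappa> Ip In \<mu> \<mu> < \<infinity>}"

definition vnorm2 :: "('a \<Rightarrow> 'a \<Rightarrow> ennreal) \<Rightarrow> 'i set \<Rightarrow> 'i set \<Rightarrow> ('i \<Rightarrow> 'a measure) \<Rightarrow> real" where
  "vnorm2 \<kappa> Ip In \<mu> = vmut \<kappa> Ip In \<mu> \<mu>"

definition vdist ::
    "('a \<Rightarrow> 'a \<Rightarrow> ennreal) \<Rightarrow> 'i set \<Rightarrow> 'i set \<Rightarrow> ('i \<Rightarrow> 'a measure) \<Rightarrow> ('i \<Rightarrow> 'a measure) \<Rightarrow> real" where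
  "vdist \<kappa> Ip In \<mu> \<nu> = sqrt (vmut \<kappa> Ip In \<mu> \<mu> - 2 * vmut \<kappa> Ip In \<mu> \<nu> + vmut \<kappa> Ip In \<nu> \<nu>)"

text \<open>chi = chiP - chiN is a bounded signed Radon measure in E (chiP, chiN its mutually singular
positive and negative parts), with S(chi^+) \<inter> A^- = {} and S(chi^-) \<inter> A^+ = {}.\<close>
definition external_field ::
    "('a::topological_space \<Rightarrow> 'a \<Rightarrow> ennreal) \<Rightarrow> 'i set \<Rightarrow> 'i set \<Rightarrow> ('i \<Rightarrow> 'a set)
       \<Rightarrow> 'a measure \<Rightarrow> 'a measure \<Rightarrow> bool" where
  "external_field \<kappa> Ip In A chiP chiN \<longleftrightarrow>
     inE \<kappa> chiP chiN
   \<and> emeasure chiP UNIV < \<infinity> \<and> emeasure chiN UNIV < \<infinity>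
   \<and> (\<exists>B\<in>sets borel. emeasure chiP (UNIV - B) = 0 \<and> emeasure chiN B = 0)
   \<and> supp chiP \<inter> (\<Union>j\<in>In. A j) = {} \<and> supp chiN \<inter> (\<Union>i\<in>Ip. A i) = {}"

text \<open>kappa(chi, R mu) = sum_i alpha_i (kappa(chi^+, mu^i) - kappa(chi^-, mu^i)).\<close>
definition chimut ::
    "('a \<Rightarrow> 'a \<Rightarrow> ennreal) \<Rightarrow> 'i set \<Rightarrow> 'i set \<Rightarrow> 'a measure \<Rightarrow> 'a measure \<Rightarrow> ('i \<Rightarrow> 'a measure) \<Rightarrow> real" where
  "chimut \<kappa> Ip In chiP chiN \<mu> =
      enn2real (\<Sum>\<^sub>\<infinity>i\<in>Ip. menergy \<kappa> chiP (\<mu> i)) - enn2real (\<Sum>\<^sub>\<infinity>i\<in>Ip. menergy \<kappa> chiN (\<mu> i))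
    - enn2real (\<Sum>\<^sub>\<infinity>i\<in>In. menergy \<kappa> chiP (\<mu> i)) + enn2real (\<Sum>\<^sub>\<infinity>i\<in>In. menergy \<kappa> chiN (\<mu> i))"

definition Gchi ::
    "('a \<Rightarrow> 'a \<Rightarrow> ennreal) \<Rightarrow> 'i set \<Rightarrow> 'i set \<Rightarrow> 'a measure \<Rightarrow> 'a measure \<Rightarrow> ('i \<Rightarrow> 'a measure) \<Rightarrow> real" where
  "Gchi \<kappa> Ip In chiP chiN \<mu> = vnorm2 \<kappa> Ip In \<mu> + 2 * chimut \<kappa> Ip In chiP chiN \<mu>"

definition EplusAag ::
    "('a::topological_space \<Rightarrow> 'a \<Rightarrow> ennreal) \<Rightarrow> 'i set \<Rightarrow> 'i set \<Rightarrow> ('i \<Rightarrow> 'a set) \<Rightarrow> ('i \<Rightarrow> real)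
       \<Rightarrow> ('a \<Rightarrow> real) \<Rightarrow> 'i set \<Rightarrow> ('i \<Rightarrow> 'a measure) set" where
  "EplusAag \<kappa> Ip In A a g J = {\<mu>\<in>EplusA \<kappa> Ip In A. \<forall>i\<in>J. (\<integral>\<^sup>+ x. ennreal (g x) \<partial>(\<mu> i)) = ennreal (a i)}"

text \<open>G_chi(A, a, g, J) = inf of G_chi over E^+(A, a, g, J) (extended real; +\<infinity> if empty).\<close>
definition Ginf ::
    "('a::topological_space \<Rightarrow> 'a \<Rightarrow> ennreal) \<Rightarrow> 'i set \<Rightarrow> 'i set \<Rightarrow> ('i \<Rightarrow> 'a set) \<Rightarrow> 'a measure \<Rightarrow> 'a measure
       \<Rightarrow> ('i \<Rightarrow> real) \<Rightarrow> ('a \<Rightarrow> real) \<Rightarrow> 'i set \<Rightarrow> ereal" where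
  "Ginf \<kappa> Ip In A chiP chiN a g J =
     (INF \<mu>\<in>EplusAag \<kappa> Ip In A a g J. ereal (Gchi \<kappa> Ip In chiP chiN \<mu>))"

definition Hconst ::
    "real \<Rightarrow> 'i set \<Rightarrow> ('i \<Rightarrow> 'a set) \<Rightarrow> 'a measure \<Rightarrow> ('i \<Rightarrow> real) \<Rightarrow> ('a \<Rightarrow> real) \<Rightarrow> 'i set \<Rightarrow> real" where
  "Hconst h I A chiP a g J =
     h * (measure chiP UNIV + 2 / (INF x\<in>(\<Union>i\<in>I. A i). g x) * (\<Sum>\<^sub>\<infinity>i\<in>J. a i))"

text \<open>Extremal measures: limits, both strongly and vaguely, of minimizing nets
(a net is represented by its image filter on vector measures).\<close>
definition extremal ::
    "('a::topological_space \<Rightarrow> 'a \<Rightarrow> ennreal) \<Rightarrow> real \<Rightarrow> 'i set \<Rightarrow> 'i set \<Rightarrow> ('i \<Rightarrow> 'a set) \<Rightarrow> 'a measure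
       \<Rightarrow> 'a measure \<Rightarrow> ('i \<Rightarrow> real) \<Rightarrow> ('a \<Rightarrow> real) \<Rightarrow> 'i set \<Rightarrow> ('i \<Rightarrow> 'a measure) set" where
  "extremal \<kappa> h Ip In A chiP chiN a g J = {\<gamma>\<in>EplusA \<kappa> Ip In A.
     \<exists>F :: ('i \<Rightarrow> 'a measure) filter. F \<noteq> bot
       \<and> (\<forall>\<^sub>F \<mu> in F. \<mu> \<in> EplusAag \<kappa> Ip In A a g J
            \<and> (\<Sum>\<^sub>\<infinity>i\<in>Ip \<union> In. emeasure (\<mu> i) UNIV) \<le> ennreal (Hconst h (Ip \<union> In) A chiP a g J))
       \<and> ((\<lambda>\<mu>. ereal (Gchi \<kappa> Ip In chiP chiN \<mu>)) \<longlongrightarrow> Ginf \<kappa> Ip In A chiP chiN a g J) F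
       \<and> ((\<lambda>\<mu>. vdist \<kappa> Ip In \<mu> \<gamma>) \<longlongrightarrow> 0) F
       \<and> (\<forall>i\<in>Ip \<union> In. \<forall>f\<in>Cc. ((\<lambda>\<mu>. \<integral>x. f x \<partial>(\<mu> i)) \<longlongrightarrow> (\<integral>x. f x \<partial>(\<gamma> i))) F)}"

text \<open>Weighted potential W^i_mu(x) = alpha_i kappa(x, chi + R mu).\<close>
definition Wpot ::
    "('a \<Rightarrow> 'a \<Rightarrow> ennreal) \<Rightarrow> 'i set \<Rightarrow> 'i set \<Rightarrow> 'a measure \<Rightarrow> 'a measure \<Rightarrow> ('i \<Rightarrow> 'a measure)
       \<Rightarrow> 'i \<Rightarrow> 'a \<Rightarrow> ereal" where
  "Wpot \<kappa> Ip In chiP chiN \<mu> i x = ereal (alpha Ip i) *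
     (enn2ereal (pot \<kappa> chiP x + (\<Sum>\<^sub>\<infinity>j\<in>Ip. pot \<kappa> (\<mu> j) x))
      - enn2ereal (pot \<kappa> chiN x + (\<Sum>\<^sub>\<infinity>j\<in>In. pot \<kappa> (\<mu> j) x)))"

definition intW ::
    "('a \<Rightarrow> 'a \<Rightarrow> ennreal) \<Rightarrow> 'i set \<Rightarrow> 'i set \<Rightarrow> 'a measure \<Rightarrow> 'a measure \<Rightarrow> ('i \<Rightarrow> 'a measure) \<Rightarrow> 'i \<Rightarrow> real" where
  "intW \<kappa> Ip In chiP chiN \<mu> i = (\<integral>x. real_of_ereal (Wpot \<kappa> Ip In chiP chiN \<mu> i x) \<partial>(\<mu> i))"

definition admissible_g ::
    "('a::topological_space \<Rightarrow> 'a \<Rightarrow> ennreal) \<Rightarrow> 'i set \<Rightarrow> ('i \<Rightarrow> 'a set) \<Rightarrow> ('a \<Rightarrow> real) \<Rightarrow> bool" where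
  "admissible_g \<kappa> I A g \<longleftrightarrow>
     continuous_on (\<Union>i\<in>I. A i) g
   \<and> (\<exists>c>0. \<forall>x\<in>(\<Union>i\<in>I. A i). c \<le> g x)
   \<and> (\<forall>i\<in>I. bounded (g ` A i)
        \<or> (\<exists>r>1. \<exists>P N. inE \<kappa> P N \<and>
              nearly_everywhere \<kappa> (A i) (\<lambda>x. ereal (g x powr r) \<le> spot \<kappa> P N x)))"

end

theory Submission
  imports Defs
begin

text \<open>
  The constraints force every component of an admissible vector measure to have mass at most
  \<open>a i / c\<close>, where \<open>c\<close> is a positive lower bound of \<open>g\<close>, so all measures in play are finite. Since the
  kernel is bounded on \<open>A\<^sup>+ \<times> A\<^sup>-\<close>, the components of a strongly convergent minimizing net have bounded
  energy; by consistency, energy-bounded nets that converge vaguely also converge weakly, so that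
  \<open>\<integral> W\<^sup>i d\<mu>\<^sup>i \<rightarrow> \<integral> W\<^sup>i d\<gamma>\<^sup>i\<close> along the net although the limit \<open>\<gamma>\<close> itself may violate the constraints.
  Strong continuity of \<open>G\<close> gives \<open>G(\<gamma>) = inf G\<close> and hence the value of the sum. Replacing \<open>\<mu>\<^sup>i\<close> by
  \<open>(1 - t) \<mu>\<^sup>i + t \<nu>\<close>, passing to the limit along the net and then \<open>t \<rightarrow> 0\<close> yields
  \<open>\<integral> W\<^sup>i d\<nu> \<ge> \<integral> W\<^sup>i d\<gamma>\<^sup>i\<close> for all admissible \<open>\<nu>\<close> on \<open>A i\<close>, which is the inequality nearly everywhere.
  Conversely any \<open>\<eta>\<close> with \<open>a i W\<^sup>i \<ge> \<eta> i g\<close> nearly everywhere satisfies \<open>\<eta> i \<le> \<integral> W\<^sup>i d\<mu>\<^sup>i\<close> along the net,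
  hence \<open>\<eta> i \<le> \<integral> W\<^sup>i d\<gamma>\<^sup>i\<close>, and equality of the sums forces equality of the terms.
\<close>

section \<open>Finite Radon measures\<close>

text \<open>A signed measure is carried throughout as a pair of positive measures;
  \<open>R \<mu>\<close> becomes the pair \<open>msum Ip \<mu>\<close>,
  \<open>msum In \<mu>\<close>. Strong convergence sees this pair alone and by itself says nothing
  about a single component, whose energy could blow up and be cancelled by the opposite sign. The
  bound on the mixed energy excludes such cancellation, and only then does vague convergence of a
  component carry information about energies. In the first variation the term
  \<open>\<integral> W d\<mu>\<close> has both factors moving with the net; it converges because one
  factor converges strongly while the other is bounded in energy and converges weakly. The
  second-order term need not converge at all. It only has to be bounded uniformly along the net,
  which is why the limit along the net precedes \<open>t \<rightarrow> 0\<close>. The factor one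
  half in the value of the sum arises because the integrals of the \<open>W\<close> add up to the
  squared norm plus the field term once, whereas \<open>G\<close> contains the field term
  twice.\<close>

definition fradon :: "'a::t2_space measure \<Rightarrow> bool" where
  "fradon M \<longleftrightarrow> radon M \<and> emeasure M UNIV < \<infinity>"

lemma fradon_sets: "fradon M \<Longrightarrow> sets M = sets borel"
  by (simp add: fradon_def radon_def)

lemma fradon_space: "fradon M \<Longrightarrow> space M = UNIV"
  using sets_eq_imp_space_eq[of M borel] by (simp add: fradon_sets)

lemma fradon_finite_measure: "fradon M \<Longrightarrow> finite_measure M"
  by (rule finite_measureI) (auto simp: fradon_space fradon_def)

lemma fradon_emeasure: "fradon M \<Longrightarrow> emeasure M B = ennreal (measure M B)"
  using finite_measure.emeasure_eq_measure[OF fradon_finite_measure] by blast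

text \<open>\<open>radon\<close> gives inner regularity for open sets only. Outer regularity of the
  complement yields an open \<open>U\<close> containing \<open>- B\<close> with little mass in
  \<open>B\<close>, inner regularity of the whole space yields a compact \<open>L\<close> of nearly
  full mass, and \<open>L - U\<close> is the compact set sought.\<close>

lemma fradon_inner_regular:
  assumes M: "fradon M" and B: "B \<in> sets borel" and e: "e > 0"
  shows "\<exists>K. compact K \<and> K \<subseteq> B \<and> measure M (B - K) \<le> e"
proof -
  interpret finite_measure M using M by (rule fradon_finite_measure)
  note [simp] = fradon_sets[OF M] fradon_space[OF M]
  have [measurable]: "B \<in> sets borel" by fact
  have "(INF U\<in>{U. open U \<and> - B \<subseteq> U}. emeasure M U) = emeasure M (-B)"
    using M B unfolding fradon_def radon_def by auto
  also have "\<dots> < emeasure M (-B) + ennreal (e/2)"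
    using e by (simp add: emeasure_eq_measure ennreal_less_iff flip: ennreal_plus)
  finally obtain U where U: "open U" "-B \<subseteq> U" "emeasure M U < emeasure M (-B) + ennreal (e/2)"
    by (auto simp: INF_less_iff)
  have [measurable]: "U \<in> sets borel" using U by simp
  have 1: "measure M (U \<inter> B) \<le> e/2"
  proof -
    have "measure M U = measure M (-B) + measure M (U \<inter> B)"
      using U(2) by (subst finite_measure_Union[symmetric]) (auto intro!: arg_cong[where f="measure M"])
    moreover have "measure M U < measure M (-B) + e/2"
      using U(3) e by (simp add: emeasure_eq_measure ennreal_less_iff flip: ennreal_plus)
    ultimately show ?thesis by linarith
  qed
  have sup: "(SUP K\<in>{K. compact K \<and> K \<subseteq> UNIV}. emeasure M K) = emeasure M UNIV"
    using M unfolding fradon_def radon_def by (metis open_UNIV)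
  have "\<exists>L. compact L \<and> measure M UNIV - e/2 < measure M L"
  proof (cases "measure M UNIV - e/2 < 0")
    case True then show ?thesis by (intro exI[of _ "{}"]) auto
  next
    case False
    then have "ennreal (measure M UNIV - e/2) < (SUP K\<in>{K. compact K \<and> K \<subseteq> UNIV}. emeasure M K)"
      unfolding sup using e by (simp add: emeasure_eq_measure ennreal_less_iff)
    then show ?thesis using False by (auto simp: less_SUP_iff emeasure_eq_measure ennreal_less_iff)
  qed
  then obtain L where L: "compact L" "measure M UNIV - e/2 < measure M L" by blast
  have [measurable]: "L \<in> sets borel" using L(1) by (simp add: borel_compact)
  have 2: "measure M (UNIV - L) \<le> e/2"
    using L finite_measure_compl[of L] by simp
  have "measure M (B - (L - U)) \<le> measure M ((UNIV - L) \<union> (U \<inter> B))"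
    by (rule finite_measure_mono) (auto)
  also have "\<dots> \<le> e" using 1 2 measure_Un_le[of "UNIV - L" M "U \<inter> B"] by simp
  finally show ?thesis using U L by (intro exI[of _ "L - U"]) (auto intro: compact_diff)
qed

text \<open>Inner approximation of all Borel sets already implies the outer clause of
  \<open>radon\<close>: a compact subset of \<open>- B\<close> is closed in a Hausdorff space, so
  its complement is an open set around \<open>B\<close> with little excess mass. Each construction
  below is shown to be Radon through this one criterion.\<close>

lemma fradonI:
  fixes M :: "'a::t2_space measure"
  assumes s: "sets M = sets borel" and f: "emeasure M UNIV < \<infinity>"
    and inner: "\<And>B e. B \<in> sets borel \<Longrightarrow> e > 0 \<Longrightarrow> \<exists>K. compact K \<and> K \<subseteq> B \<and> measure M (B - K) \<le> e"
  shows "fradon M"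
proof -
  note [simp] = s
  have sp[simp]: "space M = UNIV" using s sets_eq_imp_space_eq[of M borel] by simp
  interpret finite_measure M using f by (intro finite_measureI) auto
  have meas: "compact K \<Longrightarrow> K \<in> sets borel" for K :: "'a set" by (rule borel_compact)
  have in': "emeasure M B = (SUP K\<in>{K. compact K \<and> K \<subseteq> B}. emeasure M K)" if B: "B \<in> sets borel" for B
  proof (rule antisym)
    show "emeasure M B \<le> (SUP K\<in>{K. compact K \<and> K \<subseteq> B}. emeasure M K)"
    proof (rule ennreal_le_epsilon)
      fix e :: real assume "e > 0"
      from inner[OF B this] obtain K where K: "compact K" "K \<subseteq> B" "measure M (B - K) \<le> e" by blast
      have "emeasure M B = emeasure M K + emeasure M (B - K)"
        using K B meas by (subst plus_emeasure) (auto intro!: arg_cong[where f="emeasure M"])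
      also have "\<dots> \<le> (SUP K\<in>{K. compact K \<and> K \<subseteq> B}. emeasure M K) + ennreal e"
        using K by (intro add_mono SUP_upper) (auto simp: emeasure_eq_measure ennreal_leI)
      finally show "emeasure M B \<le> (SUP K\<in>{K. compact K \<and> K \<subseteq> B}. emeasure M K) + ennreal e" .
    qed
    show "(SUP K\<in>{K. compact K \<and> K \<subseteq> B}. emeasure M K) \<le> emeasure M B"
      using B by (auto intro!: SUP_least emeasure_mono)
  qed
  have out: "emeasure M B = (INF U\<in>{U. open U \<and> B \<subseteq> U}. emeasure M U)" if B: "B \<in> sets borel" for B
  proof (rule antisym)
    show "(INF U\<in>{U. open U \<and> B \<subseteq> U}. emeasure M U) \<le> emeasure M B"
    proof (rule ennreal_le_epsilon)
      fix e :: real assume "e > 0"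
      have "-B \<in> sets borel" using B by auto
      from inner[OF this \<open>e > 0\<close>] obtain K where K: "compact K" "K \<subseteq> -B" "measure M (-B - K) \<le> e" by blast
      have "(INF U\<in>{U. open U \<and> B \<subseteq> U}. emeasure M U) \<le> emeasure M (-K)"
        using K by (intro INF_lower) (auto simp: compact_imp_closed open_Compl)
      also have "\<dots> = emeasure M B + emeasure M (-B - K)"
        using K B meas[OF K(1)] by (subst plus_emeasure) (auto intro!: arg_cong[where f="emeasure M"])
      also have "\<dots> \<le> emeasure M B + ennreal e"
        using K by (intro add_mono) (auto simp: emeasure_eq_measure ennreal_leI)
      finally show "(INF U\<in>{U. open U \<and> B \<subseteq> U}. emeasure M U) \<le> emeasure M B + ennreal e" .
    qed
  qed (auto intro!: INF_greatest emeasure_mono)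
  have "emeasure M K < \<infinity>" for K by (simp add: emeasure_eq_measure)
  moreover have "\<forall>B\<in>sets borel. emeasure M B = (INF U\<in>{U. open U \<and> B \<subseteq> U}. emeasure M U)"
    using out by (rule ballI)
  moreover have "\<forall>U. open U \<longrightarrow> emeasure M U = (SUP K\<in>{K. compact K \<and> K \<subseteq> U}. emeasure M K)"
    by (intro allI impI in') (rule borel_open)
  ultimately show ?thesis unfolding fradon_def radon_def using s by blast
qed

section \<open>Countable sums of measures\<close>

lemma infsum_eq_nn_integral_count_space:
  fixes f :: "'i \<Rightarrow> ennreal"
  assumes "countable S"
  shows "infsum f S = (\<integral>\<^sup>+ i. f i \<partial>count_space S)"
proof (cases "S = {}")
  case True then show ?thesis by (simp add: nn_integral_empty)
next
  case False
  have inf: "infsum f S = (SUP F\<in>{F. finite F \<and> F \<subseteq> S}. sum f F)"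
    by (rule nonneg_infsum_complete) simp
  \<comment> \<open>Countability supplies an increasing sequence of finite sets that exhausts
    \<open>S\<close>, so monotone convergence reaches the supremum over all finite subsets.\<close>
  define G where "G n = from_nat_into S ` {..n::nat}" for n
  have G: "finite (G n)" "G n \<subseteq> S" for n using False from_nat_into[of S] by (auto simp: G_def)
  have fin: "(\<integral>\<^sup>+ i. f i * indicator F i \<partial>count_space S) = sum f F" if "finite F" "F \<subseteq> S" for F
    using that by (subst nn_integral_count_space'[where A=F]) (auto simp: indicator_def intro!: sum.cong)
  show ?thesis unfolding inf
  proof (rule antisym)
    show "(SUP F\<in>{F. finite F \<and> F \<subseteq> S}. sum f F) \<le> (\<integral>\<^sup>+ i. f i \<partial>count_space S)"
      by (rule SUP_least) (auto simp: fin[symmetric] intro!: nn_integral_mono split: split_indicator)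
    have "(\<integral>\<^sup>+ i. f i \<partial>count_space S) = (\<integral>\<^sup>+ i. (SUP n. f i * indicator (G n) i) \<partial>count_space S)"
    proof (rule nn_integral_cong)
      fix i assume "i \<in> space (count_space S)"
      then obtain n where "i \<in> G n"
        using assms by (auto simp: G_def) (metis atMost_iff from_nat_into_surj image_eqI order_refl)
      then have "f i \<le> (SUP n. f i * indicator (G n) i)"
        by (intro SUP_upper2[of n]) auto
      moreover have "(SUP n. f i * indicator (G n) i) \<le> f i"
        by (rule SUP_least) (auto split: split_indicator)
      ultimately show "f i = (SUP n. f i * indicator (G n) i)" by (rule antisym)
    qed
    also have "\<dots> = (SUP n. \<integral>\<^sup>+ i. f i * indicator (G n) i \<partial>count_space S)"
      by (rule nn_integral_monotone_convergence_SUP)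
         (auto simp: incseq_def le_fun_def G_def split: split_indicator)
    also have "\<dots> \<le> (SUP F\<in>{F. finite F \<and> F \<subseteq> S}. sum f F)"
      using G by (auto simp: fin intro!: SUP_least SUP_upper)
    finally show "(\<integral>\<^sup>+ i. f i \<partial>count_space S) \<le> (SUP F\<in>{F. finite F \<and> F \<subseteq> S}. sum f F)" .
  qed
qed

text \<open>Summation is written as integration against counting measure, so that countable
  additivity and the later double sums are exchanges of nonnegative integrals without any
  summability condition.\<close>

definition msum :: "'i set \<Rightarrow> ('i \<Rightarrow> 'a::topological_space measure) \<Rightarrow> 'a measure" where
  "msum S \<mu> = measure_of UNIV (sets borel) (\<lambda>B. \<integral>\<^sup>+ i. emeasure (\<mu> i) B \<partial>count_space S)"

lemma sets_msum [simp, measurable_cong]: "sets (msum S \<mu>) = sets borel"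
  unfolding msum_def using sets.sets_measure_of_eq[of borel] by simp

lemma space_msum [simp]: "space (msum S \<mu>) = UNIV"
  unfolding msum_def by simp

lemma emeasure_msum:
  fixes \<mu> :: "'i \<Rightarrow> 'a::topological_space measure"
  assumes "\<And>i. i \<in> S \<Longrightarrow> sets (\<mu> i) = sets borel" "B \<in> sets borel"
  shows "emeasure (msum S \<mu>) B = (\<integral>\<^sup>+ i. emeasure (\<mu> i) B \<partial>count_space S)"
  unfolding msum_def
proof (rule emeasure_measure_of_sigma)
  show "sigma_algebra UNIV (sets (borel :: 'a measure))"
    using sets.sigma_algebra_axioms[of "borel :: 'a measure"] by simp
  show "countably_additive (sets borel) (\<lambda>B. \<integral>\<^sup>+ i. emeasure (\<mu> i) B \<partial>count_space S)"
  proof (rule countably_additiveI)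
    fix A :: "nat \<Rightarrow> 'a set" assume A: "range A \<subseteq> sets borel" "disjoint_family A"
    have "(\<Sum>n. \<integral>\<^sup>+ i. emeasure (\<mu> i) (A n) \<partial>count_space S) =
        (\<integral>\<^sup>+ i. (\<Sum>n. emeasure (\<mu> i) (A n)) \<partial>count_space S)"
      by (rule nn_integral_suminf[symmetric]) simp
    also have "\<dots> = (\<integral>\<^sup>+ i. emeasure (\<mu> i) (\<Union>n. A n) \<partial>count_space S)"
      using A assms by (intro nn_integral_cong suminf_emeasure) auto
    finally show "(\<Sum>n. \<integral>\<^sup>+ i. emeasure (\<mu> i) (A n) \<partial>count_space S) =
        (\<integral>\<^sup>+ i. emeasure (\<mu> i) (\<Union>n. A n) \<partial>count_space S)" .
  qed
qed (use assms in \<open>auto simp: positive_def\<close>)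

lemma nn_integral_msum:
  fixes \<mu> :: "'i \<Rightarrow> 'a::topological_space measure"
  assumes s: "\<And>i. i \<in> S \<Longrightarrow> sets (\<mu> i) = sets borel" and f: "f \<in> borel_measurable borel"
  shows "(\<integral>\<^sup>+ x. f x \<partial>msum S \<mu>) = (\<integral>\<^sup>+ i. (\<integral>\<^sup>+ x. f x \<partial>\<mu> i) \<partial>count_space S)"
  using f
proof (induction f rule: borel_measurable_induct)
  case (cong f g)
  moreover have "space (\<mu> i) = UNIV" if "i \<in> S" for i
    using sets_eq_imp_space_eq[OF s[OF that]] by simp
  ultimately show ?case by simp
next
  case (set A)
  then show ?case using s by (simp add: emeasure_msum) (auto intro!: nn_integral_cong)
next
  case (mult u c)
  have "(\<integral>\<^sup>+ x. c * u x \<partial>\<mu> i) = c * (\<integral>\<^sup>+ x. u x \<partial>\<mu> i)" if "i \<in> S" for i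
    using mult s[OF that] by (intro nn_integral_cmult) (simp add: measurable_cong_sets[OF s[OF that] refl])
  then have "(\<integral>\<^sup>+ i. (\<integral>\<^sup>+ x. c * u x \<partial>\<mu> i) \<partial>count_space S)
      = (\<integral>\<^sup>+ i. c * (\<integral>\<^sup>+ x. u x \<partial>\<mu> i) \<partial>count_space S)"
    by (intro nn_integral_cong) simp
  then show ?case using mult
    by (simp add: nn_integral_cmult measurable_cong_sets[OF sets_msum refl])
next
  case (add u v)
  have "(\<integral>\<^sup>+ x. v x + u x \<partial>\<mu> i) = (\<integral>\<^sup>+ x. v x \<partial>\<mu> i) + (\<integral>\<^sup>+ x. u x \<partial>\<mu> i)" if "i \<in> S" for i
    using add s[OF that] by (intro nn_integral_add) (simp_all add: measurable_cong_sets[OF s[OF that] refl])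
  then have "(\<integral>\<^sup>+ i. (\<integral>\<^sup>+ x. v x + u x \<partial>\<mu> i) \<partial>count_space S)
      = (\<integral>\<^sup>+ i. (\<integral>\<^sup>+ x. v x \<partial>\<mu> i) + (\<integral>\<^sup>+ x. u x \<partial>\<mu> i) \<partial>count_space S)"
    by (intro nn_integral_cong) simp
  then show ?case using add
    by (simp add: nn_integral_add measurable_cong_sets[OF sets_msum refl])
next
  case (seq U)
  have "(\<integral>\<^sup>+ x. (SUP n. U n x) \<partial>\<mu> i) = (SUP n. \<integral>\<^sup>+ x. U n x \<partial>\<mu> i)" if "i \<in> S" for i
    using seq s[OF that]
    by (intro nn_integral_monotone_convergence_SUP) (simp_all add: measurable_cong_sets[OF s[OF that] refl])
  moreover have "(\<integral>\<^sup>+ x. (SUP n. U n x) \<partial>msum S \<mu>) = (SUP n. \<integral>\<^sup>+ x. U n x \<partial>msum S \<mu>)"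
    using seq by (intro nn_integral_monotone_convergence_SUP) (simp_all add: measurable_cong_sets[OF sets_msum refl])
  moreover have "(\<integral>\<^sup>+ i. (SUP n. \<integral>\<^sup>+ x. U n x \<partial>\<mu> i) \<partial>count_space S)
      = (SUP n. \<integral>\<^sup>+ i. (\<integral>\<^sup>+ x. U n x \<partial>\<mu> i) \<partial>count_space S)"
    using seq by (intro nn_integral_monotone_convergence_SUP)
      (auto simp: incseq_def le_fun_def intro!: nn_integral_mono)
  moreover have "(\<integral>\<^sup>+ i. (\<integral>\<^sup>+ x. (SUP n. U n x) \<partial>\<mu> i) \<partial>count_space S)
      = (\<integral>\<^sup>+ i. (SUP n. \<integral>\<^sup>+ x. U n x \<partial>\<mu> i) \<partial>count_space S)"
    by (intro nn_integral_cong) (simp add: calculation(1))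
  ultimately show ?case using seq by (simp add: image_comp)
qed

text \<open>Finite total mass leaves little mass outside a finite set \<open>F\<close> of indices;
  the finitely many remaining measures are approximated one by one, and the finite union of their
  compact sets is compact.\<close>

lemma fradon_msum:
  fixes \<mu> :: "'i \<Rightarrow> 'a::t2_space measure"
  assumes r: "\<And>i. i \<in> S \<Longrightarrow> fradon (\<mu> i)" and c: "countable S"
    and fin: "(\<integral>\<^sup>+ i. emeasure (\<mu> i) UNIV \<partial>count_space S) < \<infinity>"
  shows "fradon (msum S \<mu>)"
proof (rule fradonI)
  have s: "\<And>i. i \<in> S \<Longrightarrow> sets (\<mu> i) = sets borel" using r fradon_sets by blast
  show "emeasure (msum S \<mu>) UNIV < \<infinity>" using fin s by (simp add: emeasure_msum)
  fix B :: "'a set" and e :: real assume B: "B \<in> sets borel" and e: "e > 0"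
  let ?f = "\<lambda>i. emeasure (\<mu> i) UNIV"
  have "infsum ?f S = (SUP F\<in>{F. finite F \<and> F \<subseteq> S}. sum ?f F)"
    by (rule nonneg_infsum_complete) simp
  moreover have "infsum ?f S < \<infinity>" using fin c by (simp add: infsum_eq_nn_integral_count_space)
  ultimately obtain F where F: "finite F" "F \<subseteq> S" "infsum ?f S < sum ?f F + ennreal (e/2)"
    using SUP_approx_ennreal[of "e/2" "{F. finite F \<and> F \<subseteq> S}" "infsum ?f S" "sum ?f"] e
    by (auto simp: less_top[symmetric])
  have split: "(\<integral>\<^sup>+ i. h i \<partial>count_space S) = sum h F + (\<integral>\<^sup>+ i. h i * indicator (-F) i \<partial>count_space S)"
    for h :: "'i \<Rightarrow> ennreal"
  proof -
    have "(\<integral>\<^sup>+ i. h i \<partial>count_space S) = (\<integral>\<^sup>+ i. h i * indicator F i + h i * indicator (-F) i \<partial>count_space S)"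
      by (rule nn_integral_cong) (auto split: split_indicator)
    also have "\<dots> = (\<integral>\<^sup>+ i. h i * indicator F i \<partial>count_space S) + (\<integral>\<^sup>+ i. h i * indicator (-F) i \<partial>count_space S)"
      by (rule nn_integral_add) auto
    also have "(\<integral>\<^sup>+ i. h i * indicator F i \<partial>count_space S) = sum h F"
      using F by (subst nn_integral_count_space'[where A=F]) (auto simp: indicator_def intro!: sum.cong)
    finally show ?thesis .
  qed
  have tail: "(\<integral>\<^sup>+ i. ?f i * indicator (-F) i \<partial>count_space S) \<le> ennreal (e/2)"
  proof -
    have "sum ?f F + (\<integral>\<^sup>+ i. ?f i * indicator (-F) i \<partial>count_space S) < sum ?f F + ennreal (e/2)"
      using F(3) unfolding infsum_eq_nn_integral_count_space[OF c] split[of ?f] .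
    then have "(\<integral>\<^sup>+ i. ?f i * indicator (-F) i \<partial>count_space S) < ennreal (e/2)"
      by (simp add: ennreal_add_left_cancel_less)
    then show ?thesis by (rule less_imp_le)
  qed
  \<comment> \<open>The errors over \<open>F\<close> add up to at most \<open>e / 2\<close>, the
    other half being the tail; the \<open>+ 1\<close> covers an empty \<open>F\<close>.\<close>
  define d where "d = e / (2 * (card F + 1))"
  have d: "d > 0" using e by (simp add: d_def)
  have "\<forall>i\<in>F. \<exists>K. compact K \<and> K \<subseteq> B \<and> measure (\<mu> i) (B - K) \<le> d"
    using fradon_inner_regular[OF r B d] F by blast
  then obtain K where K: "\<And>i. i \<in> F \<Longrightarrow> compact (K i) \<and> K i \<subseteq> B \<and> measure (\<mu> i) (B - K i) \<le> d"
    by metis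
  define L where "L = (\<Union>i\<in>F. K i)"
  have L: "compact L" "L \<subseteq> B" using K F by (auto simp: L_def intro!: compact_UN)
  have Lm: "L \<in> sets borel" using L by (simp add: borel_compact)
  have "emeasure (msum S \<mu>) (B - L) = (\<integral>\<^sup>+ i. emeasure (\<mu> i) (B - L) \<partial>count_space S)"
    using B Lm s by (intro emeasure_msum) auto
  also have "\<dots> = (\<Sum>i\<in>F. emeasure (\<mu> i) (B - L)) + (\<integral>\<^sup>+ i. emeasure (\<mu> i) (B - L) * indicator (-F) i \<partial>count_space S)"
    by (rule split)
  also have "\<dots> \<le> (\<Sum>i\<in>F. ennreal d) + (\<integral>\<^sup>+ i. ?f i * indicator (-F) i \<partial>count_space S)"
  proof (intro add_mono sum_mono nn_integral_mono mult_right_mono)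
    fix i assume i: "i \<in> F"
    have iS: "i \<in> S" using i F by auto
    have "K i \<in> sets borel" using K[OF i] by (simp add: borel_compact)
    then have "emeasure (\<mu> i) (B - L) \<le> emeasure (\<mu> i) (B - K i)"
      using i s[OF iS] B by (intro emeasure_mono) (auto simp: L_def)
    also have "\<dots> \<le> ennreal d" using K[OF i] r[OF iS] by (simp add: fradon_emeasure ennreal_leI)
    finally show "emeasure (\<mu> i) (B - L) \<le> ennreal d" .
  next
    fix i assume "i \<in> space (count_space S)"
    then show "emeasure (\<mu> i) (B - L) \<le> emeasure (\<mu> i) UNIV" using s by (intro emeasure_mono) auto
  qed auto
  also have "\<dots> \<le> ennreal (card F * d) + ennreal (e/2)"
    using tail d by (intro add_mono) (auto simp: ennreal_mult ennreal_of_nat_eq_real_of_nat)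
  also have "\<dots> \<le> ennreal (e/2 + e/2)"
    using e by (subst ennreal_plus[symmetric]) (auto simp: d_def field_simps intro!: ennreal_leI)
  finally have "emeasure (msum S \<mu>) (B - L) \<le> ennreal e" by simp
  then have "measure (msum S \<mu>) (B - L) \<le> e" unfolding measure_def
    using e by (metis enn2real_ennreal enn2real_mono ennreal_less_top less_eq_real_def)
  then show "\<exists>K. compact K \<and> K \<subseteq> B \<and> measure (msum S \<mu>) (B - K) \<le> e" using L by blast
qed simp

section \<open>Binary sums, multiples and restrictions\<close>

definition madd :: "'a::topological_space measure \<Rightarrow> 'a measure \<Rightarrow> 'a measure" where
  "madd M N = msum UNIV (\<lambda>b. if b then M else N)"

lemma sets_madd [simp, measurable_cong]: "sets (madd M N) = sets borel"
  by (simp add: madd_def)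

lemma nn_integral_madd:
  assumes "sets M = sets borel" "sets N = sets borel" "f \<in> borel_measurable borel"
  shows "(\<integral>\<^sup>+ x. f x \<partial>madd M N) = (\<integral>\<^sup>+ x. f x \<partial>M) + (\<integral>\<^sup>+ x. f x \<partial>N)"
  unfolding madd_def using assms
  by (subst nn_integral_msum) (auto simp: nn_integral_count_space_finite UNIV_bool)

lemma fradon_madd: "fradon M \<Longrightarrow> fradon N \<Longrightarrow> fradon (madd M N)"
  unfolding madd_def
  by (rule fradon_msum) (auto simp: nn_integral_count_space_finite UNIV_bool fradon_def)

lemma fradon_scale:
  fixes M :: "'a::t2_space measure"
  assumes M: "fradon M" and c: "c < \<infinity>"
  shows "fradon (scale_measure c M)"
proof (rule fradonI)
  show "sets (scale_measure c M) = sets borel" using M by (simp add: fradon_sets)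
  show "emeasure (scale_measure c M) UNIV < \<infinity>"
    using M c by (simp add: fradon_def ennreal_mult_less_top)
  fix B :: "'a set" and e :: real assume B: "B \<in> sets borel" and e: "e > 0"
  obtain r where r: "c = ennreal r" "r \<ge> 0" using c by (cases c) auto
  have "e / (r + 1) > 0" using e r by simp
  from fradon_inner_regular[OF M B this] obtain K
    where K: "compact K" "K \<subseteq> B" "measure M (B - K) \<le> e / (r + 1)" by blast
  have "measure (scale_measure c M) (B - K) = r * measure M (B - K)"
    using r by simp
  also have "\<dots> \<le> r * (e / (r+1))" using K r by (intro mult_left_mono) auto
  also have "\<dots> \<le> e" using r e by (simp add: field_simps)
  finally show "\<exists>K. compact K \<and> K \<subseteq> B \<and> measure (scale_measure c M) (B - K) \<le> e" using K by blast
qed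

definition restr :: "'a measure \<Rightarrow> 'a set \<Rightarrow> 'a measure" where
  "restr M B = density M (indicator B)"

lemma sets_restr [simp, measurable_cong]: "sets (restr M B) = sets M"
  by (simp add: restr_def)

lemma emeasure_restr: "B \<in> sets M \<Longrightarrow> C \<in> sets M \<Longrightarrow> emeasure (restr M B) C = emeasure M (B \<inter> C)"
  unfolding restr_def by (subst emeasure_density) (auto simp flip: indicator_inter_arith)

lemma nn_integral_restr:
  "B \<in> sets M \<Longrightarrow> f \<in> borel_measurable M \<Longrightarrow> (\<integral>\<^sup>+ x. f x \<partial>restr M B) = (\<integral>\<^sup>+ x. f x * indicator B x \<partial>M)"
  unfolding restr_def by (subst nn_integral_density) (auto simp: mult.commute)

lemma fradon_restr:
  fixes M :: "'a::t2_space measure"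
  assumes M: "fradon M" and B: "B \<in> sets borel"
  shows "fradon (restr M B)"
proof (rule fradonI)
  note s = fradon_sets[OF M]
  show "sets (restr M B) = sets borel" using s by simp
  have "emeasure (restr M B) UNIV \<le> emeasure M UNIV"
    using B s by (simp add: emeasure_restr emeasure_mono)
  then show "emeasure (restr M B) UNIV < \<infinity>" using M by (auto simp: fradon_def)
  fix C :: "'a set" and e :: real assume C: "C \<in> sets borel" and e: "e > 0"
  from fradon_inner_regular[OF M C e] obtain K where K: "compact K" "K \<subseteq> C" "measure M (C - K) \<le> e" by blast
  have Km: "K \<in> sets borel" using K by (simp add: borel_compact)
  have "measure (restr M B) (C - K) = measure M (B \<inter> (C - K))"
    using B C Km s by (simp add: measure_def emeasure_restr)
  also have "\<dots> \<le> measure M (C - K)"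
    using B C Km s by (intro finite_measure.finite_measure_mono[OF fradon_finite_measure[OF M]]) auto
  finally show "\<exists>K. compact K \<and> K \<subseteq> C \<and> measure (restr M B) (C - K) \<le> e" using K by fastforce
qed

section \<open>Lower semicontinuous kernels\<close>

lemma lsc_open: "lsc f \<Longrightarrow> open {x. c < f x}"
  unfolding lsc_def eventually_nhds by (subst open_subopen) fastforce

lemma lscI: "(\<And>c. open {x. c < f x}) \<Longrightarrow> lsc f"
  unfolding lsc_def eventually_nhds by blast

lemma lsc_measurable: "lsc f \<Longrightarrow> f \<in> borel_measurable borel"
  by (rule borel_measurableI_greater) (simp add: lsc_open borel_open)

lemma lsc_SUP: "(\<And>i. i \<in> I \<Longrightarrow> lsc (f i)) \<Longrightarrow> lsc (\<lambda>x. SUP i\<in>I. f i x)"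
proof (rule lscI)
  fix c assume f: "\<And>i. i \<in> I \<Longrightarrow> lsc (f i)"
  have "{x. c < (SUP i\<in>I. f i x)} = (\<Union>i\<in>I. {x. c < f i x})" by (auto simp: less_SUP_iff)
  then show "open {x. c < (SUP i\<in>I. f i x)}" using f by (auto intro!: lsc_open)
qed

text \<open>Continuity from below holds for directed families of any cardinality, because a compact
  subset of the union is covered by finitely many members and hence, by directedness, by a single
  one.\<close>

lemma radon_SUP_open:
  assumes M: "radon M" and o: "\<And>i. i \<in> I \<Longrightarrow> open (U i)" and ne: "I \<noteq> {}"
    and dir: "\<And>i j. i \<in> I \<Longrightarrow> j \<in> I \<Longrightarrow> \<exists>k\<in>I. U i \<subseteq> U k \<and> U j \<subseteq> U k"
  shows "emeasure M (\<Union>i\<in>I. U i) = (SUP i\<in>I. emeasure M (U i))"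
proof (rule antisym)
  have s: "sets M = sets borel" using M by (simp add: radon_def)
  have "emeasure M (\<Union>i\<in>I. U i) = (SUP K\<in>{K. compact K \<and> K \<subseteq> (\<Union>i\<in>I. U i)}. emeasure M K)"
    using M o unfolding radon_def by (metis open_UN)
  also have "\<dots> \<le> (SUP i\<in>I. emeasure M (U i))"
  proof (rule SUP_least, clarify)
    fix K assume K: "compact K" "K \<subseteq> (\<Union>i\<in>I. U i)"
    then obtain J where J: "finite J" "J \<subseteq> I" "K \<subseteq> (\<Union>i\<in>J. U i)"
      using o by (metis compactE_image)
    have "\<exists>k\<in>I. (\<Union>i\<in>J. U i) \<subseteq> U k" using J(1,2)
    proof (induction J)
      case empty then show ?case using ne by auto
    next
      case (insert j J)
      then obtain k where k: "k \<in> I" "(\<Union>i\<in>J. U i) \<subseteq> U k" by auto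
      with dir[of j k] insert.prems show ?case by (auto; blast)
    qed
    then obtain k where k: "k \<in> I" "K \<subseteq> U k" using J by auto
    have "emeasure M K \<le> emeasure M (U k)"
      using k o s by (intro emeasure_mono) (auto)
    also have "\<dots> \<le> (SUP i\<in>I. emeasure M (U i))" using k by (intro SUP_upper)
    finally show "emeasure M K \<le> (SUP i\<in>I. emeasure M (U i))" .
  qed
  finally show "emeasure M (\<Union>i\<in>I. U i) \<le> (SUP i\<in>I. emeasure M (U i))" .
  show "(SUP i\<in>I. emeasure M (U i)) \<le> emeasure M (\<Union>i\<in>I. U i)"
    using o s by (intro SUP_least emeasure_mono) (auto intro!: borel_open open_UN)
qed

text \<open>Directedness provides one index that serves all summands at once, so near-optimal
  choices for the separate suprema can be merged.\<close>

lemma SUP_sum_directed_ennreal: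
  fixes g :: "'k \<Rightarrow> 'i \<Rightarrow> ennreal"
  assumes fin: "finite A" and ne: "I \<noteq> {}"
    and dir: "\<And>i j. i \<in> I \<Longrightarrow> j \<in> I \<Longrightarrow> \<exists>l\<in>I. \<forall>k\<in>A. g k i \<le> g k l \<and> g k j \<le> g k l"
  shows "(SUP i\<in>I. \<Sum>k\<in>A. g k i) = (\<Sum>k\<in>A. SUP i\<in>I. g k i)"
  using fin dir
proof (induction A)
  case empty then show ?case using ne by simp
next
  case (insert a A)
  have "(SUP i\<in>I. g a i + (\<Sum>k\<in>A. g k i)) = (SUP i\<in>I. g a i) + (SUP i\<in>I. \<Sum>k\<in>A. g k i)"
  proof (rule SUP_add_directed_ennreal)
    fix i j assume "i \<in> I" "j \<in> I"
    from insert.prems[OF this] obtain l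
      where "l \<in> I" "\<forall>k\<in>insert a A. g k i \<le> g k l \<and> g k j \<le> g k l" by blast
    then show "\<exists>l\<in>I. g a i + (\<Sum>k\<in>A. g k j) \<le> g a l + (\<Sum>k\<in>A. g k l)"
      by (intro bexI[of _ l]) (auto intro!: add_mono sum_mono)
  qed
  moreover have "(SUP i\<in>I. \<Sum>k\<in>A. g k i) = (\<Sum>k\<in>A. SUP i\<in>I. g k i)"
  proof (rule insert.IH)
    fix i j assume "i \<in> I" "j \<in> I"
    from insert.prems[OF this] show "\<exists>l\<in>I. \<forall>k\<in>A. g k i \<le> g k l \<and> g k j \<le> g k l" by blast
  qed
  ultimately show ?case using insert.hyps by simp
qed

text \<open>The sum counts the grid points \<open>k/m\<close> strictly below \<open>y\<close>, up to
  height \<open>n\<close>. Integrals of such staircases are finite combinations of measures of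
  superlevel sets, which are open for a lower semicontinuous function.\<close>

lemma staircase_bounds:
  fixes y :: ennreal and n m :: nat
  assumes m: "m > 0"
  defines "s \<equiv> (\<Sum>k=1..n*m. ennreal (1/m) * indicator {y. ennreal (k/m) < y} y)"
  shows "s \<le> y" "min y (of_nat n) \<le> s + ennreal (1/m)"
proof -
  let ?C = "{k\<in>{1..n*m}. ennreal (k/m) < y}"
  have s: "s = of_nat (card ?C) * ennreal (1/m)"
  proof -
    have "(\<Sum>k\<in>?C. ennreal (1/m)) = (\<Sum>k=1..n*m. if ennreal (k/m) < y then ennreal (1/m) else 0)"
      by (rule sum.inter_filter) simp
    also have "\<dots> = s" unfolding s_def by (intro sum.cong) auto
    finally show ?thesis by simp
  qed
  have s': "s = ennreal (card ?C / m)"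
    unfolding s using m by (simp add: ennreal_of_nat_eq_real_of_nat flip: ennreal_mult)
  show "s \<le> y"
  proof (cases y)
    case (real r)
    have "?C \<subseteq> {1..nat \<lfloor>r * m\<rfloor>}"
    proof
      fix k assume k: "k \<in> ?C"
      then have "real k / m < r" using real by (simp add: ennreal_less_iff)
      then have "real k < r * m" using m by (simp add: field_simps)
      then have "k \<le> nat \<lfloor>r * m\<rfloor>" by (simp add: le_nat_iff le_floor_iff)
      then show "k \<in> {1..nat \<lfloor>r * m\<rfloor>}" using k by auto
    qed
    then have "card ?C \<le> nat \<lfloor>r * m\<rfloor>" using card_mono[of "{1..nat \<lfloor>r * m\<rfloor>}" ?C] by simp
    moreover have "real (nat \<lfloor>r * m\<rfloor>) \<le> r * m" using real by (intro of_nat_floor) simp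
    ultimately have "real (card ?C) \<le> r * m" by linarith
    then have "card ?C / m \<le> r" using m by (simp add: field_simps)
    then show ?thesis using s' real by (simp add: ennreal_leI)
  qed simp
  show "min y (of_nat n) \<le> s + ennreal (1/m)"
  proof -
    have "min y (of_nat n) < \<infinity>" by (simp add: min_less_iff_disj ennreal_of_nat_eq_real_of_nat)
    then obtain r where r: "min y (of_nat n) = ennreal r" "r \<ge> 0" by (cases "min y (of_nat n)") auto
    have rn: "r \<le> n" using r by (metis ennreal_le_iff ennreal_of_nat_eq_real_of_nat min.cobounded2 of_nat_0_le_iff)
    have ry: "ennreal r \<le> y" using r by (metis min.cobounded1)
    have "{1..nat (\<lceil>r * m\<rceil> - 1)} \<subseteq> ?C"
    proof
      fix k assume k: "k \<in> {1..nat (\<lceil>r * m\<rceil> - 1)}"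
      then have "int k < \<lceil>r * m\<rceil>" by auto
      then have k1: "real k < r * m" by (simp add: less_ceiling_iff)
      then have "real k / m < r" using m by (simp add: field_simps)
      then have "ennreal (k/m) < y" using ry r by (metis divide_nonneg_nonneg ennreal_less_iff of_nat_0_le_iff order_less_le_trans)
      moreover have "k \<le> n * m"
      proof -
        have "real k \<le> real n * real m" using k1 rn m by (meson less_imp_le mult_right_mono of_nat_0_le_iff order_trans)
        then show ?thesis by (metis of_nat_le_iff of_nat_mult)
      qed
      ultimately show "k \<in> ?C" using k by auto
    qed
    then have "nat (\<lceil>r * m\<rceil> - 1) \<le> card ?C"
      using card_mono[of ?C "{1..nat (\<lceil>r * m\<rceil> - 1)}"] by simp
    then have "r * m - 1 \<le> real (card ?C)" by linarith
    then have "r \<le> card ?C / m + 1 / m" using m by (simp add: field_simps)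
    then have "ennreal r \<le> ennreal (card ?C / m + 1/m)" by (rule ennreal_leI)
    also have "\<dots> = ennreal (card ?C / m) + ennreal (1/m)" by (rule ennreal_plus) auto
    finally show ?thesis using r s' by simp
  qed
qed

text \<open>Inner regularity on open sets is what allows directed families that are not sequences.\<close>

lemma nn_integral_SUP_directed_lsc:
  assumes M: "fradon M" and l: "\<And>i. i \<in> I \<Longrightarrow> lsc (f i)" and ne: "I \<noteq> {}"
    and dir: "\<And>i j. i \<in> I \<Longrightarrow> j \<in> I \<Longrightarrow> \<exists>k\<in>I. f i \<le> f k \<and> f j \<le> f k"
  shows "(\<integral>\<^sup>+ x. (SUP i\<in>I. f i x) \<partial>M) = (SUP i\<in>I. \<integral>\<^sup>+ x. f i x \<partial>M)"
proof (rule antisym)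
  note s = fradon_sets[OF M]
  let ?F = "\<lambda>x. SUP i\<in>I. f i x" and ?S = "SUP i\<in>I. \<integral>\<^sup>+ x. f i x \<partial>M"
  have lF: "lsc ?F" using l by (rule lsc_SUP)
  have [measurable]: "?F \<in> borel_measurable M" "\<And>i. i \<in> I \<Longrightarrow> f i \<in> borel_measurable M"
    using lsc_measurable[OF lF] lsc_measurable[OF l] s by (auto cong: measurable_cong_sets)
  have opM: "{x. c < g x} \<in> sets M" if "lsc g" for g and c :: ennreal using that s by (simp add: lsc_open)
  have bound: "(\<integral>\<^sup>+ x. min (?F x) (of_nat n) \<partial>M) \<le> ?S" for n :: nat
  proof (rule ennreal_le_epsilon)
    fix e :: real assume e: "e > 0"
    \<comment> \<open>The mesh \<open>1/m\<close> costs \<open>1/m\<close> times the total mass;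
      this is where finiteness of \<open>M\<close> enters.\<close>
    obtain m :: nat where m: "m > 0" "measure M UNIV / m \<le> e"
    proof -
      obtain m :: nat where m: "measure M UNIV / e < m" using reals_Archimedean2 by blast
      then have "real m > 0" using e by (smt (verit) divide_nonneg_pos measure_nonneg)
      then show ?thesis using that[of m] m e by (simp add: field_simps)
    qed
    define T where "T k g = {x. ennreal (real k/m) < g x}" for k and g :: "'a \<Rightarrow> ennreal"
    have st: "(\<integral>\<^sup>+ x. (\<Sum>k=1..n*m. ennreal (1/m) * indicator {y. ennreal (real k/m) < y} (g x)) \<partial>M)
       = (\<Sum>k=1..n*m. ennreal (1/m) * emeasure M (T k g))" if "lsc g" for g
    proof -
      have "(\<integral>\<^sup>+ x. (\<Sum>k=1..n*m. ennreal (1/m) * indicator {y. ennreal (real k/m) < y} (g x)) \<partial>M)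
         = (\<integral>\<^sup>+ x. (\<Sum>k=1..n*m. ennreal (1/m) * indicator (T k g) x) \<partial>M)"
        by (intro nn_integral_cong sum.cong) (auto simp: T_def indicator_def)
      also have "\<dots> = (\<Sum>k=1..n*m. \<integral>\<^sup>+ x. ennreal (1/m) * indicator (T k g) x \<partial>M)"
        using opM[OF that] by (intro nn_integral_sum) (auto simp: T_def)
      also have "\<dots> = (\<Sum>k=1..n*m. ennreal (1/m) * emeasure M (T k g))"
        using opM[OF that] by (intro sum.cong nn_integral_cmult_indicator) (auto simp: T_def)
      finally show ?thesis .
    qed
    \<comment> \<open>A strict superlevel set of a supremum is the union of those of the members, so
      continuity along directed open sets applies level by level.\<close>
    have TF: "emeasure M (T k ?F) = (SUP i\<in>I. emeasure M (T k (f i)))" for k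
    proof -
      have "T k ?F = (\<Union>i\<in>I. T k (f i))" by (auto simp: T_def less_SUP_iff)
      also have "emeasure M \<dots> = (SUP i\<in>I. emeasure M (T k (f i)))"
      proof (rule radon_SUP_open)
        show "radon M" using M by (simp add: fradon_def)
        fix i j assume "i \<in> I" "j \<in> I"
        from dir[OF this] obtain l where "l \<in> I" "f i \<le> f l" "f j \<le> f l" by blast
        then show "\<exists>l\<in>I. T k (f i) \<subseteq> T k (f l) \<and> T k (f j) \<subseteq> T k (f l)"
          by (intro bexI[of _ l]) (auto simp: T_def le_fun_def intro: less_le_trans)
      qed (use ne l in \<open>auto simp: T_def lsc_open\<close>)
      finally show ?thesis .
    qed
    have "(\<integral>\<^sup>+ x. min (?F x) (of_nat n) \<partial>M) \<le> (\<integral>\<^sup>+ x. (\<Sum>k=1..n*m. ennreal (1/m) * indicator {y. ennreal (real k/m) < y} (?F x)) + ennreal (1/m) \<partial>M)"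
      using staircase_bounds(2)[OF m(1)] by (intro nn_integral_mono) simp
    also have "\<dots> = (\<integral>\<^sup>+ x. (\<Sum>k=1..n*m. ennreal (1/m) * indicator {y. ennreal (real k/m) < y} (?F x)) \<partial>M) + ennreal (1/m) * emeasure M UNIV"
      using fradon_space[OF M] by (subst nn_integral_add) (auto)
    also have "\<dots> \<le> (\<Sum>k=1..n*m. ennreal (1/m) * (SUP i\<in>I. emeasure M (T k (f i)))) + ennreal e"
      using m fradon_emeasure[OF M, of UNIV] unfolding st[OF lF] TF
      by (intro add_mono order_refl) (auto simp: ennreal_leI simp flip: ennreal_mult)
    also have "(\<Sum>k=1..n*m. ennreal (1/m) * (SUP i\<in>I. emeasure M (T k (f i))))
        = (SUP i\<in>I. \<Sum>k=1..n*m. ennreal (1/m) * emeasure M (T k (f i)))"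
      unfolding SUP_mult_left_ennreal
    proof (rule SUP_sum_directed_ennreal[symmetric])
      fix i j assume "i \<in> I" "j \<in> I"
      from dir[OF this] obtain l where l': "l \<in> I" "f i \<le> f l" "f j \<le> f l" by blast
      have "ennreal (1/m) * emeasure M (T k (f i)) \<le> ennreal (1/m) * emeasure M (T k (f l)) \<and>
            ennreal (1/m) * emeasure M (T k (f j)) \<le> ennreal (1/m) * emeasure M (T k (f l))" for k
        using l' opM[OF l[OF l'(1)], of "ennreal (real k/m)"]
        by (intro conjI mult_left_mono emeasure_mono) (auto simp: T_def le_fun_def intro: less_le_trans)
      then show "\<exists>l\<in>I. \<forall>k\<in>{1..n*m}. ennreal (1/m) * emeasure M (T k (f i)) \<le> ennreal (1/m) * emeasure M (T k (f l)) \<and>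
            ennreal (1/m) * emeasure M (T k (f j)) \<le> ennreal (1/m) * emeasure M (T k (f l))"
        using l' by blast
    qed (use ne in auto)
    also have "\<dots> \<le> ?S"
    proof (rule SUP_mono)
      fix i assume i: "i \<in> I"
      have "(\<Sum>k=1..n*m. ennreal (1/m) * emeasure M (T k (f i))) \<le> (\<integral>\<^sup>+ x. f i x \<partial>M)"
        unfolding st[OF l[OF i], symmetric] using staircase_bounds(1)[OF m(1)] by (intro nn_integral_mono) simp
      then show "\<exists>j\<in>I. (\<Sum>k=1..n*m. ennreal (1/m) * emeasure M (T k (f i))) \<le> (\<integral>\<^sup>+ x. f j x \<partial>M)"
        using i by blast
    qed
    finally show "(\<integral>\<^sup>+ x. min (?F x) (of_nat n) \<partial>M) \<le> ?S + ennreal e" by (simp add: add_right_mono)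
  qed
  have "(\<integral>\<^sup>+ x. ?F x \<partial>M) = (\<integral>\<^sup>+ x. (SUP n. min (?F x) (of_nat n)) \<partial>M)"
  proof (rule nn_integral_cong)
    fix x
    have "(SUP n. min (?F x) (of_nat n)) = min (?F x) (SUP n. of_nat n :: ennreal)"
      by (simp add: inf_SUP inf_min[symmetric])
    then show "?F x = (SUP n. min (?F x) (of_nat n))" by (simp add: ennreal_SUP_of_nat_eq_top)
  qed
  also have "\<dots> = (SUP n. \<integral>\<^sup>+ x. min (?F x) (of_nat n) \<partial>M)"
    by (rule nn_integral_monotone_convergence_SUP)
       (auto simp: incseq_def le_fun_def min_le_iff_disj)
  also have "\<dots> \<le> ?S" using bound by (rule SUP_least)
  finally show "(\<integral>\<^sup>+ x. ?F x \<partial>M) \<le> ?S" .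
  show "?S \<le> (\<integral>\<^sup>+ x. ?F x \<partial>M)"
    by (intro SUP_least nn_integral_mono SUP_upper)
qed

section \<open>Approximation of the kernel by open rectangles\<close>

definition rect_approx :: "(ennreal \<times> 'a set \<times> 'a set) set \<Rightarrow> 'a \<Rightarrow> 'a \<Rightarrow> ennreal" where
  "rect_approx S x y = (SUP t\<in>S. fst t * indicator (fst (snd t)) x * indicator (snd (snd t)) y)"

text \<open>Open rectangles carrying a constant minorant of the kernel. Finite subsets are directed
  under union, and their step kernels are measurable for the product of the Borel algebras.\<close>

definition rects :: "('a::topological_space \<Rightarrow> 'a \<Rightarrow> ennreal) \<Rightarrow> (ennreal \<times> 'a set \<times> 'a set) set" where
  "rects k = {(c, U, V). open U \<and> open V \<and> (\<forall>x\<in>U. \<forall>y\<in>V. c \<le> k x y)}"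

lemma rect_approx_mono: "S \<subseteq> T \<Longrightarrow> rect_approx S x y \<le> rect_approx T x y"
  unfolding rect_approx_def by (rule SUP_subset_mono) auto

text \<open>For \<open>c < k x y\<close>, lower semicontinuity keeps \<open>k\<close> above
  \<open>c\<close> on some open rectangle around \<open>(x, y)\<close>, so one rectangle already
  attains the value \<open>c\<close> there.\<close>

lemma SUP_rect_approx:
  fixes k :: "'a::topological_space \<Rightarrow> 'a \<Rightarrow> ennreal"
  assumes k: "lsc (\<lambda>(x, y). k x y)"
  shows "(SUP S\<in>{S. finite S \<and> S \<subseteq> rects k}. rect_approx S x y) = k x y"
proof (rule antisym)
  show "(SUP S\<in>{S. finite S \<and> S \<subseteq> rects k}. rect_approx S x y) \<le> k x y"
  proof (intro SUP_least)
    fix S assume "S \<in> {S. finite S \<and> S \<subseteq> rects k}"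
    then have S: "S \<subseteq> rects k" unfolding mem_Collect_eq by (rule conjunct2)
    have "fst t * indicator (fst (snd t)) x * indicator (snd (snd t)) y \<le> k x y" if "t \<in> S" for t
    proof -
      have "t \<in> rects k" using that S by (rule subsetD[rotated])
      then show ?thesis by (cases t; cases "x \<in> fst (snd t)"; cases "y \<in> snd (snd t)") (simp_all add: rects_def)
    qed
    then show "rect_approx S x y \<le> k x y" unfolding rect_approx_def by (rule SUP_least)
  qed
  show "k x y \<le> (SUP S\<in>{S. finite S \<and> S \<subseteq> rects k}. rect_approx S x y)"
  proof (rule dense_le)
    fix c assume "c < k x y"
    then have "(x, y) \<in> {p. c < (\<lambda>(x, y). k x y) p}" by simp
    then obtain U V where UV: "open U" "open V" "x \<in> U" "y \<in> V" "U \<times> V \<subseteq> {p. c < (\<lambda>(x, y). k x y) p}"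
      using open_prod_elim[OF lsc_open[OF k]] by (metis mem_Sigma_iff)
    then have "{(c, U, V)} \<in> {S. finite S \<and> S \<subseteq> rects k}"
      by (auto simp: rects_def less_imp_le)
    moreover have "rect_approx {(c, U, V)} x y = c" using UV by (simp add: rect_approx_def)
    ultimately show "c \<le> (SUP S\<in>{S. finite S \<and> S \<subseteq> rects k}. rect_approx S x y)"
      by (intro SUP_upper2[where i="{(c, U, V)}"]) auto
  qed
qed

lemma lsc_rect_approx:
  assumes "S \<subseteq> rects k" shows "lsc (rect_approx S x)"
  unfolding rect_approx_def
proof (rule lsc_SUP, rule lscI)
  fix t c assume "t \<in> S"
  then have "open (snd (snd t))" using assms by (auto simp: rects_def)
  moreover have "{y. c < fst t * indicator (fst (snd t)) x * indicator (snd (snd t)) y}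
     = (if c < fst t * indicator (fst (snd t)) x then snd (snd t) else {})"
    by (auto split: split_indicator split_indicator_asm)
  ultimately show "open {y. c < fst t * indicator (fst (snd t)) x * indicator (snd (snd t)) y}" by simp
qed

text \<open>Let \<open>W\<close> be the intersection of the finitely many first sides containing
  \<open>x\<close>. Moving \<open>x\<close> inside \<open>W\<close> leaves none of these rectangles
  and may enter others, so the integrand can only grow on this neighbourhood.\<close>

lemma lsc_integral_rect_approx:
  assumes "S \<subseteq> rects k" "finite S" shows "lsc (\<lambda>x. \<integral>\<^sup>+ y. rect_approx S x y \<partial>N)"
  unfolding lsc_def
proof (intro allI impI)
  fix x c assume c: "c < (\<integral>\<^sup>+ y. rect_approx S x y \<partial>N)"
  define W where "W = (\<Inter>t\<in>{t\<in>S. x \<in> fst (snd t)}. fst (snd t))"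
  have W: "open W" "x \<in> W" unfolding W_def using assms by (auto simp: rects_def intro!: open_INT)
  have "(\<integral>\<^sup>+ y. rect_approx S x y \<partial>N) \<le> (\<integral>\<^sup>+ y. rect_approx S x' y \<partial>N)" if "x' \<in> W" for x'
    unfolding rect_approx_def
  proof (intro nn_integral_mono SUP_mono bexI)
    fix y t assume "t \<in> S"
    then have "x \<in> fst (snd t) \<Longrightarrow> x' \<in> fst (snd t)" using that unfolding W_def by blast
    then show "fst t * indicator (fst (snd t)) x * indicator (snd (snd t)) y
        \<le> fst t * indicator (fst (snd t)) x' * indicator (snd (snd t)) y"
      by (cases "x \<in> fst (snd t)") auto
  qed
  then show "\<forall>\<^sub>F x' in nhds x. c < (\<integral>\<^sup>+ y. rect_approx S x' y \<partial>N)"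
    unfolding eventually_nhds using W c by (intro exI[of _ W]) (auto intro: less_le_trans)
qed

lemma lsc_slice: "lsc (\<lambda>(x, y). k x y) \<Longrightarrow> lsc (k x)"
proof (rule lscI)
  fix c assume "lsc (\<lambda>(x, y). k x y)"
  from open_vimage[OF lsc_open[OF this], of "Pair x" c]
  show "open {y. c < k x y}" by (simp add: vimage_def continuous_intros)
qed

lemma pot_eq_SUP:
  assumes k: "lsc (\<lambda>(x, y). k x y)" and N: "fradon N"
  shows "pot k N x = (SUP S\<in>{S. finite S \<and> S \<subseteq> rects k}. \<integral>\<^sup>+ y. rect_approx S x y \<partial>N)"
proof -
  have "pot k N x = (\<integral>\<^sup>+ y. (SUP S\<in>{S. finite S \<and> S \<subseteq> rects k}. rect_approx S x y) \<partial>N)"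
    by (simp add: pot_def SUP_rect_approx[OF k])
  also have "\<dots> = (SUP S\<in>{S. finite S \<and> S \<subseteq> rects k}. \<integral>\<^sup>+ y. rect_approx S x y \<partial>N)"
  proof (rule nn_integral_SUP_directed_lsc[OF N])
  fix S T assume "S \<in> {S. finite S \<and> S \<subseteq> rects k}" "T \<in> {S. finite S \<and> S \<subseteq> rects k}"
  then show "\<exists>U\<in>{S. finite S \<and> S \<subseteq> rects k}. rect_approx S x \<le> rect_approx U x \<and> rect_approx T x \<le> rect_approx U x"
    by (intro bexI[of _ "S \<union> T"]) (auto simp: le_fun_def intro!: rect_approx_mono)
  qed (auto intro: lsc_rect_approx)
  finally show ?thesis .
qed

lemma lsc_pot:
  assumes k: "lsc (\<lambda>(x, y). k x y)" and N: "fradon N"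
  shows "lsc (pot k N)"
  unfolding pot_eq_SUP[OF assms] by (rule lsc_SUP) (auto intro: lsc_integral_rect_approx)

text \<open>The directed convergence theorem is used a second time, now for the outer measure; the
  inner integrals of the step kernels are again lower semicontinuous and directed.\<close>

lemma menergy_eq_SUP:
  assumes k: "lsc (\<lambda>(x, y). k x y)" and M: "fradon M" and N: "fradon N"
  shows "menergy k M N = (SUP S\<in>{S. finite S \<and> S \<subseteq> rects k}. \<integral>\<^sup>+ x. \<integral>\<^sup>+ y. rect_approx S x y \<partial>N \<partial>M)"
  unfolding menergy_def pot_eq_SUP[OF k N]
proof (rule nn_integral_SUP_directed_lsc[OF M])
  fix S T assume "S \<in> {S. finite S \<and> S \<subseteq> rects k}" "T \<in> {S. finite S \<and> S \<subseteq> rects k}"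
  then show "\<exists>U\<in>{S. finite S \<and> S \<subseteq> rects k}.
      (\<lambda>x. \<integral>\<^sup>+ y. rect_approx S x y \<partial>N) \<le> (\<lambda>x. \<integral>\<^sup>+ y. rect_approx U x y \<partial>N) \<and>
      (\<lambda>x. \<integral>\<^sup>+ y. rect_approx T x y \<partial>N) \<le> (\<lambda>x. \<integral>\<^sup>+ y. rect_approx U x y \<partial>N)"
    by (intro bexI[of _ "S \<union> T"]) (auto simp: le_fun_def intro!: nn_integral_mono rect_approx_mono)
qed (auto intro: lsc_integral_rect_approx)

text \<open>The kernel need not be measurable for the product of the Borel algebras, since no countable
  base is assumed; Tonelli is applied to the finite suprema of rectangles only.\<close>

lemma menergy_commute:
  fixes k :: "'a::t2_space \<Rightarrow> 'a \<Rightarrow> ennreal"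
  assumes k: "lsc (\<lambda>(x, y). k x y)" and sym: "\<And>x y. k x y = k y x" and M: "fradon M" and N: "fradon N"
  shows "menergy k M N = menergy k N M"
proof -
  interpret M: finite_measure M using M by (rule fradon_finite_measure)
  interpret N: finite_measure N using N by (rule fradon_finite_measure)
  interpret pair_sigma_finite M N ..
  let ?R = "{S. finite S \<and> S \<subseteq> rects k}"
  let ?swap = "\<lambda>S. (\<lambda>(c, U, V). (c, V, U)) ` S"
  have tonelli: "(\<integral>\<^sup>+ x. \<integral>\<^sup>+ y. rect_approx S x y \<partial>N \<partial>M) = (\<integral>\<^sup>+ y. \<integral>\<^sup>+ x. rect_approx S x y \<partial>M \<partial>N)" if "S \<in> ?R" for S
  proof -
    have "(\<lambda>p. fst t * indicator (fst (snd t)) (fst p) * indicator (snd (snd t)) (snd p) :: ennreal)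
       \<in> borel_measurable (M \<Otimes>\<^sub>M N)" if "t \<in> S" for t
    proof -
      have [measurable]: "fst (snd t) \<in> sets M" "snd (snd t) \<in> sets N"
        using \<open>S \<in> ?R\<close> that fradon_sets[OF M] fradon_sets[OF N] by (auto simp: rects_def)
      show ?thesis by measurable
    qed
    then have "(\<lambda>p. rect_approx S (fst p) (snd p)) \<in> borel_measurable (M \<Otimes>\<^sub>M N)"
      unfolding rect_approx_def using that by (intro borel_measurable_SUP) (auto intro: countable_finite)
    then show ?thesis by (intro Fubini'[symmetric]) (simp add: case_prod_beta')
  qed
  \<comment> \<open>Symmetry of \<open>k\<close> makes the transposed rectangles admissible, so both
    iterated integrals are suprema over the same index set.\<close>
  have swap: "?swap S \<in> ?R" if "S \<in> ?R" for S
  proof -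
    have "(c, V, U) \<in> rects k" if "(c, U, V) \<in> rects k" for c U V
      using that unfolding rects_def by (auto simp del: ball_simps) (metis sym)
    then show ?thesis using that by auto
  qed
  have eq: "rect_approx (?swap S) x y = rect_approx S y x" for S x y
    unfolding rect_approx_def by (auto simp: image_image case_prod_beta' mult_ac intro!: SUP_cong)
  have "menergy k M N \<le> menergy k N M"
  proof -
    have "(\<integral>\<^sup>+ x. \<integral>\<^sup>+ y. rect_approx S x y \<partial>N \<partial>M) \<le> menergy k N M" if "S \<in> ?R" for S
    proof -
      have "(\<integral>\<^sup>+ x. \<integral>\<^sup>+ y. rect_approx S x y \<partial>N \<partial>M) = (\<integral>\<^sup>+ x. \<integral>\<^sup>+ y. rect_approx (?swap S) x y \<partial>M \<partial>N)"
        unfolding tonelli[OF that] by (simp add: eq)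
      also have "\<dots> \<le> menergy k N M"
        unfolding menergy_eq_SUP[OF k N M] by (rule SUP_upper[OF swap[OF that]])
      finally show ?thesis .
    qed
    then show ?thesis unfolding menergy_eq_SUP[OF k M N] by (rule SUP_least)
  qed
  moreover have "menergy k N M \<le> menergy k M N"
  proof -
    have "(\<integral>\<^sup>+ x. \<integral>\<^sup>+ y. rect_approx S x y \<partial>M \<partial>N) \<le> menergy k M N" if "S \<in> ?R" for S
    proof -
      have "(\<integral>\<^sup>+ x. \<integral>\<^sup>+ y. rect_approx S x y \<partial>M \<partial>N) = (\<integral>\<^sup>+ x. \<integral>\<^sup>+ y. rect_approx (?swap S) x y \<partial>N \<partial>M)"
        unfolding tonelli[OF swap[OF that]] by (simp add: eq)
      also have "\<dots> \<le> menergy k M N"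
        unfolding menergy_eq_SUP[OF k M N] by (rule SUP_upper[OF swap[OF that]])
      finally show ?thesis .
    qed
    then show ?thesis unfolding menergy_eq_SUP[OF k N M] by (rule SUP_least)
  qed
  ultimately show ?thesis by (rule antisym)
qed

section \<open>Energy\<close>

lemma supp_restr_compact:
  fixes \<mu> :: "'a::t2_space measure"
  assumes "fradon \<mu>" "compact K"
  shows "supp (restr \<mu> K) \<subseteq> K" "compact (supp (restr \<mu> K))"
proof -
  have K: "K \<in> sets borel" "closed K" using assms by (auto simp: borel_compact compact_imp_closed)
  show sub: "supp (restr \<mu> K) \<subseteq> K"
  proof
    fix x assume x: "x \<in> supp (restr \<mu> K)"
    have "emeasure (restr \<mu> K) (-K) = 0"
      using K assms by (subst emeasure_restr) (auto simp: fradon_sets)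
    then show "x \<in> K" using x K unfolding supp_def by (auto simp: open_Compl)
  qed
  have "- supp M = \<Union>{U. open U \<and> emeasure M U = 0}" for M :: "'a measure"
    by (auto simp: supp_def)
  then have cl: "closed (supp M)" for M :: "'a measure" unfolding closed_def by (metis (no_types, lifting) mem_Collect_eq open_Union)
  have "compact (K \<inter> supp (restr \<mu> K))" by (rule compact_Int_closed[OF assms(2) cl])
  then show "compact (supp (restr \<mu> K))" using sub by (simp add: Int_absorb1)
qed

text \<open>The discriminant criterion, with the linear case \<open>c = 0\<close> treated
  separately.\<close>

lemma quadratic_nonneg_imp:
  fixes a b c :: real
  assumes "\<And>t. 0 \<le> a + 2 * t * b + t\<^sup>2 * c" "c \<ge> 0"
  shows "b\<^sup>2 \<le> a * c"
proof (cases "c = 0")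
  case True
  have "b = 0"
  proof (rule ccontr)
    assume "b \<noteq> 0"
    \<comment> \<open>At this \<open>t\<close> the affine expression takes the value -1.\<close>
    then show False using assms(1)[of "- (a + 1) / (2 * b)"] True by (simp add: field_simps)
  qed
  then show ?thesis using True by simp
next
  case False
  then have c: "c > 0" using assms by simp
  have "0 \<le> c * (a + 2 * (- b / c) * b + (- b / c)\<^sup>2 * c)"
    using assms(1)[of "- b / c"] c by (intro mult_nonneg_nonneg) auto
  also have "\<dots> = a * c - b\<^sup>2" using c by (simp add: field_simps power2_eq_square)
  finally show ?thesis by simp
qed

locale energy_kernel =
  fixes \<kappa> :: "'a::t2_space \<Rightarrow> 'a \<Rightarrow> ennreal" and h :: real
  assumes admissible: "admissible_kernel \<kappa> h"
begin

lemma kernel_lsc: "lsc (\<lambda>(x, y). \<kappa> x y)"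
  using admissible unfolding admissible_kernel_def by (elim conjE)

lemma kernel_sym: "\<kappa> x y = \<kappa> y x"
  using admissible unfolding admissible_kernel_def by (elim conjE) blast

lemma kernel_pd: "inE \<kappa> P N \<Longrightarrow> senergy \<kappa> P N \<ge> 0"
  using admissible unfolding admissible_kernel_def by (elim conjE) blast

lemma kernel_consistent:
  assumes "F \<noteq> bot" "\<forall>\<^sub>F \<mu> in F. \<mu> \<in> Eplus \<kappa>" "strong_cauchy \<kappa> F" "radon \<nu>" "vague_cluster F \<nu>"
  shows "((\<lambda>\<mu>. sdist \<kappa> \<mu> \<nu>) \<longlongrightarrow> 0) F"
proof -
  have "\<forall>F. F \<noteq> bot \<longrightarrow> (\<forall>\<^sub>F \<mu> in F. \<mu> \<in> Eplus \<kappa>) \<longrightarrow> strong_cauchy \<kappa> F \<longrightarrow>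
        (\<forall>\<nu>. radon \<nu> \<longrightarrow> vague_cluster F \<nu> \<longrightarrow>
             \<nu> \<in> Eplus \<kappa> \<and> ((\<lambda>\<mu>. sdist \<kappa> \<mu> \<nu>) \<longlongrightarrow> 0) F)"
    using admissible unfolding admissible_kernel_def by (elim conjE)
  from this[rule_format, OF assms] show ?thesis by (rule conjunct2)
qed

lemma kernel_max_principle:
  assumes "radon \<nu>" "compact (supp \<nu>)" "(SUP x\<in>supp \<nu>. pot \<kappa> \<nu> x) < \<infinity>"
  shows "pot \<kappa> \<nu> x \<le> ennreal h * (SUP x\<in>supp \<nu>. pot \<kappa> \<nu> x)"
proof -
  have "\<forall>\<nu>. radon \<nu> \<and> compact (supp \<nu>) \<longrightarrow>
        (SUP x\<in>supp \<nu>. pot \<kappa> \<nu> x) < \<infinity> \<longrightarrow>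
        (\<forall>x. pot \<kappa> \<nu> x \<le> ennreal h * (SUP x\<in>supp \<nu>. pot \<kappa> \<nu> x))"
    using admissible unfolding admissible_kernel_def by (elim conjE)
  from this[rule_format, OF conjI, OF assms] show ?thesis .
qed

lemma kernel_measurable: "\<kappa> x \<in> borel_measurable borel"
  using lsc_measurable[OF lsc_slice[OF kernel_lsc]] .

lemma pot_measurable: "fradon \<nu> \<Longrightarrow> pot \<kappa> \<nu> \<in> borel_measurable borel"
  using lsc_measurable[OF lsc_pot[OF kernel_lsc]] .

lemma mutual_commute: "fradon \<mu> \<Longrightarrow> fradon \<nu> \<Longrightarrow> menergy \<kappa> \<mu> \<nu> = menergy \<kappa> \<nu> \<mu>"
  using menergy_commute[OF kernel_lsc kernel_sym] .

lemma mutual_restr_le: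
  assumes "fradon \<mu>" "fradon \<nu>" "B \<in> sets borel"
  shows "menergy \<kappa> (restr \<mu> B) \<nu> \<le> menergy \<kappa> \<mu> \<nu>"
proof -
  have "menergy \<kappa> (restr \<mu> B) \<nu> = (\<integral>\<^sup>+ x. pot \<kappa> \<nu> x * indicator B x \<partial>\<mu>)"
    unfolding menergy_def using assms pot_measurable[of \<nu>] fradon_sets[of \<mu>]
    by (subst nn_integral_restr) (auto cong: measurable_cong_sets)
  also have "\<dots> \<le> menergy \<kappa> \<mu> \<nu>"
    unfolding menergy_def by (intro nn_integral_mono) (auto split: split_indicator)
  finally show ?thesis .
qed

lemma pot_restr_le:
  assumes "fradon \<mu>" "B \<in> sets borel"
  shows "pot \<kappa> (restr \<mu> B) x \<le> pot \<kappa> \<mu> x"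
  unfolding pot_def using assms kernel_measurable[of x] fradon_sets[of \<mu>]
  by (subst nn_integral_restr) (auto cong: measurable_cong_sets intro!: nn_integral_mono split: split_indicator)

text \<open>Restricted to finite measures, because the regularity, symmetry and Tonelli arguments
  above are proved for those. The class is stable under restriction, addition and finite
  multiples.\<close>

definition \<E> :: "'a measure set" where
  "\<E> = {\<mu>. fradon \<mu> \<and> menergy \<kappa> \<mu> \<mu> < \<infinity>}"

lemma energy_restr:
  assumes "\<mu> \<in> \<E>" "B \<in> sets borel" shows "restr \<mu> B \<in> \<E>"
proof -
  have f: "fradon \<mu>" "fradon (restr \<mu> B)" using assms fradon_restr by (auto simp: \<E>_def)
  have "menergy \<kappa> (restr \<mu> B) (restr \<mu> B) \<le> menergy \<kappa> \<mu> (restr \<mu> B)"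
    by (rule mutual_restr_le[OF f assms(2)])
  also have "\<dots> = menergy \<kappa> (restr \<mu> B) \<mu>" by (rule mutual_commute[OF f])
  also have "\<dots> \<le> menergy \<kappa> \<mu> \<mu>" by (rule mutual_restr_le[OF f(1) f(1) assms(2)])
  finally show ?thesis using assms f by (auto simp: \<E>_def)
qed

text \<open>The potential of the restriction is at most \<open>n\<close> on its support, hence at
  most \<open>h n\<close> everywhere by the maximum principle. Its mutual energy with the finite
  measure \<open>\<nu>\<close> is therefore finite and positive definiteness applies. The resulting
  bound depends neither on \<open>n\<close> nor on \<open>K\<close>, so it survives an
  exhaustion.\<close>

lemma mutual_restr_bound:
  assumes \<mu>: "\<mu> \<in> \<E>" and \<nu>: "\<nu> \<in> \<E>" and K: "compact K" and b: "\<And>x. x \<in> K \<Longrightarrow> pot \<kappa> \<mu> x \<le> of_nat n"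
  shows "menergy \<kappa> (restr \<mu> K) \<nu> \<le> menergy \<kappa> \<mu> \<mu> + menergy \<kappa> \<nu> \<nu>"
proof -
  let ?m = "restr \<mu> K"
  have Kb: "K \<in> sets borel" using K by (rule borel_compact)
  have f: "fradon \<mu>" "fradon \<nu>" "fradon ?m" using \<mu> \<nu> energy_restr[OF \<mu> Kb] by (auto simp: \<E>_def)
  have m\<E>: "?m \<in> \<E>" by (rule energy_restr[OF \<mu> Kb])
  have sup: "(SUP x\<in>supp ?m. pot \<kappa> ?m x) \<le> of_nat n"
  proof (rule SUP_least)
    fix x assume "x \<in> supp ?m"
    then have "x \<in> K" using supp_restr_compact[OF f(1) K] by auto
    then show "pot \<kappa> ?m x \<le> of_nat n" using b pot_restr_le[OF f(1) Kb] by (blast intro: order_trans)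
  qed
  have nt: "(of_nat n :: ennreal) < \<infinity>" by (simp add: ennreal_of_nat_eq_real_of_nat)
  have "pot \<kappa> ?m x \<le> ennreal h * of_nat n" for x
  proof -
    have "pot \<kappa> ?m x \<le> ennreal h * (SUP x\<in>supp ?m. pot \<kappa> ?m x)"
      using supp_restr_compact[OF f(1) K] f(3) sup nt
      by (intro kernel_max_principle) (auto simp: fradon_def intro: le_less_trans)
    also have "\<dots> \<le> ennreal h * of_nat n" using sup by (rule mult_left_mono) simp
    finally show ?thesis .
  qed
  then have "menergy \<kappa> \<nu> ?m \<le> (\<integral>\<^sup>+ x. ennreal h * of_nat n \<partial>\<nu>)"
    unfolding menergy_def by (intro nn_integral_mono)
  also have "\<dots> < \<infinity>"
    using f(2) nt by (auto simp: fradon_def fradon_space ennreal_mult_less_top)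
  finally have fin: "menergy \<kappa> ?m \<nu> < \<infinity>" using mutual_commute[OF f(3,2)] by simp
  have "inE \<kappa> ?m \<nu>" using fin m\<E> \<nu> f unfolding inE_def \<E>_def fradon_def by auto
  from kernel_pd[OF this] have "2 * enn2real (menergy \<kappa> ?m \<nu>) \<le> enn2real (menergy \<kappa> ?m ?m) + enn2real (menergy \<kappa> \<nu> \<nu>)"
    unfolding senergy_def by simp
  then have "enn2real (menergy \<kappa> ?m \<nu>) \<le> enn2real (menergy \<kappa> ?m ?m) + enn2real (menergy \<kappa> \<nu> \<nu>)"
    using enn2real_nonneg[of "menergy \<kappa> ?m \<nu>"] by linarith
  then have "ennreal (enn2real (menergy \<kappa> ?m \<nu>)) \<le> ennreal (enn2real (menergy \<kappa> ?m ?m) + enn2real (menergy \<kappa> \<nu> \<nu>))"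
    by (rule ennreal_leI)
  then have "ennreal (enn2real (menergy \<kappa> ?m \<nu>)) \<le> ennreal (enn2real (menergy \<kappa> ?m ?m)) + ennreal (enn2real (menergy \<kappa> \<nu> \<nu>))"
    by (simp add: ennreal_plus)
  then have "menergy \<kappa> ?m \<nu> \<le> menergy \<kappa> ?m ?m + menergy \<kappa> \<nu> \<nu>"
    using fin m\<E> \<nu> by (simp add: \<E>_def ennreal_enn2real)
  also have "menergy \<kappa> ?m ?m \<le> menergy \<kappa> \<mu> \<mu>"
    using mutual_restr_le[OF f(1) f(3) Kb] mutual_restr_le[OF f(1) f(1) Kb] mutual_commute[OF f(1,3)] by simp
  finally show ?thesis by (simp add: add_right_mono)
qed

text \<open>Positive definiteness only speaks of pairs whose mutual energy is known to be finite. The maximum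
  principle supplies this for the restrictions of \<open>\<mu>\<close> to compact sets on which its potential is bounded,
  and these exhaust \<open>\<mu>\<close>.\<close>

lemma mutual_finite:
  assumes \<mu>: "\<mu> \<in> \<E>" and \<nu>: "\<nu> \<in> \<E>"
  shows "menergy \<kappa> \<mu> \<nu> < \<infinity>"
proof -
  have f: "fradon \<mu>" "fradon \<nu>" using \<mu> \<nu> by (auto simp: \<E>_def)
  interpret finite_measure \<mu> using f(1) by (rule fradon_finite_measure)
  note [simp] = fradon_sets[OF f(1)] fradon_space[OF f(1)]
  define A where "A n = {x. pot \<kappa> \<mu> x \<le> of_nat n}" for n
  have pm[measurable]: "pot \<kappa> \<mu> \<in> borel_measurable borel" "pot \<kappa> \<nu> \<in> borel_measurable borel"
    using f by (auto intro: pot_measurable)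
  have Am[measurable]: "A n \<in> sets borel" for n unfolding A_def by measurable
  have "\<exists>K. compact K \<and> K \<subseteq> A n \<and> measure \<mu> (A n - K) \<le> 1 / Suc n" for n
    by (rule fradon_inner_regular[OF f(1) Am]) simp
  then obtain K where K: "\<And>n. compact (K n)" "\<And>n. K n \<subseteq> A n" "\<And>n. measure \<mu> (A n - K n) \<le> 1 / Suc n"
    by metis
  define L where "L n = (\<Union>m\<le>n. K m)" for n
  have Amono: "A m \<subseteq> A n" if "m \<le> n" for m n
    using that unfolding A_def by (auto intro: order_trans)
  have L: "compact (L n)" "L n \<subseteq> A n" for n
    unfolding L_def using K Amono by (auto intro!: compact_UN) blast
  have Lm[measurable]: "L n \<in> sets borel" for n using L by (simp add: borel_compact)
  \<comment> \<open>The remainder of \<open>A m\<close> lies in \<open>A (m+n) - K (m+n)\<close> for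
    every \<open>n\<close>, since the levels increase; its measure is thus below
    \<open>1 / Suc (m+n)\<close> for all \<open>n\<close>.\<close>
  have null: "A m - (\<Union>n. L n) \<in> null_sets \<mu>" for m
  proof -
    have "measure \<mu> (A m - (\<Union>n. L n)) \<le> 1 / Suc (m + n)" for n
    proof -
      have "measure \<mu> (A m - (\<Union>n. L n)) \<le> measure \<mu> (A (m+n) - K (m+n))"
        using Amono[of m "m+n"] K(1)[of "m+n"] borel_compact by (intro finite_measure_mono) (auto simp: L_def)
      also have "\<dots> \<le> 1 / Suc (m + n)" by (rule K)
      finally show ?thesis .
    qed
    moreover have "(\<lambda>n. 1 / real (Suc (m + n))) \<longlonglongrightarrow> 0"
      using LIMSEQ_ignore_initial_segment[OF LIMSEQ_inverse_real_of_nat, of m]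
      by (simp add: inverse_eq_divide add.commute)
    ultimately have "measure \<mu> (A m - (\<Union>n. L n)) \<le> 0"
      by (intro LIMSEQ_le_const) auto
    then show ?thesis
      by (intro null_setsI) (auto simp: emeasure_eq_measure measure_le_0_iff)
  qed
  have fin: "AE x in \<mu>. pot \<kappa> \<mu> x \<noteq> \<infinity>"
    using \<mu> by (intro nn_integral_PInf_AE) (auto simp: \<E>_def menergy_def cong: measurable_cong_sets)
  have "AE x in \<mu>. \<forall>m. x \<notin> A m - (\<Union>n. L n)"
    unfolding AE_all_countable using null AE_not_in by blast
  \<comment> \<open>Finite energy makes the potential of \<open>\<mu>\<close> finite
    \<open>\<mu>\<close>-almost everywhere, so almost every point belongs to some level
    \<open>A m\<close>.\<close>
  with fin have ae: "AE x in \<mu>. x \<in> (\<Union>n. L n)"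
  proof eventually_elim
    case (elim x)
    then obtain m where "pot \<kappa> \<mu> x \<le> of_nat m"
      using ennreal_Ex_less_of_nat[of "pot \<kappa> \<mu> x"] by (auto simp: less_top intro: less_imp_le)
    then show ?case using elim by (auto simp: A_def)
  qed
  have "menergy \<kappa> \<mu> \<nu> = (\<integral>\<^sup>+ x. (SUP n. pot \<kappa> \<nu> x * indicator (L n) x) \<partial>\<mu>)"
    unfolding menergy_def
  proof (rule nn_integral_cong_AE, use ae in eventually_elim)
    case (elim x)
    then obtain n where n: "x \<in> L n" by auto
    show ?case
    proof (rule antisym)
      show "pot \<kappa> \<nu> x \<le> (SUP n. pot \<kappa> \<nu> x * indicator (L n) x)"
        using n by (intro SUP_upper2[of n]) auto
      show "(SUP n. pot \<kappa> \<nu> x * indicator (L n) x) \<le> pot \<kappa> \<nu> x"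
        by (rule SUP_least) (auto split: split_indicator)
    qed
  qed
  also have "\<dots> = (SUP n. \<integral>\<^sup>+ x. pot \<kappa> \<nu> x * indicator (L n) x \<partial>\<mu>)"
    by (rule nn_integral_monotone_convergence_SUP)
       (use Lm in \<open>auto simp: incseq_def le_fun_def L_def split: split_indicator cong: measurable_cong_sets\<close>)
  also have "\<dots> = (SUP n. menergy \<kappa> (restr \<mu> (L n)) \<nu>)"
    unfolding menergy_def by (subst nn_integral_restr) (auto cong: measurable_cong_sets)
  also have "\<dots> \<le> menergy \<kappa> \<mu> \<mu> + menergy \<kappa> \<nu> \<nu>"
    using L by (intro SUP_least mutual_restr_bound[OF \<mu> \<nu>]) (auto simp: A_def)
  also have "\<dots> < \<infinity>" using \<mu> \<nu> by (simp add: \<E>_def)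
  finally show ?thesis .
qed

section \<open>Mutual energy as a bilinear form\<close>

text \<open>\<open>enn2real\<close> sends an infinite energy to 0, so \<open>e\<close> is meaningful
  only between members of \<open>\<E>\<close>, where \<open>mutual_finite\<close> rules that case
  out.\<close>

definition e :: "'a measure \<Rightarrow> 'a measure \<Rightarrow> real" where
  "e \<mu> \<nu> = enn2real (menergy \<kappa> \<mu> \<nu>)"

lemma energy_fradon: "\<mu> \<in> \<E> \<Longrightarrow> fradon \<mu>" by (simp add: \<E>_def)

lemma ennreal_e: "\<mu> \<in> \<E> \<Longrightarrow> \<nu> \<in> \<E> \<Longrightarrow> ennreal (e \<mu> \<nu>) = menergy \<kappa> \<mu> \<nu>"
  using mutual_finite by (simp add: e_def)

lemma e_sym: "\<mu> \<in> \<E> \<Longrightarrow> \<nu> \<in> \<E> \<Longrightarrow> e \<mu> \<nu> = e \<nu> \<mu>"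
  unfolding e_def by (simp add: mutual_commute energy_fradon)

lemma e_nonneg: "e \<mu> \<nu> \<ge> 0"
  by (simp add: e_def)

lemma menergy_msum_left:
  assumes "\<And>i. i \<in> S \<Longrightarrow> sets (\<mu> i) = sets borel" "fradon \<nu>"
  shows "menergy \<kappa> (msum S \<mu>) \<nu> = (\<integral>\<^sup>+ i. menergy \<kappa> (\<mu> i) \<nu> \<partial>count_space S)"
  unfolding menergy_def by (rule nn_integral_msum[OF assms(1) pot_measurable[OF assms(2)]])

lemma pot_msum:
  assumes "\<And>i. i \<in> S \<Longrightarrow> sets (\<mu> i) = sets borel"
  shows "pot \<kappa> (msum S \<mu>) x = (\<integral>\<^sup>+ i. pot \<kappa> (\<mu> i) x \<partial>count_space S)"
  unfolding pot_def by (rule nn_integral_msum[OF assms kernel_measurable])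

lemma menergy_madd_left:
  "fradon \<mu> \<Longrightarrow> fradon \<mu>' \<Longrightarrow> fradon \<nu> \<Longrightarrow>
    menergy \<kappa> (madd \<mu> \<mu>') \<nu> = menergy \<kappa> \<mu> \<nu> + menergy \<kappa> \<mu>' \<nu>"
  unfolding menergy_def by (intro nn_integral_madd) (auto simp: fradon_sets pot_measurable)

lemma menergy_scale_left:
  "fradon \<mu> \<Longrightarrow> fradon \<nu> \<Longrightarrow> menergy \<kappa> (scale_measure c \<mu>) \<nu> = c * menergy \<kappa> \<mu> \<nu>"
  unfolding menergy_def using pot_measurable[of \<nu>]
  by (intro nn_integral_scale_measure) (auto simp: fradon_sets cong: measurable_cong_sets)

lemma energy_madd:
  assumes "\<mu> \<in> \<E>" "\<nu> \<in> \<E>" shows "madd \<mu> \<nu> \<in> \<E>"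
proof -
  have f: "fradon \<mu>" "fradon \<nu>" "fradon (madd \<mu> \<nu>)" using assms by (auto intro: energy_fradon fradon_madd)
  have "menergy \<kappa> (madd \<mu> \<nu>) (madd \<mu> \<nu>) = menergy \<kappa> \<mu> (madd \<mu> \<nu>) + menergy \<kappa> \<nu> (madd \<mu> \<nu>)"
    by (rule menergy_madd_left[OF f])
  also have "\<dots> = menergy \<kappa> \<mu> \<mu> + menergy \<kappa> \<nu> \<mu> + (menergy \<kappa> \<mu> \<nu> + menergy \<kappa> \<nu> \<nu>)"
    using f by (simp add: mutual_commute[OF _ f(3)] menergy_madd_left)
  also have "\<dots> < \<infinity>" using mutual_finite assms by simp
  finally show ?thesis using f by (simp add: \<E>_def)
qed

lemma energy_scale:
  assumes "\<mu> \<in> \<E>" "c < \<infinity>" shows "scale_measure c \<mu> \<in> \<E>"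
proof -
  have f: "fradon \<mu>" "fradon (scale_measure c \<mu>)" using assms by (auto intro: energy_fradon fradon_scale)
  have "menergy \<kappa> (scale_measure c \<mu>) (scale_measure c \<mu>) = c * (c * menergy \<kappa> \<mu> \<mu>)"
    using f by (simp add: mutual_commute[OF f] menergy_scale_left)
  also have "\<dots> < \<infinity>" using assms by (simp add: \<E>_def ennreal_mult_less_top)
  finally show ?thesis using f by (simp add: \<E>_def)
qed

lemma e_madd_left: "\<mu> \<in> \<E> \<Longrightarrow> \<mu>' \<in> \<E> \<Longrightarrow> \<nu> \<in> \<E> \<Longrightarrow> e (madd \<mu> \<mu>') \<nu> = e \<mu> \<nu> + e \<mu>' \<nu>"
  unfolding e_def by (simp add: menergy_madd_left energy_fradon enn2real_plus mutual_finite[simplified])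

lemma e_madd_right: "\<mu> \<in> \<E> \<Longrightarrow> \<mu>' \<in> \<E> \<Longrightarrow> \<nu> \<in> \<E> \<Longrightarrow> e \<nu> (madd \<mu> \<mu>') = e \<nu> \<mu> + e \<nu> \<mu>'"
  using e_madd_left e_sym energy_madd by metis

lemma e_scale_left: "\<mu> \<in> \<E> \<Longrightarrow> \<nu> \<in> \<E> \<Longrightarrow> c \<ge> 0 \<Longrightarrow> e (scale_measure (ennreal c) \<mu>) \<nu> = c * e \<mu> \<nu>"
  unfolding e_def by (simp add: menergy_scale_left energy_fradon enn2real_mult)

lemma e_scale_right: "\<mu> \<in> \<E> \<Longrightarrow> \<nu> \<in> \<E> \<Longrightarrow> c \<ge> 0 \<Longrightarrow> e \<nu> (scale_measure (ennreal c) \<mu>) = c * e \<nu> \<mu>"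
  using e_scale_left e_sym energy_scale by (metis ennreal_less_top infinity_ennreal_def)

lemma e_pd: 
  assumes "\<mu> \<in> \<E>" "\<nu> \<in> \<E>" shows "0 \<le> e \<mu> \<mu> + e \<nu> \<nu> - 2 * e \<mu> \<nu>"
proof -
  have "inE \<kappa> \<mu> \<nu>" using assms mutual_finite by (auto simp: inE_def \<E>_def fradon_def)
  from kernel_pd[OF this] show ?thesis by (simp add: senergy_def e_def)
qed

text \<open>The mutual energy of the signed measures \<open>P - N\<close> and \<open>P' - N'\<close>.\<close>

definition bf :: "'a measure \<Rightarrow> 'a measure \<Rightarrow> 'a measure \<Rightarrow> 'a measure \<Rightarrow> real" where
  "bf P N P' N' = e P P' + e N N' - e P N' - e N P'"

lemma bf_self_nonneg: "P \<in> \<E> \<Longrightarrow> N \<in> \<E> \<Longrightarrow> 0 \<le> bf P N P N"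
  using e_pd[of P N] e_sym[of P N] by (simp add: bf_def)

text \<open>Nonnegativity of the form on \<open>(P - N) + t (P' - N')\<close> for all real
  \<open>t\<close> gives the discriminant inequality. Measures can only be multiplied by nonnegative
  factors, so the expansion is first made for \<open>t \<ge> 0\<close>.\<close>

lemma Cauchy_Schwarz:
  assumes m: "P \<in> \<E>" "N \<in> \<E>" "P' \<in> \<E>" "N' \<in> \<E>"
  shows "\<bar>bf P N P' N'\<bar> \<le> sqrt (bf P N P N) * sqrt (bf P' N' P' N')"
proof -
  have *: "0 \<le> bf P N P N + 2 * t * bf P N Q R + t\<^sup>2 * bf Q R Q R"
    if "t \<ge> 0" "Q \<in> \<E>" "R \<in> \<E>" for t Q R
  proof -
    let ?s = "\<lambda>M. scale_measure (ennreal t) M"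
    have s: "?s Q \<in> \<E>" "?s R \<in> \<E>" using that by (auto intro: energy_scale)
    have "0 \<le> bf (madd P (?s Q)) (madd N (?s R)) (madd P (?s Q)) (madd N (?s R))"
      using m s by (intro bf_self_nonneg energy_madd)
    also have "\<dots> = bf P N P N + 2 * t * bf P N Q R + t\<^sup>2 * bf Q R Q R"
      using m s that e_sym[of Q P] e_sym[of R P] e_sym[of Q N] e_sym[of R N]
      by (simp add: bf_def e_madd_left e_madd_right e_scale_left e_scale_right energy_madd algebra_simps power2_eq_square)
    finally show ?thesis .
  qed
  have "0 \<le> bf P N P N + 2 * t * bf P N P' N' + t\<^sup>2 * bf P' N' P' N'" for t
  proof (cases "t \<ge> 0")
    case True then show ?thesis using * m by blast
  next
    case False
    \<comment> \<open>A negative \<open>t\<close> is absorbed by exchanging the two parts of the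
      second signed measure, which changes its sign.\<close>
    then have "0 \<le> bf P N P N + 2 * (-t) * bf P N N' P' + (-t)\<^sup>2 * bf N' P' N' P'"
      using m by (intro *) auto
    moreover have "bf P N N' P' = - bf P N P' N'" "bf N' P' N' P' = bf P' N' P' N'"
      by (simp_all add: bf_def)
    ultimately show ?thesis by simp
  qed
  from quadratic_nonneg_imp[OF this bf_self_nonneg[OF m(3,4)]]
  have "sqrt ((bf P N P' N')\<^sup>2) \<le> sqrt (bf P N P N * bf P' N' P' N')"
    by (rule real_sqrt_le_mono)
  then show ?thesis by (simp add: real_sqrt_mult)
qed

definition mzero :: "'a measure" where "mzero = null_measure borel"

lemma mzero_energy: "mzero \<in> \<E>"
proof -
  have "fradon mzero" unfolding mzero_def
    by (rule fradonI) (auto simp: measure_def intro!: exI[of _ "{}"])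
  then show ?thesis by (simp add: \<E>_def mzero_def menergy_def)
qed

lemma e_mzero: "\<mu> \<in> \<E> \<Longrightarrow> e mzero \<mu> = 0" "\<mu> \<in> \<E> \<Longrightarrow> e \<mu> mzero = 0"
  by (simp_all add: e_def mzero_def menergy_def pot_def)

text \<open>Strong convergence implies weak convergence: the inequality is applied to the signed
  measure \<open>\<mu> - \<nu>\<close> against \<open>\<xi>\<close>, written as a pair with second
  part \<open>mzero\<close>.\<close>

lemma e_Cauchy_Schwarz:
  assumes "\<mu> \<in> \<E>" "\<nu> \<in> \<E>" "\<xi> \<in> \<E>"
  shows "\<bar>e \<mu> \<xi> - e \<nu> \<xi>\<bar> \<le> sdist \<kappa> \<mu> \<nu> * sqrt (e \<xi> \<xi>)"
proof -
  have "sdist \<kappa> \<mu> \<nu> = sqrt (bf \<mu> \<nu> \<mu> \<nu>)"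
    using e_sym[OF assms(1,2)] by (simp add: sdist_def bf_def e_def)
  then show ?thesis
    using Cauchy_Schwarz[OF assms mzero_energy] assms mzero_energy by (simp add: bf_def e_mzero)
qed

end

section \<open>Vague and weak convergence\<close>

lemma Cc_measurable: "f \<in> Cc \<Longrightarrow> f \<in> borel_measurable borel"
  by (auto simp: Cc_def intro: borel_measurable_continuous_onI)

lemma Cc_bounded:
  assumes "f \<in> Cc" shows "\<exists>B. \<forall>x. \<bar>f x\<bar> \<le> B"
proof -
  obtain K where K: "compact K" "\<And>x. x \<notin> K \<Longrightarrow> f x = 0" and c: "continuous_on UNIV f"
    using assms by (auto simp: Cc_def)
  have "bounded (f ` K)"
    using c K by (intro compact_imp_bounded compact_continuous_image) (auto intro: continuous_on_subset)
  then obtain B where B: "\<And>x. x \<in> K \<Longrightarrow> \<bar>f x\<bar> \<le> B" by (auto simp: bounded_iff)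
  have "\<bar>f x\<bar> \<le> max B 0" for x using B[of x] K(2)[of x] by (cases "x \<in> K") auto
  then show ?thesis by blast
qed

lemma Cc_integrable:
  assumes "f \<in> Cc" "fradon M" shows "integrable M f"
proof -
  obtain B where "\<forall>x. \<bar>f x\<bar> \<le> B" using Cc_bounded[OF assms(1)] by blast
  then show ?thesis
    using Cc_measurable[OF assms(1)] fradon_sets[OF assms(2)]
    by (intro finite_measure.integrable_const_bound[OF fradon_finite_measure[OF assms(2)]])
       (auto cong: measurable_cong_sets)
qed

lemma integral_scale_madd:
  assumes f: "f \<in> Cc" and M: "fradon M" and N: "fradon N" and c: "0 \<le> c"
  shows "(\<integral>x. f x \<partial>scale_measure (ennreal c) (madd M N)) = c * ((\<integral>x. f x \<partial>M) + (\<integral>x. f x \<partial>N))"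
proof -
  let ?D = "scale_measure (ennreal c) (madd M N)"
  have D: "fradon ?D" "fradon (madd M N)" using M N by (auto intro!: fradon_scale fradon_madd)
  have nn: "enn2real (\<integral>\<^sup>+ x. ennreal (g x) \<partial>?D)
     = c * (enn2real (\<integral>\<^sup>+ x. ennreal (g x) \<partial>M) + enn2real (\<integral>\<^sup>+ x. ennreal (g x) \<partial>N))"
    if g: "g \<in> Cc" for g
  proof -
    have m: "(\<lambda>x. ennreal (g x)) \<in> borel_measurable borel" using Cc_measurable[OF g] by measurable
    have fin: "(\<integral>\<^sup>+ x. ennreal (g x) \<partial>L) < \<infinity>" if "fradon L" for L
      using Cc_integrable[OF g that] by (auto simp: real_integrable_def less_top)
    have "(\<integral>\<^sup>+ x. ennreal (g x) \<partial>?D) = ennreal c * ((\<integral>\<^sup>+ x. ennreal (g x) \<partial>M) + (\<integral>\<^sup>+ x. ennreal (g x) \<partial>N))"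
      using m fradon_sets[OF M] fradon_sets[OF N]
      by (subst nn_integral_scale_measure) (auto simp: nn_integral_madd cong: measurable_cong_sets)
    then show ?thesis using fin[OF M] fin[OF N] c by (simp add: enn2real_mult enn2real_plus)
  qed
  \<comment> \<open>\<open>ennreal\<close> cuts negative values to 0, so applying the identity to
    \<open>f\<close> and to \<open>- f\<close> treats its positive and negative parts.\<close>
  have f': "(\<lambda>x. - f x) \<in> Cc" using f by (auto simp: Cc_def intro: continuous_intros)
  show ?thesis
    unfolding real_lebesgue_integral_def[OF Cc_integrable[OF f D(1)]]
      real_lebesgue_integral_def[OF Cc_integrable[OF f M]] real_lebesgue_integral_def[OF Cc_integrable[OF f N]]
      nn[OF f] nn[OF f'] by (simp add: field_simps)
qed

text \<open>If \<open>e (m s) \<xi>\<close> stayed away from \<open>e \<nu> \<xi>\<close>, the measures that are vaguely close to \<open>\<nu>\<close> but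
  whose mutual energy with \<open>\<xi>\<close> is off by \<open>\<delta>\<close> would form nonempty convex sets. Elements of almost minimal
  energy in these sets form a strong Cauchy filter by the parallelogram law, and consistency makes it
  converge strongly to \<open>\<nu>\<close>, contradicting the gap.\<close>

lemma (in energy_kernel) weak_convergence:
  fixes F :: "'b filter"
  assumes ev: "\<forall>\<^sub>F s in F. m s \<in> \<E> \<and> e (m s) (m s) \<le> C" and \<nu>: "\<nu> \<in> \<E>" and \<xi>: "\<xi> \<in> \<E>"
    and vague: "\<And>f. f \<in> Cc \<Longrightarrow> ((\<lambda>s. \<integral>x. f x \<partial>m s) \<longlongrightarrow> (\<integral>x. f x \<partial>\<nu>)) F"
  shows "((\<lambda>s. e (m s) \<xi>) \<longlongrightarrow> e \<nu> \<xi>) F"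
proof (rule ccontr)
  assume "\<not> ?thesis"
  then obtain \<delta> where \<delta>: "\<delta> > 0" "\<not> (\<forall>\<^sub>F s in F. dist (e (m s) \<xi>) (e \<nu> \<xi>) < \<delta>)"
    by (auto simp: tendsto_iff)
  from this(2) have "\<exists>\<^sub>F s in F. \<delta> \<le> e (m s) \<xi> - e \<nu> \<xi> \<or> \<delta> \<le> - (e (m s) \<xi> - e \<nu> \<xi>)"
    unfolding not_eventually by (elim frequently_elim1) (auto simp: dist_real_def)
  \<comment> \<open>One side of the gap is selected because a one-sided affine condition is
    preserved by midpoints, whereas deviation in absolute value is not.\<close>
  then have "\<exists>sg::real. (\<exists>\<^sub>F s in F. \<delta> \<le> sg * (e (m s) \<xi> - e \<nu> \<xi>)) \<and> \<bar>sg\<bar> = 1"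
    unfolding frequently_disj_iff
    by (elim disjE) (intro exI[of _ 1], simp, intro exI[of _ "-1"], simp)
  then obtain sg :: real where sg: "\<exists>\<^sub>F s in F. \<delta> \<le> sg * (e (m s) \<xi> - e \<nu> \<xi>)" "\<bar>sg\<bar> = 1" by blast
  \<comment> \<open>Indices of basic vague neighbourhoods of \<open>\<nu>\<close>: finitely many
    test functions and a tolerance.\<close>
  define Q where "Q = {(fs, \<epsilon>). finite fs \<and> fs \<subseteq> (Cc :: ('a \<Rightarrow> real) set) \<and> \<epsilon> > (0::real)}"
  define Cs where "Cs q = {\<rho>\<in>\<E>. (\<forall>f\<in>fst q. \<bar>(\<integral>x. f x \<partial>\<rho>) - (\<integral>x. f x \<partial>\<nu>)\<bar> < snd q) \<and>
      \<delta> \<le> sg * (e \<rho> \<xi> - e \<nu> \<xi>)}" for q :: "('a \<Rightarrow> real) set \<times> real"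
  have ne: "\<exists>\<rho>\<in>Cs q. e \<rho> \<rho> \<le> C" if "q \<in> Q" for q
  proof -
    have "\<forall>\<^sub>F s in F. \<forall>f\<in>fst q. \<bar>(\<integral>x. f x \<partial>m s) - (\<integral>x. f x \<partial>\<nu>)\<bar> < snd q"
    proof (rule eventually_ball_finite)
      show "finite (fst q)" using that by (auto simp: Q_def)
      show "\<forall>f\<in>fst q. \<forall>\<^sub>F s in F. \<bar>(\<integral>x. f x \<partial>m s) - (\<integral>x. f x \<partial>\<nu>)\<bar> < snd q"
        using that vague unfolding tendsto_iff dist_real_def by (auto simp: Q_def)
    qed
    with ev have "\<forall>\<^sub>F s in F. (m s \<in> \<E> \<and> e (m s) (m s) \<le> C) \<and>
        (\<forall>f\<in>fst q. \<bar>(\<integral>x. f x \<partial>m s) - (\<integral>x. f x \<partial>\<nu>)\<bar> < snd q)" by (rule eventually_conj)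
    from frequently_ex[OF frequently_eventually_frequently[OF sg(1) this]]
    show ?thesis unfolding Cs_def by blast
  qed
  \<comment> \<open>The least energy within a neighbourhood can only rise as the neighbourhood
    shrinks, and the net keeps it below \<open>C\<close>; hence its supremum \<open>ms\<close> is
    finite.\<close>
  define d where "d q = Inf ((\<lambda>\<rho>. e \<rho> \<rho>) ` Cs q)" for q
  have bdd: "bdd_below ((\<lambda>\<rho>. e \<rho> \<rho>) ` S)" for S by (rule bdd_belowI[of _ 0]) (auto simp: e_nonneg)
  have dle: "d q \<le> e \<rho> \<rho>" if "\<rho> \<in> Cs q" for q \<rho>
    unfolding d_def using that by (intro cInf_lower bdd) auto
  have dC: "d q \<le> C" if "q \<in> Q" for q using ne[OF that] dle by (meson order_trans)
  define ms where "ms = Sup (d ` Q)"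
  have bddQ: "bdd_above (d ` Q)" using dC by (intro bdd_aboveI[of _ C]) auto
  have Qne: "({}, 1) \<in> Q" by (simp add: Q_def)
  have dms: "d q \<le> ms" if "q \<in> Q" for q unfolding ms_def using that bddQ by (intro cSup_upper) auto
  \<comment> \<open>The sets for varying neighbourhood and tolerance form a filter base;
    \<open>ms\<close> bounds every \<open>d q\<close>, which makes each of them nonempty.\<close>
  define D where "D r = {\<rho>\<in>Cs (fst r). e \<rho> \<rho> < ms + snd r}" for r
  define R where "R = Q \<times> {0::real<..}"
  define G where "G = (INF r\<in>R. principal (D r))"
  have evG: "eventually p G \<longleftrightarrow> (\<exists>r\<in>R. \<forall>\<rho>\<in>D r. p \<rho>)" for p
    unfolding G_def eventually_principal[symmetric]
  proof (rule eventually_INF_base)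
    show "R \<noteq> {}" using Qne by (auto simp: R_def)
    fix r r' assume rR: "r \<in> R" "r' \<in> R"
    show "\<exists>x\<in>R. principal (D x) \<le> inf (principal (D r)) (principal (D r'))"
    proof (intro bexI)
      let ?x = "((fst (fst r) \<union> fst (fst r'), min (snd (fst r)) (snd (fst r'))), min (snd r) (snd r'))"
      have "D ?x \<subseteq> D r \<inter> D r'" unfolding D_def Cs_def by (intro subsetI) (simp add: min_add_distrib_right)
      then show "principal (D ?x) \<le> inf (principal (D r)) (principal (D r'))" by simp
      show "?x \<in> R" using rR unfolding R_def Q_def by (cases r; cases r'; auto)
    qed
  qed
  have Dne: "D r \<noteq> {}" if "r \<in> R" for r
  proof -
    have q: "fst r \<in> Q" and "snd r > 0" using that by (auto simp: R_def)
    then have lt: "Inf ((\<lambda>\<rho>. e \<rho> \<rho>) ` Cs (fst r)) < ms + snd r" using dms[OF q] by (simp add: d_def)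
    have "(\<lambda>\<rho>. e \<rho> \<rho>) ` Cs (fst r) \<noteq> {}" using ne[OF q] by blast
    from cInf_lessD[OF this lt] show ?thesis by (auto simp: D_def)
  qed
  have Gbot: "G \<noteq> bot"
    using evG[of "\<lambda>_. False"] Dne by (auto simp: trivial_limit_def)
  have evC: "\<forall>\<^sub>F \<rho> in G. \<rho> \<in> Cs q" if "q \<in> Q" for q
    unfolding evG using that by (intro bexI[of _ "(q, 1)"]) (auto simp: R_def D_def)
  have ev\<E>: "\<forall>\<^sub>F \<rho> in G. \<rho> \<in> \<E> \<and> \<delta> \<le> sg * (e \<rho> \<xi> - e \<nu> \<xi>)"
    using evC[OF Qne] by eventually_elim (simp add: Cs_def)
  define c :: real where "c = 1/2"
  have c: "0 \<le> c" by (simp add: c_def)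
  \<comment> \<open>Convexity is needed for midpoints only: the midpoint stays in
    \<open>Cs q\<close>, so its energy cannot fall below \<open>d q\<close>.\<close>
  have mid: "scale_measure (ennreal c) (madd \<rho> \<rho>') \<in> Cs q" if q: "q \<in> Q" and \<rho>: "\<rho> \<in> Cs q" "\<rho>' \<in> Cs q" for q \<rho> \<rho>'
  proof -
    let ?m = "scale_measure (ennreal c) (madd \<rho> \<rho>')"
    have m: "\<rho> \<in> \<E>" "\<rho>' \<in> \<E>" using \<rho> by (auto simp: Cs_def)
    have "\<bar>(\<integral>x. f x \<partial>?m) - (\<integral>x. f x \<partial>\<nu>)\<bar> < snd q" if f: "f \<in> fst q" for f
    proof -
      have "f \<in> Cc" using f q by (auto simp: Q_def)
      then have "(\<integral>x. f x \<partial>?m) = ((\<integral>x. f x \<partial>\<rho>) + (\<integral>x. f x \<partial>\<rho>')) / 2"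
        using m c integral_scale_madd[of f \<rho> \<rho>' c] by (simp add: energy_fradon c_def)
      moreover have "\<bar>(\<integral>x. f x \<partial>\<rho>) - (\<integral>x. f x \<partial>\<nu>)\<bar> < snd q" "\<bar>(\<integral>x. f x \<partial>\<rho>') - (\<integral>x. f x \<partial>\<nu>)\<bar> < snd q"
        using \<rho> f by (auto simp: Cs_def)
      ultimately show ?thesis by (simp add: abs_less_iff)
    qed
    moreover have "\<delta> \<le> sg * (e ?m \<xi> - e \<nu> \<xi>)"
    proof -
      have "e ?m \<xi> = c * (e \<rho> \<xi> + e \<rho>' \<xi>)" using m \<xi> c by (simp add: e_scale_left e_madd_left energy_madd)
      then have eq: "sg * (e ?m \<xi> - e \<nu> \<xi>) = (sg * (e \<rho> \<xi> - e \<nu> \<xi>) + sg * (e \<rho>' \<xi> - e \<nu> \<xi>)) / 2"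
        by (simp add: c_def field_simps)
      have half: "x \<le> (a + b) / 2" if "x \<le> a" "x \<le> b" for x a b :: real using that by simp
      show ?thesis unfolding eq using \<rho> unfolding Cs_def by (intro half) simp_all
    qed
    moreover have "?m \<in> \<E>" using m by (intro energy_scale energy_madd) auto
    ultimately show ?thesis unfolding Cs_def by blast
  qed
  have cauchy: "strong_cauchy \<kappa> G"
    unfolding strong_cauchy_def
  proof (intro allI impI)
    fix \<epsilon> :: real assume \<epsilon>: "\<epsilon> > 0"
    \<comment> \<open>By the parallelogram law the squared distance is below
      \<open>8 * \<eta>\<close>, that is \<open>\<epsilon>\<^sup>2 / 2\<close>: each energy exceeds
      \<open>ms\<close> by less than \<open>\<eta>\<close>, and the midpoint energy falls short of
      \<open>ms\<close> by less than \<open>\<eta>\<close>.\<close>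
    define \<eta> where "\<eta> = \<epsilon>\<^sup>2 / 16"
    have \<eta>: "\<eta> > 0" using \<epsilon> by (simp add: \<eta>_def)
    obtain q where q: "q \<in> Q" "ms - \<eta> < d q"
    proof -
      have "d ` Q \<noteq> {}" using Qne by blast
      from less_cSupD[OF this, of "ms - \<eta>"] show thesis using \<eta> that by (auto simp: ms_def)
    qed
    have close: "sdist \<kappa> \<rho> \<rho>' < \<epsilon>" if "\<rho> \<in> D (q, \<eta>)" "\<rho>' \<in> D (q, \<eta>)" for \<rho> \<rho>'
    proof -
      have \<rho>: "\<rho> \<in> Cs q" "\<rho>' \<in> Cs q" "e \<rho> \<rho> < ms + \<eta>" "e \<rho>' \<rho>' < ms + \<eta>" using that by (auto simp: D_def)
      have m: "\<rho> \<in> \<E>" "\<rho>' \<in> \<E>" using \<rho> by (auto simp: Cs_def)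
      let ?m = "scale_measure (ennreal c) (madd \<rho> \<rho>')"
      have "ms - \<eta> < e ?m ?m" using dle[OF mid[OF q(1) \<rho>(1,2)]] q by linarith
      also have "e ?m ?m = (e \<rho> \<rho> + 2 * e \<rho> \<rho>' + e \<rho>' \<rho>') / 4"
      proof -
        have "?m \<in> \<E>" using m by (intro energy_scale energy_madd) auto
        then have "e ?m ?m = c * (c * (e \<rho> \<rho> + e \<rho> \<rho>' + (e \<rho>' \<rho> + e \<rho>' \<rho>')))"
          using m c by (simp add: e_scale_left e_scale_right e_madd_left e_madd_right energy_madd algebra_simps)
        then show ?thesis using e_sym[OF m] by (simp add: c_def)
      qed
      finally have "4 * (ms - \<eta>) < e \<rho> \<rho> + 2 * e \<rho> \<rho>' + e \<rho>' \<rho>'" by simp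
      then have "e \<rho> \<rho> + e \<rho>' \<rho>' - 2 * e \<rho> \<rho>' < 8 * \<eta>" using \<rho>(3,4) by argo
      also have "\<dots> < \<epsilon>\<^sup>2" using \<epsilon> by (simp add: \<eta>_def)
      finally show ?thesis unfolding sdist_def e_def[symmetric] using \<epsilon>
        by (metis real_sqrt_less_mono real_sqrt_abs abs_of_pos)
    qed
    have "(q, \<eta>) \<in> R" using q \<eta> by (simp add: R_def)
    then have "\<forall>\<^sub>F \<rho> in G. \<rho> \<in> D (q, \<eta>)" unfolding evG by blast
    then show "\<forall>\<^sub>F (\<rho>, \<rho>') in G \<times>\<^sub>F G. sdist \<kappa> \<rho> \<rho>' < \<epsilon>"
      unfolding eventually_prod_filter using close by (intro exI[of _ "\<lambda>\<rho>. \<rho> \<in> D (q, \<eta>)"]) auto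
  qed
  have cluster: "vague_cluster G \<nu>"
    unfolding vague_cluster_def
  proof (intro allI impI)
    fix fs :: "('a \<Rightarrow> real) set" and \<epsilon> :: real assume "finite fs \<and> fs \<subseteq> Cc" "\<epsilon> > 0"
    then have "(fs, \<epsilon>) \<in> Q" by (simp add: Q_def)
    from evC[OF this] have "\<forall>\<^sub>F \<rho> in G. \<forall>f\<in>fs. \<bar>(\<integral>x. f x \<partial>\<rho>) - (\<integral>x. f x \<partial>\<nu>)\<bar> < \<epsilon>"
      by eventually_elim (simp add: Cs_def)
    then show "\<exists>\<^sub>F \<rho> in G. \<forall>f\<in>fs. \<bar>(\<integral>x. f x \<partial>\<rho>) - (\<integral>x. f x \<partial>\<nu>)\<bar> < \<epsilon>"
      by (rule eventually_frequently[OF Gbot])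
  qed
  have "((\<lambda>\<rho>. sdist \<kappa> \<rho> \<nu>) \<longlongrightarrow> 0) G"
  proof (rule kernel_consistent[OF Gbot _ cauchy _ cluster])
    show "\<forall>\<^sub>F \<rho> in G. \<rho> \<in> Eplus \<kappa>"
      using ev\<E> by eventually_elim (simp add: \<E>_def Eplus_def fradon_def)
    show "radon \<nu>" using \<nu> by (simp add: \<E>_def fradon_def)
  qed
  then have "((\<lambda>\<rho>. sdist \<kappa> \<rho> \<nu> * sqrt (e \<xi> \<xi>)) \<longlongrightarrow> 0) G" by (rule tendsto_mult_left_zero)
  from order_tendstoD(2)[OF this \<open>\<delta> > 0\<close>] ev\<E>
  have "\<forall>\<^sub>F \<rho> in G. False"
  proof eventually_elim
    case (elim \<rho>)
    have "\<delta> \<le> \<bar>sg * (e \<rho> \<xi> - e \<nu> \<xi>)\<bar>" using elim by linarith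
    also have "\<dots> = \<bar>e \<rho> \<xi> - e \<nu> \<xi>\<bar>" using sg(2) by (simp add: abs_mult)
    also have "\<dots> \<le> sdist \<kappa> \<rho> \<nu> * sqrt (e \<xi> \<xi>)" using elim \<nu> \<xi> by (intro e_Cauchy_Schwarz) auto
    finally show ?case using elim by simp
  qed
  then show False using Gbot by simp
qed

text \<open>Locally compact Hausdorff spaces are completely regular, which gives a compactly
  supported bump around each point. Finitely many bumps cover \<open>K\<close>, and their sum is
  rescaled and truncated.\<close>

lemma Cc_Urysohn:
  fixes K :: "'a::t2_space set"
  assumes lc: "locally_compact_space (euclidean :: 'a topology)" and K: "compact K"
  shows "\<exists>f\<in>Cc. (\<forall>x. 0 \<le> f x \<and> f x \<le> 1) \<and> (\<forall>x\<in>K. f x = 1)"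
proof -
  have cr: "completely_regular_space (euclidean :: 'a topology)"
    using locally_compact_regular_imp_completely_regular_space[OF lc]
    by (simp add: Hausdorff_space_def disjnt_def) (metis hausdorff)
  have "\<exists>f U. f \<in> Cc \<and> (\<forall>x. 0 \<le> f x) \<and> open U \<and> x \<in> U \<and> (\<forall>y\<in>U. f y > 1/2)" for x :: 'a
  proof -
    obtain V L where V: "open V" "compact L" "x \<in> V" "V \<subseteq> L"
      using lc unfolding locally_compact_space_def by (simp add: compactin_euclidean_iff) blast
    have "closedin euclidean (-V)" "x \<in> topspace euclidean - (-V)" using V by auto
    then obtain f :: "'a \<Rightarrow> real" where f: "continuous_map euclidean (top_of_set {0..1}) f" "f x = 0" "f ` (-V) \<subseteq> {1}"
      using cr unfolding completely_regular_space_def by blast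
    have c: "continuous_on UNIV f" and r: "\<And>y. 0 \<le> f y \<and> f y \<le> 1"
      using f(1) by (auto simp: continuous_map_in_subtopology)
    have "(\<lambda>y. 1 - f y) \<in> Cc"
      using V f(3) c unfolding Cc_def by (auto intro!: continuous_intros exI[of _ L])
    moreover have "open {y. 1 - f y > 1/2}"
      using c by (intro open_Collect_less continuous_intros)
    ultimately show ?thesis using f(2) r
      by (intro exI[of _ "\<lambda>y. 1 - f y"] exI[of _ "{y. 1 - f y > 1/2}"]) auto
  qed
  then obtain f U where fU: "\<And>x::'a. f x \<in> Cc" "\<And>x y. 0 \<le> f x y" "\<And>x. open (U x)" "\<And>x. x \<in> U x"
    "\<And>x y. y \<in> U x \<Longrightarrow> f x y > 1/2" by metis
  have "K \<subseteq> (\<Union>x\<in>K. U x)" using fU(4) by blast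
  with K obtain T where T: "finite T" "K \<subseteq> (\<Union>x\<in>T. U x)"
    using compactE_image[of K K U] fU(3) by metis
  \<comment> \<open>Each bump exceeds 1/2 on its neighbourhood, so the factor 2 lifts the sum above
    1 on \<open>K\<close> before truncation.\<close>
  define g where "g y = min 1 (2 * (\<Sum>x\<in>T. f x y))" for y
  have "g \<in> Cc"
  proof -
    have "\<forall>x. \<exists>L. compact L \<and> (\<forall>y. y \<notin> L \<longrightarrow> f x y = 0)" and c: "\<And>x. continuous_on UNIV (f x)"
      using fU(1) by (auto simp: Cc_def)
    then obtain L where L: "\<And>x. compact (L x)" "\<And>x y. y \<notin> L x \<Longrightarrow> f x y = 0" by metis
    have "continuous_on UNIV g" unfolding g_def using c by (intro continuous_intros) auto
    moreover have "compact (\<Union>x\<in>T. L x)" using T L by auto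
    moreover have "g y = 0" if "y \<notin> (\<Union>x\<in>T. L x)" for y using that L(2) by (simp add: g_def)
    ultimately show ?thesis unfolding Cc_def by blast
  qed
  moreover have "0 \<le> g y \<and> g y \<le> 1" for y using fU(2) by (simp add: g_def sum_nonneg)
  moreover have "g y = 1" if yK: "y \<in> K" for y
  proof -
    obtain x where x: "x \<in> T" "y \<in> U x" using yK T by auto
    have "f x y \<le> (\<Sum>x\<in>T. f x y)" using x T fU(2) by (intro member_le_sum) auto
    then show ?thesis using fU(5)[OF x(2)] by (simp add: g_def)
  qed
  ultimately show ?thesis by blast
qed

text \<open>Mass may escape in a vague limit but is never gained: a test function with values in
  [0, 1] that equals 1 on \<open>K\<close> bounds the mass of \<open>K\<close>, and inner regularity
  does the rest.\<close>

lemma vague_limit_mass_le: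
  fixes \<nu> :: "'a::t2_space measure"
  assumes lc: "locally_compact_space (euclidean :: 'a topology)" and F: "F \<noteq> bot"
    and ev: "\<forall>\<^sub>F s in F. fradon (m s) \<and> measure (m s) UNIV \<le> c" and \<nu>: "radon \<nu>"
    and vague: "\<And>f. f \<in> Cc \<Longrightarrow> ((\<lambda>s. \<integral>x. f x \<partial>m s) \<longlongrightarrow> (\<integral>x. f x \<partial>\<nu>)) F"
  shows "emeasure \<nu> UNIV \<le> ennreal c"
proof -
  have s: "sets \<nu> = sets borel" using \<nu> by (simp add: radon_def)
  have sp: "space \<nu> = UNIV" using sets_eq_imp_space_eq[OF s] by simp
  have "emeasure \<nu> K \<le> ennreal c" if K: "compact K" for K
  proof -
    obtain f where f: "f \<in> Cc" "\<And>x. 0 \<le> f x \<and> f x \<le> 1" "\<And>x. x \<in> K \<Longrightarrow> f x = 1"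
      using Cc_Urysohn[OF lc K] by blast
    obtain L where L: "compact L" "\<And>x. x \<notin> L \<Longrightarrow> f x = 0" using f(1) by (auto simp: Cc_def)
    have [measurable]: "f \<in> borel_measurable \<nu>" using Cc_measurable[OF f(1)] s by (simp cong: measurable_cong_sets)
    have "(\<integral>\<^sup>+ x. ennreal (norm (f x)) \<partial>\<nu>) \<le> (\<integral>\<^sup>+ x. indicator L x \<partial>\<nu>)"
    proof (intro nn_integral_mono)
      fix x show "ennreal (norm (f x)) \<le> indicator L x"
        using f(2)[of x] L(2)[of x] by (cases "x \<in> L") auto
    qed
    also have "\<dots> = emeasure \<nu> L" using L s by (simp add: borel_compact)
    also have "\<dots> < \<infinity>" using \<nu> L by (simp add: radon_def)
    finally have int: "integrable \<nu> f" by (intro integrableI_bounded) auto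
    have "emeasure \<nu> K = (\<integral>\<^sup>+ x. indicator K x \<partial>\<nu>)" using K s by (simp add: borel_compact)
    also have "\<dots> \<le> (\<integral>\<^sup>+ x. ennreal (f x) \<partial>\<nu>)"
      using f by (intro nn_integral_mono) (auto split: split_indicator)
    also have "\<dots> = ennreal (\<integral>x. f x \<partial>\<nu>)" using f int by (intro nn_integral_eq_integral) auto
    also have "\<dots> \<le> ennreal c"
    proof (intro ennreal_leI tendsto_upperbound[OF vague[OF f(1)] _ F])
      show "\<forall>\<^sub>F s in F. (\<integral>x. f x \<partial>m s) \<le> c" using ev
      proof eventually_elim
        case (elim s)
        then interpret finite_measure "m s" by (simp add: fradon_finite_measure)
        have "(\<integral>x. f x \<partial>m s) \<le> (\<integral>x. 1 \<partial>m s)"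
          using f elim by (intro integral_mono Cc_integrable[OF f(1)]) auto
        also have "\<dots> = measure (m s) UNIV" using elim by (simp add: fradon_space)
        finally show ?case using elim by simp
      qed
    qed
    finally show ?thesis .
  qed
  moreover have "emeasure \<nu> UNIV = (SUP K\<in>{K. compact K \<and> K \<subseteq> UNIV}. emeasure \<nu> K)"
    using \<nu> unfolding radon_def by (metis open_UNIV)
  ultimately show ?thesis by (auto intro: SUP_least)
qed

section \<open>Sums of measures\<close>

text \<open>Energies are summed in \<open>ennreal\<close>, while the values of the integrals are
  real sums; this is the passage between the two.\<close>

lemma infsum_ennreal_has_sum:
  fixes f :: "'i \<Rightarrow> real"
  assumes nn: "\<And>i. i \<in> S \<Longrightarrow> 0 \<le> f i" and r: "0 \<le> r" and s: "infsum (\<lambda>i. ennreal (f i)) S = ennreal r"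
  shows "(f has_sum r) S"
proof -
  have sup: "infsum (\<lambda>i. ennreal (f i)) S = (SUP F\<in>{F. finite F \<and> F \<subseteq> S}. \<Sum>i\<in>F. ennreal (f i))"
    by (rule nonneg_infsum_complete) simp
  have sum: "(\<Sum>i\<in>F. ennreal (f i)) = ennreal (sum f F)" if "F \<subseteq> S" for F
    using that nn by (intro sum_ennreal) auto
  have "sum f F \<le> r" if "finite F" "F \<subseteq> S" for F
  proof -
    have "(\<Sum>i\<in>F. ennreal (f i)) \<le> ennreal r" unfolding s[symmetric] sup using that by (intro SUP_upper) auto
    then show ?thesis using r sum[OF that(2)] by (simp add: ennreal_le_iff)
  qed
  then have summ: "f summable_on S"
    using nn by (intro nonneg_bdd_above_summable_on bdd_aboveI[of _ r]) auto
  have "ennreal (infsum f S) = (SUP F\<in>{F. finite F \<and> F \<subseteq> S}. ennreal (sum f F))"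
    using summ nn by (rule infsum_nonneg_is_SUPREMUM_ennreal)
  also have "\<dots> = (SUP F\<in>{F. finite F \<and> F \<subseteq> S}. \<Sum>i\<in>F. ennreal (f i))"
    by (intro SUP_cong) (simp_all add: sum)
  also have "\<dots> = ennreal r" using sup s by simp
  finally have "infsum f S = r" using r nn by (simp add: infsum_nonneg)
  then show ?thesis using has_sum_infsum[OF summ] by simp
qed

lemma nn_integral_count_space_summable:
  fixes f :: "'i \<Rightarrow> real"
  assumes "f summable_on S" "countable S" "\<And>i. i \<in> S \<Longrightarrow> 0 \<le> f i"
  shows "(\<integral>\<^sup>+ i. ennreal (f i) \<partial>count_space S) = ennreal (infsum f S)"
proof -
  have "(\<Sum>i\<in>F. ennreal (f i)) = ennreal (sum f F)" if "F \<subseteq> S" for F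
    using that assms by (intro sum_ennreal) auto
  then have "(SUP F\<in>{F. finite F \<and> F \<subseteq> S}. \<Sum>i\<in>F. ennreal (f i)) = (SUP F\<in>{F. finite F \<and> F \<subseteq> S}. ennreal (sum f F))"
    by (intro SUP_cong) auto
  also have "\<dots> = ennreal (infsum f S)"
    using assms by (intro infsum_nonneg_is_SUPREMUM_ennreal[symmetric]) auto
  finally have "(SUP F\<in>{F. finite F \<and> F \<subseteq> S}. \<Sum>i\<in>F. ennreal (f i)) = ennreal (infsum f S)" .
  then show ?thesis
    unfolding infsum_eq_nn_integral_count_space[OF assms(2), symmetric]
    by (subst nonneg_infsum_complete) auto
qed

lemma concentrated_AE: "sets M = sets borel \<Longrightarrow> concentrated M E \<Longrightarrow> AE x in M. x \<in> E"
proof -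
  assume s: "sets M = sets borel" and "concentrated M E"
  then obtain N where N: "N \<in> null_sets M" "UNIV - E \<subseteq> N" by (auto simp: concentrated_def)
  show "AE x in M. x \<in> E" by (rule AE_I'[OF N(1)]) (use N(2) in auto)
qed

lemma AE_concentrated:
  assumes s: "sets M = sets borel" and ae: "AE x in M. x \<in> E"
  shows "concentrated M E"
proof -
  have "space M = UNIV" using sets_eq_imp_space_eq[OF s] by simp
  then show ?thesis using ae unfolding eventually_ae_filter concentrated_def by auto
qed

context energy_kernel
begin

text \<open>The two arguments of the energy are enlarged one after the other, with symmetry
  exchanging them in between.\<close>

lemma energy_dominated:
  assumes M: "fradon M" and N: "N \<in> \<E>"
    and le: "\<And>f. f \<in> borel_measurable borel \<Longrightarrow> (\<integral>\<^sup>+ x. f x \<partial>M) \<le> (\<integral>\<^sup>+ x. f x \<partial>N)"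
  shows "M \<in> \<E>"
proof -
  have N': "fradon N" using N by (rule energy_fradon)
  have "menergy \<kappa> M M \<le> menergy \<kappa> N M"
    unfolding menergy_def by (rule le[OF pot_measurable[OF M]])
  also have "\<dots> = menergy \<kappa> M N" by (rule mutual_commute[OF N' M])
  also have "\<dots> \<le> menergy \<kappa> N N"
    unfolding menergy_def by (rule le[OF pot_measurable[OF N']])
  finally show ?thesis using M N by (auto simp: \<E>_def)
qed

lemma energy_msum_member:
  assumes P: "msum S \<mu> \<in> \<E>" and s: "\<And>j. j \<in> S \<Longrightarrow> fradon (\<mu> j)" and i: "i \<in> S"
  shows "\<mu> i \<in> \<E>" "e (\<mu> i) (\<mu> i) \<le> e (msum S \<mu>) (msum S \<mu>)"
proof -
  have b: "sets (\<mu> j) = sets borel" if "j \<in> S" for j using s[OF that] by (rule fradon_sets)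
  have le: "menergy \<kappa> (\<mu> i) \<nu> \<le> menergy \<kappa> (msum S \<mu>) \<nu>" if "fradon \<nu>" for \<nu>
    using nn_integral_ge_point[OF i, of "\<lambda>j. menergy \<kappa> (\<mu> j) \<nu>"] menergy_msum_left[of S \<mu> \<nu>, OF b that] by simp
  have "menergy \<kappa> (\<mu> i) (\<mu> i) \<le> menergy \<kappa> (msum S \<mu>) (msum S \<mu>)"
    using le[OF s[OF i]] le[OF energy_fradon[OF P]] mutual_commute[OF s[OF i] energy_fradon[OF P]] by simp
  moreover from this show "\<mu> i \<in> \<E>" using P s[OF i] by (auto simp: \<E>_def)
  ultimately show "e (\<mu> i) (\<mu> i) \<le> e (msum S \<mu>) (msum S \<mu>)"
    using P by (auto simp: e_def \<E>_def intro!: enn2real_mono)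
qed

lemma e_msum_has_sum:
  assumes P: "msum S \<mu> \<in> \<E>" and c: "countable S" and s: "\<And>j. j \<in> S \<Longrightarrow> fradon (\<mu> j)" and \<xi>: "\<xi> \<in> \<E>"
  shows "((\<lambda>j. e (\<mu> j) \<xi>) has_sum e (msum S \<mu>) \<xi>) S"
proof (rule infsum_ennreal_has_sum)
  have "infsum (\<lambda>j. ennreal (e (\<mu> j) \<xi>)) S = (\<integral>\<^sup>+ j. menergy \<kappa> (\<mu> j) \<xi> \<partial>count_space S)"
    unfolding infsum_eq_nn_integral_count_space[OF c]
    by (intro nn_integral_cong ennreal_e energy_msum_member(1)[OF P s] \<xi>) auto
  also have "\<dots> = menergy \<kappa> (msum S \<mu>) \<xi>"
    using s \<xi> by (intro menergy_msum_left[symmetric]) (auto simp: fradon_sets energy_fradon)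
  finally show "infsum (\<lambda>j. ennreal (e (\<mu> j) \<xi>)) S = ennreal (e (msum S \<mu>) \<xi>)"
    using ennreal_e[OF P \<xi>] by simp
qed (auto simp: e_nonneg)

lemma infsum_menergy:
  assumes c: "countable S" and s: "\<And>j. j \<in> S \<Longrightarrow> fradon (\<mu> j)" and P: "fradon (msum S \<mu>)" and \<xi>: "fradon \<xi>"
  shows "infsum (\<lambda>j. menergy \<kappa> \<xi> (\<mu> j)) S = menergy \<kappa> \<xi> (msum S \<mu>)"
proof -
  have "infsum (\<lambda>j. menergy \<kappa> \<xi> (\<mu> j)) S = (\<integral>\<^sup>+ j. menergy \<kappa> (\<mu> j) \<xi> \<partial>count_space S)"
    unfolding infsum_eq_nn_integral_count_space[OF c]
    using s \<xi> by (intro nn_integral_cong mutual_commute) auto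
  also have "\<dots> = menergy \<kappa> (msum S \<mu>) \<xi>"
    using s \<xi> by (intro menergy_msum_left[symmetric]) (auto simp: fradon_sets)
  also have "\<dots> = menergy \<kappa> \<xi> (msum S \<mu>)" by (rule mutual_commute[OF P \<xi>])
  finally show ?thesis .
qed

text \<open>Tonelli for counting measures turns the double series in the definition of vector
  energies into the mutual energy of two single measures.\<close>

lemma blockE_msum:
  assumes c: "countable S" "countable T" and s: "\<And>j. j \<in> S \<Longrightarrow> fradon (\<mu> j)" "\<And>j. j \<in> T \<Longrightarrow> fradon (\<nu> j)"
    and f: "fradon (msum T \<nu>)"
  shows "blockE \<kappa> S T \<mu> \<nu> = menergy \<kappa> (msum S \<mu>) (msum T \<nu>)"
proof -
  interpret T: sigma_finite_measure "count_space T" using c by (rule_tac sigma_finite_measure_count_space_countable)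
  have "blockE \<kappa> S T \<mu> \<nu> = (\<integral>\<^sup>+ p. menergy \<kappa> (\<mu> (fst p)) (\<nu> (snd p)) \<partial>count_space (S \<times> T))"
    unfolding blockE_def using c by (simp add: infsum_eq_nn_integral_count_space case_prod_beta')
  also have "\<dots> = (\<integral>\<^sup>+ i. \<integral>\<^sup>+ j. menergy \<kappa> (\<mu> i) (\<nu> j) \<partial>count_space T \<partial>count_space S)"
    unfolding pair_measure_countable[OF c, symmetric] by (subst T.nn_integral_fst[symmetric]) (auto simp: pair_measure_countable[OF c])
  also have "\<dots> = (\<integral>\<^sup>+ i. menergy \<kappa> (\<mu> i) (msum T \<nu>) \<partial>count_space S)"
    using s f c by (intro nn_integral_cong) (simp add: infsum_menergy infsum_eq_nn_integral_count_space[symmetric])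
  also have "\<dots> = menergy \<kappa> (msum S \<mu>) (msum T \<nu>)"
    using s f by (intro menergy_msum_left[symmetric]) (auto simp: fradon_sets)
  finally show ?thesis .
qed

lemma bf_sym: "P \<in> \<E> \<Longrightarrow> N \<in> \<E> \<Longrightarrow> P' \<in> \<E> \<Longrightarrow> N' \<in> \<E> \<Longrightarrow> bf P N P' N' = bf P' N' P N"
  unfolding bf_def using e_sym[of P P'] e_sym[of N N'] e_sym[of P N'] e_sym[of N P'] by simp

text \<open>The difference of \<open>P - N\<close> and \<open>P' - N'\<close> is represented by the
  pair \<open>(P + N', N + P')\<close>, which avoids subtracting measures.\<close>

lemma bf_diff_self:
  assumes m: "P \<in> \<E>" "N \<in> \<E>" "P' \<in> \<E>" "N' \<in> \<E>"
  shows "bf (madd P N') (madd N P') (madd P N') (madd N P') = bf P N P N - 2 * bf P N P' N' + bf P' N' P' N'"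
  using m e_sym[OF m(1,3)] e_sym[OF m(1,4)] e_sym[OF m(2,3)] e_sym[OF m(2,4)]
  by (simp add: bf_def e_madd_left e_madd_right energy_madd)

lemma bf_diff_self_nonneg:
  assumes m: "P \<in> \<E>" "N \<in> \<E>" "P' \<in> \<E>" "N' \<in> \<E>"
  shows "0 \<le> bf P N P N - 2 * bf P N P' N' + bf P' N' P' N'"
  unfolding bf_diff_self[OF m, symmetric] using m by (intro bf_self_nonneg energy_madd)

lemma bf_diff_Cauchy_Schwarz:
  assumes m: "P \<in> \<E>" "N \<in> \<E>" "P' \<in> \<E>" "N' \<in> \<E>" "Q \<in> \<E>" "R \<in> \<E>"
  shows "\<bar>bf P N Q R - bf P' N' Q R\<bar>
     \<le> sqrt (bf P N P N - 2 * bf P N P' N' + bf P' N' P' N') * sqrt (bf Q R Q R)"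
proof -
  have "bf (madd P N') (madd N P') Q R = bf P N Q R - bf P' N' Q R"
    using m by (simp add: bf_def e_madd_left)
  with Cauchy_Schwarz[of "madd P N'" "madd N P'" Q R] m show ?thesis by (simp add: energy_madd bf_diff_self)
qed

lemma pot_AE_finite:
  assumes "m \<in> \<E>" "\<sigma> \<in> \<E>" shows "AE x in m. pot \<kappa> \<sigma> x < \<infinity>"
proof -
  have "AE x in m. pot \<kappa> \<sigma> x \<noteq> \<infinity>"
    using mutual_finite[OF assms] pot_measurable[OF energy_fradon[OF assms(2)]] fradon_sets[OF energy_fradon[OF assms(1)]]
    by (intro nn_integral_PInf_AE) (auto simp: menergy_def cong: measurable_cong_sets)
  then show ?thesis by eventually_elim (simp add: less_top)
qed

text \<open>Finite mutual energy makes the potential finite almost everywhere, so replacing infinite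
  values by 0 does not alter the integral.\<close>

lemma pot_integral:
  assumes "m \<in> \<E>" "\<sigma> \<in> \<E>"
  shows "integrable m (\<lambda>x. enn2real (pot \<kappa> \<sigma> x))" "(\<integral>x. enn2real (pot \<kappa> \<sigma> x) \<partial>m) = e m \<sigma>"
proof -
  have [measurable]: "pot \<kappa> \<sigma> \<in> borel_measurable m"
    using pot_measurable[OF energy_fradon[OF assms(2)]] fradon_sets[OF energy_fradon[OF assms(1)]] by (simp cong: measurable_cong_sets)
  have eq: "(\<integral>\<^sup>+ x. ennreal (enn2real (pot \<kappa> \<sigma> x)) \<partial>m) = menergy \<kappa> m \<sigma>"
    unfolding menergy_def using pot_AE_finite[OF assms]
    by (intro nn_integral_cong_AE) (auto simp: ennreal_enn2real_if)
  show "integrable m (\<lambda>x. enn2real (pot \<kappa> \<sigma> x))"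
    using eq mutual_finite[OF assms] by (intro integrableI_bounded) auto
  show "(\<integral>x. enn2real (pot \<kappa> \<sigma> x) \<partial>m) = e m \<sigma>"
    unfolding e_def using eq by (subst integral_eq_nn_integral) auto
qed

end

section \<open>Capacity zero and measures of finite energy\<close>

text \<open>Without competitors the infimum over the empty set is \<open>top\<close>, whose inverse
  is 0.\<close>

lemma nearly_everywhereI:
  assumes "\<And>m. m \<in> Eplus \<kappa> \<Longrightarrow> concentrated m {x\<in>S. \<not> P x} \<Longrightarrow> emeasure m UNIV = 1 \<Longrightarrow> False"
  shows "nearly_everywhere \<kappa> S P"
proof -
  have "{m. m \<in> Eplus \<kappa> \<and> concentrated m {x\<in>S. \<not> P x} \<and> emeasure m UNIV = 1} = {}" using assms by blast
  then show ?thesis unfolding nearly_everywhere_def icap_def by (simp only:) simp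
qed

lemma nearly_everywhereD:
  assumes "nearly_everywhere \<kappa> S P" "m \<in> Eplus \<kappa>" "concentrated m {x\<in>S. \<not> P x}" "emeasure m UNIV = 1"
  shows False
proof -
  have "(INF \<nu>\<in>{\<nu>. \<nu> \<in> Eplus \<kappa> \<and> concentrated \<nu> {x\<in>S. \<not> P x} \<and> emeasure \<nu> UNIV = 1}. menergy \<kappa> \<nu> \<nu>) \<le> menergy \<kappa> m m"
    using assms by (intro INF_lower) auto
  also have "\<dots> < top" using assms by (simp add: Eplus_def)
  finally show False using assms(1) by (simp add: nearly_everywhere_def icap_def)
qed

text \<open>A member of \<open>\<E>\<close> does not charge a Borel set of capacity zero, since its
  normalized restriction would be a competitor in the definition of the capacity.\<close>

lemma (in energy_kernel) nearly_everywhere_AE: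
  assumes ne: "nearly_everywhere \<kappa> S P" and m: "m \<in> \<E>" and c: "concentrated m S" and B: "{x\<in>S. \<not> P x} \<in> sets borel"
  shows "AE x in m. x \<in> S \<and> P x"
proof -
  let ?B = "{x\<in>S. \<not> P x}"
  have f: "fradon m" using m by (rule energy_fradon)
  note s = fradon_sets[OF f]
  have "emeasure m ?B = 0"
  proof (rule ccontr)
    assume nz: "emeasure m ?B \<noteq> 0"
    define r where "r = emeasure m ?B"
    have r: "r \<noteq> 0" "r < top" using nz f by (auto simp: r_def fradon_emeasure)
    let ?n = "scale_measure (inverse r) (restr m ?B)"
    have n\<E>: "?n \<in> \<E>" using r by (intro energy_scale energy_restr m B) (simp add: less_top[symmetric])
    have "emeasure ?n UNIV = inverse r * r"
      using B s by (simp add: emeasure_restr r_def)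
    also have "\<dots> = 1" using r by (cases r) (auto simp: inverse_ennreal ennreal_mult[symmetric])
    finally have "emeasure ?n UNIV = 1" .
    moreover have "UNIV - ?B \<in> null_sets ?n"
      using B s by (intro null_setsI) (auto simp: emeasure_restr)
    then have "concentrated ?n ?B" unfolding concentrated_def by blast
    ultimately show False
      using n\<E> by (intro nearly_everywhereD[OF ne]) (auto simp: Eplus_def \<E>_def fradon_def)
  qed
  then have "AE x in m. x \<notin> ?B" using B s by (intro AE_not_in null_setsI) auto
  with concentrated_AE[OF s c] show ?thesis by eventually_elim auto
qed

section \<open>Minimizing nets\<close>

locale minimizing_net = energy_kernel \<kappa> h
  for \<kappa> :: "'a::t2_space \<Rightarrow> 'a \<Rightarrow> ennreal" and h :: real +
  fixes Ip In :: "'i set" and A :: "'i \<Rightarrow> 'a set"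
    and chiP chiN :: "'a measure" and g :: "'a \<Rightarrow> real" and a :: "'i \<Rightarrow> real"
    and \<gamma> :: "'i \<Rightarrow> 'a measure" and F :: "('i \<Rightarrow> 'a measure) filter" and c :: real
  assumes lc: "locally_compact_space (euclidean :: 'a topology)"
    and cond: "condenser \<kappa> Ip In A"
    and field: "external_field \<kappa> Ip In A chiP chiN"
    and gcont: "continuous_on (\<Union>i\<in>Ip \<union> In. A i) g"
    and c_pos: "c > 0" and c_le: "\<And>x i. i \<in> Ip \<union> In \<Longrightarrow> x \<in> A i \<Longrightarrow> c \<le> g x"
    and a_pos: "\<And>i. i \<in> Ip \<union> In \<Longrightarrow> a i > 0" and a_summable: "a summable_on (Ip \<union> In)"
    and \<gamma>_mem: "\<gamma> \<in> EplusA \<kappa> Ip In A"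
    and F_nonbot: "F \<noteq> bot"
    and ev_adm: "\<forall>\<^sub>F \<mu> in F. \<mu> \<in> EplusAag \<kappa> Ip In A a g (Ip \<union> In)"
    and Glim: "((\<lambda>\<mu>. ereal (Gchi \<kappa> Ip In chiP chiN \<mu>)) \<longlongrightarrow> Ginf \<kappa> Ip In A chiP chiN a g (Ip \<union> In)) F"
    and strong: "((\<lambda>\<mu>. vdist \<kappa> Ip In \<mu> \<gamma>) \<longlongrightarrow> 0) F"
    and vague: "\<And>i f. i \<in> Ip \<union> In \<Longrightarrow> f \<in> Cc \<Longrightarrow> ((\<lambda>\<mu>. \<integral>x. f x \<partial>(\<mu> i)) \<longlongrightarrow> (\<integral>x. f x \<partial>(\<gamma> i))) F"
begin

lemma countable_I: "countable (Ip \<union> In)" and disjoint_I: "Ip \<inter> In = {}"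
  and closed_A: "i \<in> Ip \<union> In \<Longrightarrow> closed (A i)"
  using cond by (auto simp: condenser_def)

lemma countable_Ip: "countable Ip" and countable_In: "countable In"
  using countable_I by auto

lemma chi_energy: "chiP \<in> \<E>" "chiN \<in> \<E>"
  using field by (auto simp: external_field_def inE_def \<E>_def fradon_def)

definition mass_bounded :: "('i \<Rightarrow> 'a measure) \<Rightarrow> bool" where
  "mass_bounded \<mu> \<longleftrightarrow> (\<forall>i\<in>Ip \<union> In. fradon (\<mu> i) \<and> emeasure (\<mu> i) UNIV \<le> ennreal (a i / c))"

text \<open>Markov's inequality: \<open>g\<close> is at least \<open>c\<close> on
  \<open>A i\<close>, which carries \<open>m\<close>.\<close>

lemma mass_bound_of_constraint:
  assumes r: "radon m" and i: "i \<in> Ip \<union> In" and con: "concentrated m (A i)"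
    and g: "(\<integral>\<^sup>+ x. ennreal (g x) \<partial>m) = ennreal (a i)"
  shows "fradon m" "emeasure m UNIV \<le> ennreal (a i / c)"
proof -
  have s: "sets m = sets borel" using r by (simp add: radon_def)
  have sp: "space m = UNIV" using sets_eq_imp_space_eq[OF s] by simp
  have "ennreal c * emeasure m UNIV = (\<integral>\<^sup>+ x. ennreal c \<partial>m)" using sp by simp
  also have "\<dots> \<le> (\<integral>\<^sup>+ x. ennreal (g x) \<partial>m)"
    using concentrated_AE[OF s con] c_le[OF i] by (intro nn_integral_mono_AE) (auto intro: ennreal_leI)
  finally have le: "ennreal c * emeasure m UNIV \<le> ennreal (a i)" using g by simp
  show *: "emeasure m UNIV \<le> ennreal (a i / c)"
  proof (cases "emeasure m UNIV")
    case (real r)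
    then have "c * r \<le> a i"
      using le c_pos a_pos[OF i] by (simp add: ennreal_le_iff flip: ennreal_mult)
    then show ?thesis using real c_pos by (simp add: field_simps ennreal_leI)
  next
    case top then show ?thesis using le c_pos by (simp add: ennreal_mult_top top_unique)
  qed
  then show "fradon m" using r by (auto simp: fradon_def intro: le_less_trans)
qed

lemma adm_mass_bounded:
  assumes "\<mu> \<in> EplusAag \<kappa> Ip In A a g (Ip \<union> In)" shows "mass_bounded \<mu>"
  using assms mass_bound_of_constraint unfolding mass_bounded_def EplusAag_def EplusA_def by blast

text \<open>The constraint itself may be lost in the vague limit; its consequence for the mass is
  inherited.\<close>

lemma \<gamma>_mass_bounded: "mass_bounded \<gamma>"
  unfolding mass_bounded_def
proof (intro ballI conjI)
  fix i assume i: "i \<in> Ip \<union> In"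
  have r: "radon (\<gamma> i)" using \<gamma>_mem i by (simp add: EplusA_def)
  show *: "emeasure (\<gamma> i) UNIV \<le> ennreal (a i / c)"
  proof (rule vague_limit_mass_le[OF lc F_nonbot _ r vague[OF i]])
    show "\<forall>\<^sub>F \<mu> in F. fradon (\<mu> i) \<and> measure (\<mu> i) UNIV \<le> a i / c"
      using ev_adm
    proof eventually_elim
      case (elim \<mu>)
      then have "fradon (\<mu> i)" "emeasure (\<mu> i) UNIV \<le> ennreal (a i / c)"
        using adm_mass_bounded i by (auto simp: mass_bounded_def)
      then show ?case using c_pos a_pos[OF i] by (simp add: fradon_emeasure ennreal_le_iff)
    qed
  qed
  then show "fradon (\<gamma> i)" using r by (auto simp: fradon_def intro: le_less_trans)
qed

definition T :: ennreal where "T = (\<integral>\<^sup>+ i. ennreal (a i / c) \<partial>count_space (Ip \<union> In))"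

lemma T_finite: "T < \<infinity>"
proof -
  have "(\<lambda>i. a i / c) summable_on (Ip \<union> In)"
    using summable_on_cmult_right[OF a_summable, of "1/c"] by simp
  then show ?thesis unfolding T_def using countable_I a_pos c_pos
    by (subst nn_integral_count_space_summable) (auto intro: less_imp_le)
qed

lemma total_mass:
  assumes "mass_bounded \<mu>" "S \<subseteq> Ip \<union> In"
  shows "(\<integral>\<^sup>+ i. emeasure (\<mu> i) UNIV \<partial>count_space S) \<le> T"
proof -
  have "(\<integral>\<^sup>+ i. emeasure (\<mu> i) UNIV \<partial>count_space S) \<le> (\<integral>\<^sup>+ i. ennreal (a i / c) \<partial>count_space S)"
    using assms by (intro nn_integral_mono) (auto simp: mass_bounded_def)
  also have "\<dots> = (\<integral>\<^sup>+ i. ennreal (a i / c) * indicator S i \<partial>count_space (Ip \<union> In))"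
    using assms(2) by (subst nn_integral_count_space_indicator) (auto simp: nn_integral_count_space_indicator[of "Ip \<union> In"] intro!: nn_integral_cong split: split_indicator)
  also have "\<dots> \<le> T" unfolding T_def by (intro nn_integral_mono) (auto split: split_indicator)
  finally show ?thesis .
qed

lemma fradon_parts:
  assumes "mass_bounded \<mu>" shows "fradon (msum Ip \<mu>)" "fradon (msum In \<mu>)"
  using assms countable_I T_finite total_mass[OF assms, of Ip] total_mass[OF assms, of In]
  by (auto intro!: fradon_msum simp: mass_bounded_def intro: le_less_trans)

lemma blockE_eq:
  assumes "mass_bounded \<mu>" "mass_bounded \<nu>"
  shows "blockE \<kappa> Ip Ip \<mu> \<nu> = menergy \<kappa> (msum Ip \<mu>) (msum Ip \<nu>)"
    "blockE \<kappa> Ip In \<mu> \<nu> = menergy \<kappa> (msum Ip \<mu>) (msum In \<nu>)"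
    "blockE \<kappa> In Ip \<mu> \<nu> = menergy \<kappa> (msum In \<mu>) (msum Ip \<nu>)"
    "blockE \<kappa> In In \<mu> \<nu> = menergy \<kappa> (msum In \<mu>) (msum In \<nu>)"
  using assms fradon_parts[OF assms(2)] countable_Ip countable_In
  by (auto intro!: blockE_msum simp: mass_bounded_def)

text \<open>The constraint is replaced by its mass bound, so that \<open>\<gamma>\<close> and the
  members of the net satisfy the same condition and share all energy formulas.\<close>

definition adm :: "('i \<Rightarrow> 'a measure) \<Rightarrow> bool" where
  "adm \<mu> \<longleftrightarrow> mass_bounded \<mu> \<and> (\<forall>i\<in>Ip \<union> In. concentrated (\<mu> i) (A i)) \<and> msum Ip \<mu> \<in> \<E> \<and> msum In \<mu> \<in> \<E>"

text \<open>The mixed block in \<open>EplusA\<close> is finite once both diagonal blocks are, by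
  \<open>mutual_finite\<close>.\<close>

lemma adm_iff: "mass_bounded \<mu> \<Longrightarrow> adm \<mu> \<longleftrightarrow> \<mu> \<in> EplusA \<kappa> Ip In A"
  unfolding adm_def EplusA_def using fradon_parts[of \<mu>] mutual_finite[of "msum Ip \<mu>" "msum In \<mu>"]
  by (auto simp: blockE_eq \<E>_def mass_bounded_def fradon_def)

lemma adm_\<gamma>: "adm \<gamma>"
  using adm_iff[OF \<gamma>_mass_bounded] \<gamma>_mem by simp

lemma adm_EplusAag: "\<mu> \<in> EplusAag \<kappa> Ip In A a g (Ip \<union> In) \<Longrightarrow> adm \<mu>"
  using adm_iff[OF adm_mass_bounded] by (simp add: EplusAag_def)

lemma adm_fradon: "adm \<mu> \<Longrightarrow> i \<in> Ip \<union> In \<Longrightarrow> fradon (\<mu> i)"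
  and adm_energy: "adm \<mu> \<Longrightarrow> i \<in> Ip \<union> In \<Longrightarrow> \<mu> i \<in> \<E>"
  and adm_parts: "adm \<mu> \<Longrightarrow> msum Ip \<mu> \<in> \<E>" "adm \<mu> \<Longrightarrow> msum In \<mu> \<in> \<E>"
proof -
  show *: "adm \<mu> \<Longrightarrow> i \<in> Ip \<union> In \<Longrightarrow> fradon (\<mu> i)" for i by (simp add: adm_def mass_bounded_def)
  show "adm \<mu> \<Longrightarrow> i \<in> Ip \<union> In \<Longrightarrow> \<mu> i \<in> \<E>"
    using energy_msum_member(1)[of Ip \<mu> i] energy_msum_member(1)[of In \<mu> i] * by (auto simp: adm_def)
  show "adm \<mu> \<Longrightarrow> msum Ip \<mu> \<in> \<E>" "adm \<mu> \<Longrightarrow> msum In \<mu> \<in> \<E>" by (auto simp: adm_def)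
qed

lemma vmut_eq:
  "adm \<mu> \<Longrightarrow> adm \<nu> \<Longrightarrow> vmut \<kappa> Ip In \<mu> \<nu> = bf (msum Ip \<mu>) (msum In \<mu>) (msum Ip \<nu>) (msum In \<nu>)"
  unfolding vmut_def bf_def e_def by (simp add: blockE_eq adm_def)

lemma chimut_eq: "adm \<mu> \<Longrightarrow> chimut \<kappa> Ip In chiP chiN \<mu> = bf (msum Ip \<mu>) (msum In \<mu>) chiP chiN"
proof -
  assume \<mu>: "adm \<mu>"
  have "infsum (\<lambda>j. menergy \<kappa> \<xi> (\<mu> j)) Ip = menergy \<kappa> \<xi> (msum Ip \<mu>)" "infsum (\<lambda>j. menergy \<kappa> \<xi> (\<mu> j)) In = menergy \<kappa> \<xi> (msum In \<mu>)"
    if "\<xi> \<in> \<E>" for \<xi>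
    using \<mu> that countable_Ip countable_In adm_parts adm_energy
    by (auto intro!: infsum_menergy energy_fradon)
  then have "chimut \<kappa> Ip In chiP chiN \<mu> = bf chiP chiN (msum Ip \<mu>) (msum In \<mu>)"
    unfolding chimut_def bf_def e_def using chi_energy by simp
  then show ?thesis using bf_sym chi_energy adm_parts[OF \<mu>] by simp
qed

lemma Gchi_eq: "adm \<mu> \<Longrightarrow> Gchi \<kappa> Ip In chiP chiN \<mu> =
    bf (msum Ip \<mu>) (msum In \<mu>) (msum Ip \<mu>) (msum In \<mu>) + 2 * bf (msum Ip \<mu>) (msum In \<mu>) chiP chiN"
  by (simp add: Gchi_def vnorm2_def vmut_eq chimut_eq)

lemma ev_adm': "\<forall>\<^sub>F \<mu> in F. adm \<mu>"
  using ev_adm by eventually_elim (rule adm_EplusAag)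

lemma vdist_eq: "adm \<mu> \<Longrightarrow> vdist \<kappa> Ip In \<mu> \<gamma> =
   sqrt (bf (msum Ip \<mu>) (msum In \<mu>) (msum Ip \<mu>) (msum In \<mu>) - 2 * bf (msum Ip \<mu>) (msum In \<mu>) (msum Ip \<gamma>) (msum In \<gamma>)
      + bf (msum Ip \<gamma>) (msum In \<gamma>) (msum Ip \<gamma>) (msum In \<gamma>))"
  using adm_\<gamma> by (simp add: vdist_def vmut_eq)

section \<open>Limits of energies along the net\<close>

lemma bf_tendsto:
  assumes "Q \<in> \<E>" "R \<in> \<E>"
  shows "((\<lambda>\<mu>. bf (msum Ip \<mu>) (msum In \<mu>) Q R) \<longlongrightarrow> bf (msum Ip \<gamma>) (msum In \<gamma>) Q R) F"
proof (rule LIM_zero_cancel, rule Lim_null_comparison[where g="\<lambda>\<mu>. vdist \<kappa> Ip In \<mu> \<gamma> * sqrt (bf Q R Q R)"])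
  show "((\<lambda>\<mu>. vdist \<kappa> Ip In \<mu> \<gamma> * sqrt (bf Q R Q R)) \<longlongrightarrow> 0) F"
    using strong by (rule tendsto_mult_left_zero)
  show "\<forall>\<^sub>F \<mu> in F. norm (bf (msum Ip \<mu>) (msum In \<mu>) Q R - bf (msum Ip \<gamma>) (msum In \<gamma>) Q R)
      \<le> vdist \<kappa> Ip In \<mu> \<gamma> * sqrt (bf Q R Q R)"
    using ev_adm'
  proof eventually_elim
    case (elim \<mu>)
    then show ?case unfolding vdist_eq[OF elim] real_norm_def
      using adm_\<gamma> assms by (intro bf_diff_Cauchy_Schwarz adm_parts)
  qed
qed

text \<open>The squared norm of \<open>\<mu>\<close> is the squared distance to
  \<open>\<gamma>\<close> plus twice the product with \<open>\<gamma>\<close> minus the squared norm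
  of \<open>\<gamma>\<close>; the product converges by the preceding weak statement.\<close>

lemma norm_tendsto:
  "((\<lambda>\<mu>. bf (msum Ip \<mu>) (msum In \<mu>) (msum Ip \<mu>) (msum In \<mu>))
     \<longlongrightarrow> bf (msum Ip \<gamma>) (msum In \<gamma>) (msum Ip \<gamma>) (msum In \<gamma>)) F"
proof -
  let ?b = "\<lambda>\<mu> \<nu>. bf (msum Ip \<mu>) (msum In \<mu>) (msum Ip \<nu>) (msum In \<nu>)"
  have "((\<lambda>\<mu>. (vdist \<kappa> Ip In \<mu> \<gamma>)\<^sup>2 + 2 * ?b \<mu> \<gamma> - ?b \<gamma> \<gamma>) \<longlongrightarrow> 0\<^sup>2 + 2 * ?b \<gamma> \<gamma> - ?b \<gamma> \<gamma>) F"
    using adm_\<gamma> by (intro tendsto_intros strong bf_tendsto adm_parts)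
  moreover have "\<forall>\<^sub>F \<mu> in F. (vdist \<kappa> Ip In \<mu> \<gamma>)\<^sup>2 + 2 * ?b \<mu> \<gamma> - ?b \<gamma> \<gamma> = ?b \<mu> \<mu>"
    using ev_adm'
  proof eventually_elim
    case (elim \<mu>)
    from bf_diff_self_nonneg[OF adm_parts[OF elim] adm_parts[OF adm_\<gamma>]]
    show ?case unfolding vdist_eq[OF elim] by simp
  qed
  ultimately show ?thesis by (subst (asm) tendsto_cong) auto
qed

lemma G_tendsto: "((\<lambda>\<mu>. Gchi \<kappa> Ip In chiP chiN \<mu>) \<longlongrightarrow> Gchi \<kappa> Ip In chiP chiN \<gamma>) F"
proof -
  have "((\<lambda>\<mu>. bf (msum Ip \<mu>) (msum In \<mu>) (msum Ip \<mu>) (msum In \<mu>) + 2 * bf (msum Ip \<mu>) (msum In \<mu>) chiP chiN)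
     \<longlongrightarrow> Gchi \<kappa> Ip In chiP chiN \<gamma>) F"
    unfolding Gchi_eq[OF adm_\<gamma>] by (intro tendsto_intros norm_tendsto bf_tendsto chi_energy)
  moreover have "\<forall>\<^sub>F \<mu> in F. bf (msum Ip \<mu>) (msum In \<mu>) (msum Ip \<mu>) (msum In \<mu>) + 2 * bf (msum Ip \<mu>) (msum In \<mu>) chiP chiN
     = Gchi \<kappa> Ip In chiP chiN \<mu>"
    using ev_adm' by eventually_elim (simp add: Gchi_eq)
  ultimately show ?thesis by (subst (asm) tendsto_cong) auto
qed

text \<open>Both sides are limits of \<open>G\<close> along the same net. Hence
  \<open>\<gamma>\<close> attains the infimum even where it is not a competitor.\<close>

lemma Ginf_eq: "Ginf \<kappa> Ip In A chiP chiN a g (Ip \<union> In) = ereal (Gchi \<kappa> Ip In chiP chiN \<gamma>)"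
  using tendsto_unique[OF F_nonbot Glim] G_tendsto by simp

text \<open>With \<open>\<sigma>N\<close>, a pair standing for \<open>\<chi> + R \<gamma>\<close>,
  the signed measure whose potential, up to the sign \<open>alpha\<close>, is
  \<open>W\<close>.\<close>

definition \<sigma>P :: "'a measure" where "\<sigma>P = madd chiP (msum Ip \<gamma>)"
definition \<sigma>N :: "'a measure" where "\<sigma>N = madd chiN (msum In \<gamma>)"

lemma \<sigma>_energy: "\<sigma>P \<in> \<E>" "\<sigma>N \<in> \<E>"
  unfolding \<sigma>P_def \<sigma>N_def using adm_\<gamma> chi_energy by (auto intro!: energy_madd adm_parts)

text \<open>The kernel is at most \<open>s\<close> on the product of the two plates, and each total
  measure has mass at most \<open>T\<close>.\<close>

lemma cross_energy_bound:
  "\<exists>B. \<forall>\<mu>. adm \<mu> \<longrightarrow> e (msum Ip \<mu>) (msum In \<mu>) \<le> B"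
proof -
  define s where "s = (SUP p\<in>(\<Union>i\<in>Ip. A i) \<times> (\<Union>j\<in>In. A j). \<kappa> (fst p) (snd p))"
  have s: "s < \<infinity>" using cond by (simp add: condenser_def s_def)
  have ks: "\<kappa> x y \<le> s" if "x \<in> A i" "y \<in> A j" "i \<in> Ip" "j \<in> In" for x y i j
    unfolding s_def using that by (intro SUP_upper2[of "(x, y)"]) auto
  have "menergy \<kappa> (msum Ip \<mu>) (msum In \<mu>) \<le> s * T * T" if \<mu>: "adm \<mu>" for \<mu>
  proof -
    have mb: "mass_bounded \<mu>" using \<mu> by (simp add: adm_def)
    have b: "sets (\<mu> i) = sets borel" if "i \<in> Ip \<union> In" for i using adm_fradon[OF \<mu> that] by (rule fradon_sets)
    have con: "AE x in \<mu> i. x \<in> A i" if "i \<in> Ip \<union> In" for i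
      using \<mu> that by (intro concentrated_AE b) (auto simp: adm_def)
    have sp: "space (\<mu> i) = UNIV" if "i \<in> Ip \<union> In" for i using adm_fradon[OF \<mu> that] by (rule fradon_space)
    have pot: "pot \<kappa> (msum In \<mu>) x \<le> s * T" if x: "x \<in> A i" "i \<in> Ip" for x i
    proof -
      have "pot \<kappa> (msum In \<mu>) x = (\<integral>\<^sup>+ j. pot \<kappa> (\<mu> j) x \<partial>count_space In)" using b by (intro pot_msum) auto
      also have "\<dots> \<le> (\<integral>\<^sup>+ j. s * emeasure (\<mu> j) UNIV \<partial>count_space In)"
      proof (intro nn_integral_mono)
        fix j assume "j \<in> space (count_space In)"
        then have j: "j \<in> In" by simp
        have "pot \<kappa> (\<mu> j) x \<le> (\<integral>\<^sup>+ y. s \<partial>\<mu> j)"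
          unfolding pot_def using con[of j] j ks[OF x(1) _ x(2) j]
          by (intro nn_integral_mono_AE) auto
        then show "pot \<kappa> (\<mu> j) x \<le> s * emeasure (\<mu> j) UNIV" using j sp[of j] by simp
      qed
      also have "\<dots> = s * (\<integral>\<^sup>+ j. emeasure (\<mu> j) UNIV \<partial>count_space In)" by (rule nn_integral_cmult) simp
      also have "\<dots> \<le> s * T" using total_mass[OF mb, of In] by (intro mult_left_mono) auto
      finally show ?thesis .
    qed
    have "menergy \<kappa> (msum Ip \<mu>) (msum In \<mu>) = (\<integral>\<^sup>+ i. menergy \<kappa> (\<mu> i) (msum In \<mu>) \<partial>count_space Ip)"
      using b fradon_parts[OF mb] by (intro menergy_msum_left) auto
    also have "\<dots> \<le> (\<integral>\<^sup>+ i. s * T * emeasure (\<mu> i) UNIV \<partial>count_space Ip)"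
    proof (intro nn_integral_mono)
      fix i assume "i \<in> space (count_space Ip)"
      then have i: "i \<in> Ip" by simp
      have "menergy \<kappa> (\<mu> i) (msum In \<mu>) \<le> (\<integral>\<^sup>+ x. s * T \<partial>\<mu> i)"
        unfolding menergy_def using con[of i] i pot[OF _ i] by (intro nn_integral_mono_AE) auto
      then show "menergy \<kappa> (\<mu> i) (msum In \<mu>) \<le> s * T * emeasure (\<mu> i) UNIV" using i sp[of i] by simp
    qed
    also have "\<dots> = s * T * (\<integral>\<^sup>+ i. emeasure (\<mu> i) UNIV \<partial>count_space Ip)" by (rule nn_integral_cmult) simp
    also have "\<dots> \<le> s * T * T" using total_mass[OF mb, of Ip] by (intro mult_left_mono) auto
    finally show ?thesis .
  qed
  moreover have "s * T * T < top" using s T_finite by (simp add: ennreal_mult_less_top)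
  ultimately show ?thesis unfolding e_def by (intro exI[of _ "enn2real (s * T * T)"]) (auto intro!: enn2real_mono)
qed

text \<open>Convergent norms are eventually bounded; adding back the bounded mixed energy
  \<open>2 * B\<close> bounds the energy of each part, and positivity of the kernel passes this
  bound to each component.\<close>

lemma component_energy_bound: "\<exists>C. \<forall>\<^sub>F \<mu> in F. adm \<mu> \<and> (\<forall>i\<in>Ip \<union> In. e (\<mu> i) (\<mu> i) \<le> C)"
proof -
  let ?b = "\<lambda>\<mu>. bf (msum Ip \<mu>) (msum In \<mu>) (msum Ip \<mu>) (msum In \<mu>)"
  obtain B where B: "\<And>\<mu>. adm \<mu> \<Longrightarrow> e (msum Ip \<mu>) (msum In \<mu>) \<le> B" using cross_energy_bound by blast
  have "\<forall>\<^sub>F \<mu> in F. ?b \<mu> < ?b \<gamma> + 1" using order_tendstoD(2)[OF norm_tendsto, of "?b \<gamma> + 1"] by simp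
  with ev_adm' have "\<forall>\<^sub>F \<mu> in F. adm \<mu> \<and> (\<forall>i\<in>Ip \<union> In. e (\<mu> i) (\<mu> i) \<le> ?b \<gamma> + 1 + 2 * B)"
  proof eventually_elim
    case (elim \<mu>)
    have "?b \<mu> = e (msum Ip \<mu>) (msum Ip \<mu>) + e (msum In \<mu>) (msum In \<mu>) - 2 * e (msum Ip \<mu>) (msum In \<mu>)"
      using e_sym[OF adm_parts[OF elim(1)]] by (simp add: bf_def)
    then have "e (msum Ip \<mu>) (msum Ip \<mu>) \<le> ?b \<gamma> + 1 + 2 * B" "e (msum In \<mu>) (msum In \<mu>) \<le> ?b \<gamma> + 1 + 2 * B"
      using elim(2) B[OF elim(1)] e_nonneg[of "msum Ip \<mu>" "msum Ip \<mu>"] e_nonneg[of "msum In \<mu>" "msum In \<mu>"] by linarith+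
    moreover have "e (\<mu> i) (\<mu> i) \<le> e (msum S \<mu>) (msum S \<mu>)" if "i \<in> S" "S = Ip \<or> S = In" for i S
      using that adm_parts[OF elim(1)] adm_fradon[OF elim(1)] by (intro energy_msum_member(2)) auto
    ultimately show ?case using elim by (fastforce intro: order_trans)
  qed
  then show ?thesis by blast
qed

lemma component_weak_limit:
  assumes i: "i \<in> Ip \<union> In" and \<xi>: "\<xi> \<in> \<E>"
  shows "((\<lambda>\<mu>. e (\<mu> i) \<xi>) \<longlongrightarrow> e (\<gamma> i) \<xi>) F"
proof -
  obtain C where "\<forall>\<^sub>F \<mu> in F. adm \<mu> \<and> (\<forall>i\<in>Ip \<union> In. e (\<mu> i) (\<mu> i) \<le> C)" using component_energy_bound by blast
  then have "\<forall>\<^sub>F \<mu> in F. \<mu> i \<in> \<E> \<and> e (\<mu> i) (\<mu> i) \<le> C"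
    by eventually_elim (use i in \<open>auto intro: adm_energy\<close>)
  then show ?thesis
    using vague[OF i] by (intro weak_convergence[where m="\<lambda>\<mu>. \<mu> i"] adm_energy[OF adm_\<gamma> i] \<xi>)
qed

text \<open>The second argument is first exchanged for \<open>\<gamma>\<close>, at a cost of strong
  distance times the bounded norm of the component. With that argument fixed, weak convergence of
  the component applies.\<close>

lemma component_mutual_limit:
  assumes i: "i \<in> Ip \<union> In"
  shows "((\<lambda>\<mu>. bf (\<mu> i) mzero (msum Ip \<mu>) (msum In \<mu>)) \<longlongrightarrow> bf (\<gamma> i) mzero (msum Ip \<gamma>) (msum In \<gamma>)) F"
proof -
  obtain C where C: "\<forall>\<^sub>F \<mu> in F. adm \<mu> \<and> (\<forall>i\<in>Ip \<union> In. e (\<mu> i) (\<mu> i) \<le> C)" using component_energy_bound by blast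
  have "((\<lambda>\<mu>. bf (\<mu> i) mzero (msum Ip \<mu>) (msum In \<mu>) - bf (\<mu> i) mzero (msum Ip \<gamma>) (msum In \<gamma>)) \<longlongrightarrow> 0) F"
  proof (rule Lim_null_comparison[where g="\<lambda>\<mu>. vdist \<kappa> Ip In \<mu> \<gamma> * sqrt C"])
    show "((\<lambda>\<mu>. vdist \<kappa> Ip In \<mu> \<gamma> * sqrt C) \<longlongrightarrow> 0) F" using strong by (rule tendsto_mult_left_zero)
    show "\<forall>\<^sub>F \<mu> in F. norm (bf (\<mu> i) mzero (msum Ip \<mu>) (msum In \<mu>) - bf (\<mu> i) mzero (msum Ip \<gamma>) (msum In \<gamma>))
        \<le> vdist \<kappa> Ip In \<mu> \<gamma> * sqrt C"
      using C
    proof eventually_elim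
      case (elim \<mu>)
      then have \<mu>: "adm \<mu>" and le: "e (\<mu> i) (\<mu> i) \<le> C" using i by auto
      have mi: "\<mu> i \<in> \<E>" using \<mu> i by (rule adm_energy)
      have "bf (\<mu> i) mzero (\<mu> i) mzero = e (\<mu> i) (\<mu> i)" using mi mzero_energy by (simp add: bf_def e_mzero)
      moreover have "0 \<le> vdist \<kappa> Ip In \<mu> \<gamma>"
        unfolding vdist_eq[OF \<mu>] using bf_diff_self_nonneg[OF adm_parts[OF \<mu>] adm_parts[OF adm_\<gamma>]] by simp
      ultimately show ?case
        using bf_diff_Cauchy_Schwarz[OF adm_parts[OF \<mu>] adm_parts[OF adm_\<gamma>] mi mzero_energy] le
          mult_left_mono[OF real_sqrt_le_mono[OF le], of "vdist \<kappa> Ip In \<mu> \<gamma>"]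
          bf_sym[OF mi mzero_energy adm_parts[OF \<mu>]] bf_sym[OF mi mzero_energy adm_parts[OF adm_\<gamma>]]
        unfolding vdist_eq[OF \<mu>] by simp
    qed
  qed
  moreover have "((\<lambda>\<mu>. bf (\<mu> i) mzero (msum Ip \<gamma>) (msum In \<gamma>)) \<longlongrightarrow> bf (\<gamma> i) mzero (msum Ip \<gamma>) (msum In \<gamma>)) F"
    using adm_parts[OF adm_\<gamma>] unfolding bf_def by (auto simp: e_mzero intro!: tendsto_intros component_weak_limit[OF i])
  ultimately show ?thesis using tendsto_add by force
qed

end

section \<open>Variation of a component\<close>

text \<open>The change of each part is prescribed through its mutual energies with test measures,
  since \<open>\<nu> - \<mu>\<close> is not a positive measure. Only \<open>p - q\<close> survives,
  the coefficient of \<open>\<nu> - \<mu>\<close> in the signed difference.\<close>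

lemma (in energy_kernel) bf_update:
  assumes m: "P \<in> \<E>" "N \<in> \<E>" "P' \<in> \<E>" "N' \<in> \<E>" "\<nu> \<in> \<E>" "\<mu> \<in> \<E>"
    and P': "\<And>\<xi>. \<xi> \<in> \<E> \<Longrightarrow> e P' \<xi> = e P \<xi> + p * (e \<nu> \<xi> - e \<mu> \<xi>)"
    and N': "\<And>\<xi>. \<xi> \<in> \<E> \<Longrightarrow> e N' \<xi> = e N \<xi> + q * (e \<nu> \<xi> - e \<mu> \<xi>)"
  shows "Q \<in> \<E> \<Longrightarrow> R \<in> \<E> \<Longrightarrow>
      bf P' N' Q R = bf P N Q R + (p - q) * (bf \<nu> mzero Q R - bf \<mu> mzero Q R)" (is "_ \<Longrightarrow> _ \<Longrightarrow> ?lin Q R")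
    and "bf P' N' P' N' = bf P N P N + 2 * (p - q) * (bf \<nu> mzero P N - bf \<mu> mzero P N)
       + (p - q)\<^sup>2 * (e \<nu> \<nu> - 2 * e \<nu> \<mu> + e \<mu> \<mu>)"
proof -
  have lin: "?lin Q R" if "Q \<in> \<E>" "R \<in> \<E>" for Q R
    using that by (simp add: bf_def P' N' e_mzero algebra_simps)
  then show "Q \<in> \<E> \<Longrightarrow> R \<in> \<E> \<Longrightarrow> ?lin Q R" .
  note z = mzero_energy
  have 1: "bf P' N' P' N' = bf P N P' N' + (p - q) * (bf \<nu> mzero P' N' - bf \<mu> mzero P' N')"
    using m by (intro lin)
  have 2: "bf P N P' N' = bf P N P N + (p - q) * (bf \<nu> mzero P N - bf \<mu> mzero P N)"
    using m by (subst bf_sym) (auto simp: lin)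
  have 3: "bf \<rho> mzero P' N' = bf \<rho> mzero P N + (p - q) * (e \<nu> \<rho> - e \<mu> \<rho>)" if "\<rho> \<in> \<E>" for \<rho>
  proof -
    have "bf \<rho> mzero P' N' = bf P' N' \<rho> mzero" using m that z by (intro bf_sym)
    also have "\<dots> = bf P N \<rho> mzero + (p - q) * (bf \<nu> mzero \<rho> mzero - bf \<mu> mzero \<rho> mzero)"
      using that z by (rule lin)
    also have "\<dots> = bf \<rho> mzero P N + (p - q) * (e \<nu> \<rho> - e \<mu> \<rho>)"
      using m that z bf_sym[OF m(1,2) that z] by (simp add: bf_def e_mzero)
    finally show ?thesis .
  qed
  show "bf P' N' P' N' = bf P N P N + 2 * (p - q) * (bf \<nu> mzero P N - bf \<mu> mzero P N)
       + (p - q)\<^sup>2 * (e \<nu> \<nu> - 2 * e \<nu> \<mu> + e \<mu> \<mu>)"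
    unfolding 1 2 3[OF m(5)] 3[OF m(6)] e_sym[OF m(6,5)] by (simp add: algebra_simps power2_eq_square)
qed

context minimizing_net
begin

abbreviation mix :: "real \<Rightarrow> 'a measure \<Rightarrow> 'a measure \<Rightarrow> 'a measure" where
  "mix t \<mu> \<nu> \<equiv> madd (scale_measure (ennreal (1 - t)) \<mu>) (scale_measure (ennreal t) \<nu>)"

lemma g_measurable:
  assumes i: "i \<in> Ip \<union> In" shows "(\<lambda>x. indicator (A i) x *\<^sub>R g x) \<in> borel_measurable borel"
  using closed_A[OF i] gcont i
  by (intro borel_measurable_continuous_on_indicator) (auto intro: continuous_on_subset)

text \<open>Off \<open>A i\<close> the function \<open>g\<close> is arbitrary and need not be Borel.\<close>

lemma g_integral_cong:
  assumes "sets m = sets borel" "concentrated m (A i)"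
  shows "(\<integral>\<^sup>+ x. ennreal (g x) \<partial>m) = (\<integral>\<^sup>+ x. ennreal (indicator (A i) x *\<^sub>R g x) \<partial>m)"
  using concentrated_AE[OF assms] by (intro nn_integral_cong_AE) auto

lemma concentrated_iff:
  assumes "i \<in> Ip \<union> In" "sets m = sets borel"
  shows "concentrated m (A i) \<longleftrightarrow> emeasure m (- A i) = 0"
proof
  assume "concentrated m (A i)"
  then obtain N where "N \<in> null_sets m" "- A i \<subseteq> N" by (auto simp: concentrated_def)
  then show "emeasure m (- A i) = 0" by (metis emeasure_mono le_zero_eq null_setsD1 null_setsD2)
next
  assume "emeasure m (- A i) = 0"
  moreover have "- A i \<in> sets m" using closed_A[OF assms(1)] assms(2) by (simp add: open_Compl)
  ultimately show "concentrated m (A i)" unfolding concentrated_def by (intro bexI[of _ "- A i"]) auto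
qed

lemma nn_integral_mix:
  assumes "fradon \<mu>" "fradon \<nu>" "f \<in> borel_measurable borel"
  shows "(\<integral>\<^sup>+ x. f x \<partial>mix t \<mu> \<nu>) = ennreal (1 - t) * (\<integral>\<^sup>+ x. f x \<partial>\<mu>) + ennreal t * (\<integral>\<^sup>+ x. f x \<partial>\<nu>)"
  using assms by (subst nn_integral_madd) (auto simp: fradon_sets nn_integral_scale_measure cong: measurable_cong_sets)

text \<open>The mixture is dominated by \<open>\<mu> i + \<nu>\<close>, so each part of the varied
  vector is dominated by the old part plus \<open>\<nu>\<close>, which has finite energy. The
  constraint is affine and is preserved by mixing.\<close>

lemma variation_admissible:
  assumes \<mu>: "\<mu> \<in> EplusAag \<kappa> Ip In A a g (Ip \<union> In)" and i: "i \<in> Ip \<union> In" and \<nu>: "\<nu> \<in> \<E>" "concentrated \<nu> (A i)"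
    and g\<nu>: "(\<integral>\<^sup>+ x. ennreal (g x) \<partial>\<nu>) = ennreal (a i)" and t: "0 \<le> t" "t \<le> 1"
  shows "\<mu>(i := mix t (\<mu> i) \<nu>) \<in> EplusAag \<kappa> Ip In A a g (Ip \<union> In)" (is "?\<mu> \<in> _")
proof -
  have adm: "adm \<mu>" using \<mu> by (rule adm_EplusAag)
  have f: "fradon (\<mu> i)" "fradon \<nu>" using adm_fradon[OF adm i] energy_fradon[OF \<nu>(1)] by auto
  have con: "concentrated (\<mu> i) (A i)" and g\<mu>: "(\<integral>\<^sup>+ x. ennreal (g x) \<partial>\<mu> i) = ennreal (a i)"
    using \<mu> i by (auto simp: EplusAag_def EplusA_def)
  let ?m = "mix t (\<mu> i) \<nu>"
  have fm: "fradon ?m" using f by (intro fradon_madd fradon_scale) auto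
  have cm: "concentrated ?m (A i)"
  proof -
    have [measurable]: "- A i \<in> sets borel" using closed_A[OF i] by (simp add: open_Compl)
    have "emeasure ?m (- A i) = (\<integral>\<^sup>+ x. indicator (- A i) x \<partial>?m)" using fm by (simp add: fradon_sets)
    also have "\<dots> = ennreal (1 - t) * emeasure (\<mu> i) (- A i) + ennreal t * emeasure \<nu> (- A i)"
      using f by (subst nn_integral_mix) (auto simp: fradon_sets)
    also have "\<dots> = 0"
      using con \<nu>(2) concentrated_iff[OF i] f by (simp add: fradon_sets)
    finally show ?thesis using concentrated_iff[OF i] fm by (simp add: fradon_sets)
  qed
  have gm: "(\<integral>\<^sup>+ x. ennreal (g x) \<partial>?m) = ennreal (a i)"
  proof -
    have "(\<integral>\<^sup>+ x. ennreal (g x) \<partial>?m) = (\<integral>\<^sup>+ x. ennreal (indicator (A i) x *\<^sub>R g x) \<partial>?m)"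
      using fm cm by (intro g_integral_cong) (auto simp: fradon_sets)
    also have "\<dots> = ennreal (1 - t) * (\<integral>\<^sup>+ x. ennreal (indicator (A i) x *\<^sub>R g x) \<partial>\<mu> i) + ennreal t * (\<integral>\<^sup>+ x. ennreal (indicator (A i) x *\<^sub>R g x) \<partial>\<nu>)"
      using g_measurable[OF i] by (intro nn_integral_mix f) (rule measurable_compose[OF _ measurable_ennreal])
    also have "\<dots> = ennreal (1 - t) * ennreal (a i) + ennreal t * ennreal (a i)"
      using g_integral_cong[OF fradon_sets[OF f(1)] con] g_integral_cong[OF fradon_sets[OF f(2)] \<nu>(2)] g\<mu> g\<nu> by simp
    also have "\<dots> = ennreal ((1 - t) * a i + t * a i)"
      using t a_pos[OF i] by (simp add: ennreal_mult ennreal_plus)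
    also have "\<dots> = ennreal (a i)" by (simp add: algebra_simps)
    finally show ?thesis .
  qed
  have mb: "mass_bounded ?\<mu>"
    using adm_mass_bounded[OF \<mu>] mass_bound_of_constraint[OF _ i cm gm] fm
    by (auto simp: mass_bounded_def fradon_def)
  have energy: "msum S ?\<mu> \<in> \<E>" if S: "S = Ip \<or> S = In" for S
  proof (rule energy_dominated)
    show "fradon (msum S ?\<mu>)" using fradon_parts[OF mb] S by auto
    show "madd (msum S \<mu>) \<nu> \<in> \<E>" using S adm_parts[OF adm] \<nu> by (auto intro: energy_madd)
    fix f :: "'a \<Rightarrow> ennreal" assume fb: "f \<in> borel_measurable borel"
    have b: "sets (\<mu> j) = sets borel" "sets (?\<mu> j) = sets borel" if "j \<in> S" for j
      using that S fradon_sets[OF adm_fradon[OF adm]] by auto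
    have "(\<integral>\<^sup>+ x. f x \<partial>msum S ?\<mu>) = (\<integral>\<^sup>+ j. (\<integral>\<^sup>+ x. f x \<partial>?\<mu> j) \<partial>count_space S)"
      using b fb by (intro nn_integral_msum)
    also have "\<dots> \<le> (\<integral>\<^sup>+ j. (\<integral>\<^sup>+ x. f x \<partial>\<mu> j) + (\<integral>\<^sup>+ x. f x \<partial>\<nu>) * indicator {i} j \<partial>count_space S)"
    proof (intro nn_integral_mono)
      fix j
      have "ennreal (1 - t) * u + ennreal t * v \<le> u + v" for u v :: ennreal
        using t mult_right_mono[of "ennreal (1 - t)" 1 u] mult_right_mono[of "ennreal t" 1 v]
        by (intro add_mono) (auto simp: ennreal_le_1)
      then show "(\<integral>\<^sup>+ x. f x \<partial>?\<mu> j) \<le> (\<integral>\<^sup>+ x. f x \<partial>\<mu> j) + (\<integral>\<^sup>+ x. f x \<partial>\<nu>) * indicator {i} j"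
        using f fb by (cases "j = i") (auto simp: nn_integral_mix)
    qed
    also have "\<dots> = (\<integral>\<^sup>+ j. (\<integral>\<^sup>+ x. f x \<partial>\<mu> j) \<partial>count_space S) + (\<integral>\<^sup>+ j. (\<integral>\<^sup>+ x. f x \<partial>\<nu>) * indicator {i} j \<partial>count_space S)"
      by (rule nn_integral_add) auto
    also have "\<dots> \<le> (\<integral>\<^sup>+ j. (\<integral>\<^sup>+ x. f x \<partial>\<mu> j) \<partial>count_space S) + (\<integral>\<^sup>+ x. f x \<partial>\<nu>)"
    proof (intro add_left_mono)
      show "(\<integral>\<^sup>+ j. (\<integral>\<^sup>+ x. f x \<partial>\<nu>) * indicator {i} j \<partial>count_space S) \<le> (\<integral>\<^sup>+ x. f x \<partial>\<nu>)"
      proof (cases "i \<in> S")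
        case True
        then show ?thesis by (subst nn_integral_cmult_indicator) auto
      next
        case False
        then have "(\<integral>\<^sup>+ j. (\<integral>\<^sup>+ x. f x \<partial>\<nu>) * indicator {i} j \<partial>count_space S) = (\<integral>\<^sup>+ j. 0 \<partial>count_space S)"
          by (intro nn_integral_cong) (auto simp: indicator_def)
        then show ?thesis by simp
      qed
    qed
    also have "\<dots> = (\<integral>\<^sup>+ x. f x \<partial>madd (msum S \<mu>) \<nu>)"
      using b fb f by (subst nn_integral_madd) (auto simp: nn_integral_msum fradon_sets)
    finally show "(\<integral>\<^sup>+ x. f x \<partial>msum S ?\<mu>) \<le> (\<integral>\<^sup>+ x. f x \<partial>madd (msum S \<mu>) \<nu>)" .
  qed
  have "adm ?\<mu>" unfolding adm_def using mb energy adm cm by (auto simp: adm_def)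
  then have "?\<mu> \<in> EplusA \<kappa> Ip In A" using adm_iff[OF mb] by simp
  then show ?thesis using \<mu> gm by (auto simp: EplusAag_def)
qed

lemma e_variation:
  assumes adm: "adm \<mu>" and adm': "adm (\<mu>(i := mix t (\<mu> i) \<nu>))" and i: "i \<in> Ip \<union> In" and \<nu>: "\<nu> \<in> \<E>"
    and t: "0 \<le> t" "t \<le> 1" and S: "S = Ip \<or> S = In" and \<xi>: "\<xi> \<in> \<E>"
  shows "e (msum S (\<mu>(i := mix t (\<mu> i) \<nu>))) \<xi> = e (msum S \<mu>) \<xi> + (if i \<in> S then t else 0) * (e \<nu> \<xi> - e (\<mu> i) \<xi>)"
proof -
  let ?\<mu> = "\<mu>(i := mix t (\<mu> i) \<nu>)" and ?d = "e \<nu> \<xi> - e (\<mu> i) \<xi>"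
  have hs: "((\<lambda>j. e (\<mu>' j) \<xi>) has_sum e (msum S \<mu>') \<xi>) S" if "adm \<mu>'" for \<mu>'
    using that S adm_parts[OF that] countable_Ip countable_In adm_fradon[OF that] \<xi>
    by (intro e_msum_has_sum) auto
  \<comment> \<open>The variation alters a single term of the series for the energy, or none when
    \<open>i\<close> is not in \<open>S\<close>; uniqueness of sums then identifies the new
    total.\<close>
  have "((\<lambda>j. if j = i then t * ?d else 0) has_sum (if i \<in> S then t else 0) * ?d) S"
    by (rule has_sum_finite_neutralI[where B="S \<inter> {i}"]) auto
  with hs[OF adm] have "((\<lambda>j. e (\<mu> j) \<xi> + (if j = i then t * ?d else 0)) has_sum
      e (msum S \<mu>) \<xi> + (if i \<in> S then t else 0) * ?d) S" by (rule has_sum_add)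
  moreover have "e (?\<mu> j) \<xi> = e (\<mu> j) \<xi> + (if j = i then t * ?d else 0)" for j
  proof (cases "j = i")
    case True
    have "e (mix t (\<mu> i) \<nu>) \<xi> = (1 - t) * e (\<mu> i) \<xi> + t * e \<nu> \<xi>"
      using adm_energy[OF adm i] \<nu> \<xi> t by (simp add: e_madd_left e_scale_left energy_scale)
    then show ?thesis using True by (simp add: algebra_simps)
  qed simp
  ultimately have "((\<lambda>j. e (?\<mu> j) \<xi>) has_sum e (msum S \<mu>) \<xi> + (if i \<in> S then t else 0) * ?d) S"
    by (simp only:)
  with hs[OF adm'] show ?thesis by (rule has_sum_unique)
qed

lemma G_variation:
  assumes adm: "adm \<mu>" and adm': "adm (\<mu>(i := mix t (\<mu> i) \<nu>))" and i: "i \<in> Ip \<union> In" and \<nu>: "\<nu> \<in> \<E>"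
    and t: "0 \<le> t" "t \<le> 1"
  shows "Gchi \<kappa> Ip In chiP chiN (\<mu>(i := mix t (\<mu> i) \<nu>)) = Gchi \<kappa> Ip In chiP chiN \<mu>
     + 2 * t * alpha Ip i * ((bf \<nu> mzero (msum Ip \<mu>) (msum In \<mu>) + bf \<nu> mzero chiP chiN)
         - (bf (\<mu> i) mzero (msum Ip \<mu>) (msum In \<mu>) + bf (\<mu> i) mzero chiP chiN))
     + t\<^sup>2 * (e \<nu> \<nu> - 2 * e \<nu> (\<mu> i) + e (\<mu> i) (\<mu> i))"
proof -
  let ?\<mu> = "\<mu>(i := mix t (\<mu> i) \<nu>)"
  \<comment> \<open>Exactly one of \<open>p\<close>, \<open>q\<close> equals \<open>t\<close>, and
    their difference carries the sign of the plate to which \<open>i\<close> belongs.\<close>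
  define p q where "p = (if i \<in> Ip then t else 0)" and "q = (if i \<in> In then t else 0)"
  have pq: "p - q = t * alpha Ip i" "(p - q)\<^sup>2 = t\<^sup>2"
    using i disjoint_I by (auto simp: p_def q_def alpha_def)
  note m = adm_parts[OF adm] adm_parts[OF adm'] \<nu> adm_energy[OF adm i]
  have P: "e (msum Ip ?\<mu>) \<xi> = e (msum Ip \<mu>) \<xi> + p * (e \<nu> \<xi> - e (\<mu> i) \<xi>)"
    and N: "e (msum In ?\<mu>) \<xi> = e (msum In \<mu>) \<xi> + q * (e \<nu> \<xi> - e (\<mu> i) \<xi>)" if "\<xi> \<in> \<E>" for \<xi>
    using e_variation[OF adm adm' i \<nu> t _ that] by (auto simp: p_def q_def)
  have b1: "bf (msum Ip ?\<mu>) (msum In ?\<mu>) chiP chiN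
      = bf (msum Ip \<mu>) (msum In \<mu>) chiP chiN + (p - q) * (bf \<nu> mzero chiP chiN - bf (\<mu> i) mzero chiP chiN)"
    by (rule bf_update(1)[OF m]) (fact P N chi_energy)+
  have b2: "bf (msum Ip ?\<mu>) (msum In ?\<mu>) (msum Ip ?\<mu>) (msum In ?\<mu>) = bf (msum Ip \<mu>) (msum In \<mu>) (msum Ip \<mu>) (msum In \<mu>)
      + 2 * (p - q) * (bf \<nu> mzero (msum Ip \<mu>) (msum In \<mu>) - bf (\<mu> i) mzero (msum Ip \<mu>) (msum In \<mu>))
      + (p - q)\<^sup>2 * (e \<nu> \<nu> - 2 * e \<nu> (\<mu> i) + e (\<mu> i) (\<mu> i))"
    by (rule bf_update(2)[OF m]) (fact P N)+
  show ?thesis unfolding Gchi_eq[OF adm] Gchi_eq[OF adm'] b1 b2 unfolding pq(2) unfolding pq(1)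
    by (simp add: algebra_simps)
qed

lemma \<sigma>_split:
  assumes "m \<in> \<E>"
  shows "bf m mzero \<sigma>P \<sigma>N = bf m mzero (msum Ip \<gamma>) (msum In \<gamma>) + bf m mzero chiP chiN"
  using assms adm_parts[OF adm_\<gamma>] chi_energy \<sigma>_energy
  unfolding \<sigma>P_def \<sigma>N_def bf_def by (simp add: e_madd_right e_mzero mzero_energy)

text \<open>The one-sided derivative of \<open>G\<close> in the direction of \<open>\<nu>\<close> is
  nonnegative in the limit, although only members of the net are varied.\<close>

lemma variational_inequality:
  assumes i: "i \<in> Ip \<union> In" and \<nu>: "\<nu> \<in> \<E>" "concentrated \<nu> (A i)"
    and g\<nu>: "(\<integral>\<^sup>+ x. ennreal (g x) \<partial>\<nu>) = ennreal (a i)"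
  shows "alpha Ip i * bf (\<gamma> i) mzero \<sigma>P \<sigma>N \<le> alpha Ip i * bf \<nu> mzero \<sigma>P \<sigma>N"
proof -
  obtain C where C: "\<forall>\<^sub>F \<mu> in F. adm \<mu> \<and> (\<forall>i\<in>Ip \<union> In. e (\<mu> i) (\<mu> i) \<le> C)" using component_energy_bound by blast
  \<comment> \<open>Bounds the coefficient of \<open>t\<^sup>2\<close> uniformly along the net: the
    mixed term \<open>- 2 * e \<nu> (\<mu> i)\<close> is at most 0 and is dropped.\<close>
  define D where "D = e \<nu> \<nu> + C"
  let ?G = "Gchi \<kappa> Ip In chiP chiN"
  let ?d = "alpha Ip i * (bf \<nu> mzero \<sigma>P \<sigma>N - bf (\<gamma> i) mzero \<sigma>P \<sigma>N)"
  have gi: "\<gamma> i \<in> \<E>" using adm_energy[OF adm_\<gamma> i] .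
  have step: "0 \<le> 2 * ?d + t * D" if t: "0 < t" "t \<le> 1" for t
  proof -
    let ?f = "\<lambda>\<mu>. ?G \<mu> + 2 * t * alpha Ip i * ((bf \<nu> mzero (msum Ip \<mu>) (msum In \<mu>) + bf \<nu> mzero chiP chiN)
         - (bf (\<mu> i) mzero (msum Ip \<mu>) (msum In \<mu>) + bf (\<mu> i) mzero chiP chiN)) + t\<^sup>2 * D"
    have lower: "\<forall>\<^sub>F \<mu> in F. ?G \<gamma> \<le> ?f \<mu>"
      using C ev_adm
    proof eventually_elim
      case (elim \<mu>)
      let ?\<mu> = "\<mu>(i := mix t (\<mu> i) \<nu>)"
      have mem: "?\<mu> \<in> EplusAag \<kappa> Ip In A a g (Ip \<union> In)"
        using t by (intro variation_admissible[OF elim(2) i \<nu> g\<nu>]) auto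
      have "Ginf \<kappa> Ip In A chiP chiN a g (Ip \<union> In) \<le> ereal (?G ?\<mu>)"
        unfolding Ginf_def by (rule INF_lower[OF mem])
      then have "?G \<gamma> \<le> ?G ?\<mu>" unfolding Ginf_eq by simp
      also have "\<dots> \<le> ?f \<mu>"
      proof -
        have "e \<nu> \<nu> - 2 * e \<nu> (\<mu> i) + e (\<mu> i) (\<mu> i) \<le> D"
          using bspec[OF conjunct2[OF elim(1)] i] e_nonneg[of \<nu> "\<mu> i"] by (simp add: D_def)
        then show ?thesis
          using G_variation[OF _ adm_EplusAag[OF mem] i \<nu>(1)] elim(1) t by (simp add: mult_left_mono)
      qed
      finally show ?case .
    qed
    have "(?f \<longlongrightarrow> ?G \<gamma> + 2 * t * alpha Ip i * ((bf \<nu> mzero (msum Ip \<gamma>) (msum In \<gamma>) + bf \<nu> mzero chiP chiN)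
         - (bf (\<gamma> i) mzero (msum Ip \<gamma>) (msum In \<gamma>) + bf (\<gamma> i) mzero chiP chiN)) + t\<^sup>2 * D) F"
    proof (intro tendsto_intros G_tendsto component_mutual_limit[OF i])
      have "\<forall>\<^sub>F \<mu> in F. bf (msum Ip \<mu>) (msum In \<mu>) \<nu> mzero = bf \<nu> mzero (msum Ip \<mu>) (msum In \<mu>)"
        using ev_adm' by eventually_elim (intro bf_sym adm_parts \<nu> mzero_energy)
      then show "((\<lambda>\<mu>. bf \<nu> mzero (msum Ip \<mu>) (msum In \<mu>)) \<longlongrightarrow> bf \<nu> mzero (msum Ip \<gamma>) (msum In \<gamma>)) F"
        using bf_tendsto[OF \<nu>(1) mzero_energy] bf_sym[OF adm_parts[OF adm_\<gamma>] \<nu>(1) mzero_energy]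
        by (subst (asm) tendsto_cong) auto
      have "((\<lambda>\<mu>. e (\<mu> i) chiP - e (\<mu> i) chiN) \<longlongrightarrow> e (\<gamma> i) chiP - e (\<gamma> i) chiN) F"
        by (intro tendsto_intros component_weak_limit[OF i] chi_energy)
      then show "((\<lambda>\<mu>. bf (\<mu> i) mzero chiP chiN) \<longlongrightarrow> bf (\<gamma> i) mzero chiP chiN) F"
        using chi_energy by (simp add: bf_def e_mzero)
    qed
    \<comment> \<open>\<open>G\<close> at \<open>\<gamma>\<close> appears on both sides because it
      equals the infimum; after cancelling, one factor \<open>t\<close> can be divided out.\<close>
    from tendsto_lowerbound[OF this lower F_nonbot]
    have "?G \<gamma> \<le> ?G \<gamma> + 2 * t * ?d + t\<^sup>2 * D"
      unfolding \<sigma>_split[OF \<nu>(1)] \<sigma>_split[OF gi] by (simp add: mult.assoc)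
    then have "0 \<le> t * (2 * ?d + t * D)" by (simp add: algebra_simps power2_eq_square)
    then show ?thesis using t by (simp add: zero_le_mult_iff)
  qed
  have "((\<lambda>t. 2 * ?d + t * D) \<longlongrightarrow> 2 * ?d + 0 * D) (at_right 0)" by (intro tendsto_intros)
  moreover have "\<forall>\<^sub>F t in at_right 0. 0 \<le> 2 * ?d + t * D"
    unfolding eventually_at_right_field using step by (intro exI[of _ 1]) auto
  ultimately have "0 \<le> 2 * ?d + 0 * D"
    by (rule tendsto_lowerbound) simp
  then show ?thesis by (simp add: algebra_simps)
qed

section \<open>The weighted potential and its integrals\<close>

abbreviation W :: "'i \<Rightarrow> 'a \<Rightarrow> ereal" where "W i \<equiv> Wpot \<kappa> Ip In chiP chiN \<gamma> i"

lemma W_eq: "W i x = ereal (alpha Ip i) * (enn2ereal (pot \<kappa> \<sigma>P x) - enn2ereal (pot \<kappa> \<sigma>N x))"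
proof -
  have "pot \<kappa> (madd \<tau> (msum S \<gamma>)) x = pot \<kappa> \<tau> x + (\<Sum>\<^sub>\<infinity>j\<in>S. pot \<kappa> (\<gamma> j) x)"
    if "\<tau> \<in> \<E>" "S = Ip \<or> S = In" for \<tau> S
  proof -
    have "pot \<kappa> (madd \<tau> (msum S \<gamma>)) x = pot \<kappa> \<tau> x + pot \<kappa> (msum S \<gamma>) x"
      unfolding pot_def using that kernel_measurable by (intro nn_integral_madd) (auto simp: fradon_sets energy_fradon)
    also have "pot \<kappa> (msum S \<gamma>) x = (\<integral>\<^sup>+ j. pot \<kappa> (\<gamma> j) x \<partial>count_space S)"
      using that adm_fradon[OF adm_\<gamma>] by (intro pot_msum) (auto simp: fradon_sets)
    also have "\<dots> = (\<Sum>\<^sub>\<infinity>j\<in>S. pot \<kappa> (\<gamma> j) x)"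
      using that countable_Ip countable_In by (intro infsum_eq_nn_integral_count_space[symmetric]) auto
    finally show ?thesis .
  qed
  then show ?thesis using chi_energy by (simp add: Wpot_def \<sigma>P_def \<sigma>N_def)
qed

text \<open>A total real version of \<open>W\<close>. It can differ only where one of the two
  potentials is infinite, and no member of \<open>\<E>\<close> charges that set.\<close>

definition Wr :: "'i \<Rightarrow> 'a \<Rightarrow> real" where
  "Wr i x = alpha Ip i * (enn2real (pot \<kappa> \<sigma>P x) - enn2real (pot \<kappa> \<sigma>N x))"

lemma W_AE_real:
  assumes "m \<in> \<E>" shows "AE x in m. W i x = ereal (Wr i x)"
  using pot_AE_finite[OF assms \<sigma>_energy(1)] pot_AE_finite[OF assms \<sigma>_energy(2)]
proof eventually_elim
  case (elim x)
  then obtain u v where "pot \<kappa> \<sigma>P x = ennreal u" "u \<ge> 0" "pot \<kappa> \<sigma>N x = ennreal v" "v \<ge> 0"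
    by (cases "pot \<kappa> \<sigma>P x"; cases "pot \<kappa> \<sigma>N x") auto
  then show ?case by (simp add: W_eq Wr_def enn2ereal_ennreal)
qed

lemma Wr_integral:
  assumes "m \<in> \<E>"
  shows "integrable m (Wr i)" "(\<integral>x. Wr i x \<partial>m) = alpha Ip i * bf m mzero \<sigma>P \<sigma>N"
proof -
  note P = pot_integral[OF assms \<sigma>_energy(1)] and N = pot_integral[OF assms \<sigma>_energy(2)]
  show "integrable m (Wr i)" unfolding Wr_def using P(1) N(1) by (intro integrable_mult_right integrable_diff) auto
  have "(\<integral>x. Wr i x \<partial>m) = alpha Ip i * (e m \<sigma>P - e m \<sigma>N)"
    unfolding Wr_def using P N by simp
  then show "(\<integral>x. Wr i x \<partial>m) = alpha Ip i * bf m mzero \<sigma>P \<sigma>N"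
    using \<sigma>_energy by (simp add: bf_def e_mzero)
qed

lemma W_measurable: "W i \<in> borel_measurable borel"
proof -
  have [measurable]: "pot \<kappa> \<sigma>P \<in> borel_measurable borel" "pot \<kappa> \<sigma>N \<in> borel_measurable borel"
    using \<sigma>_energy by (auto intro: pot_measurable energy_fradon)
  show ?thesis unfolding W_eq[abs_def] by measurable
qed

lemma intW_eq:
  assumes i: "i \<in> Ip \<union> In"
  shows "intW \<kappa> Ip In chiP chiN \<gamma> i = alpha Ip i * bf (\<gamma> i) mzero \<sigma>P \<sigma>N"
proof -
  have gi: "\<gamma> i \<in> \<E>" using adm_energy[OF adm_\<gamma> i] .
  have s: "sets (\<gamma> i) = sets borel" using gi by (simp add: fradon_sets energy_fradon)
  have "intW \<kappa> Ip In chiP chiN \<gamma> i = (\<integral>x. Wr i x \<partial>\<gamma> i)"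
    unfolding intW_def
  proof (rule integral_cong_AE)
    show "(\<lambda>x. real_of_ereal (W i x)) \<in> borel_measurable (\<gamma> i)"
      using W_measurable[of i] s by (auto cong: measurable_cong_sets)
    show "Wr i \<in> borel_measurable (\<gamma> i)" using Wr_integral(1)[OF gi] by (rule borel_measurable_integrable)
    show "AE x in \<gamma> i. real_of_ereal (W i x) = Wr i x" using W_AE_real[OF gi, of i] by eventually_elim simp
  qed
  then show ?thesis using Wr_integral(2)[OF gi] by simp
qed

text \<open>The sums over the two index sets add up to the mutual energy of
  \<open>R \<gamma>\<close> with \<open>\<chi> + R \<gamma>\<close>, that is, the squared norm plus
  the field term. This is half of the squared norm plus \<open>G\<close>, and \<open>G\<close> at
  \<open>\<gamma>\<close> equals the infimum.\<close>

lemma intW_has_sum: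
  "((\<lambda>i. intW \<kappa> Ip In chiP chiN \<gamma> i) has_sum
     (vnorm2 \<kappa> Ip In \<gamma> + real_of_ereal (Ginf \<kappa> Ip In A chiP chiN a g (Ip \<union> In))) / 2) (Ip \<union> In)"
proof -
  let ?P = "msum Ip \<gamma>" and ?N = "msum In \<gamma>"
  note p = adm_parts[OF adm_\<gamma>] and s = \<sigma>_energy
  have hs: "((\<lambda>j. e (\<gamma> j) \<xi>) has_sum e (msum S \<gamma>) \<xi>) S" if "S = Ip \<or> S = In" "\<xi> \<in> \<E>" for S \<xi>
    using that p countable_Ip countable_In adm_fradon[OF adm_\<gamma>] by (intro e_msum_has_sum) auto
  have "((\<lambda>j. e (\<gamma> j) \<sigma>P + - 1 * e (\<gamma> j) \<sigma>N) has_sum e ?P \<sigma>P + - 1 * e ?P \<sigma>N) Ip"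
    using s by (intro has_sum_add has_sum_cmult_right hs) auto
  then have 1: "((\<lambda>i. intW \<kappa> Ip In chiP chiN \<gamma> i) has_sum e ?P \<sigma>P + - 1 * e ?P \<sigma>N) Ip"
    using s by (subst has_sum_cong[where g="\<lambda>j. e (\<gamma> j) \<sigma>P + - 1 * e (\<gamma> j) \<sigma>N"]) (auto simp: intW_eq alpha_def bf_def e_mzero)
  have "((\<lambda>j. e (\<gamma> j) \<sigma>N + - 1 * e (\<gamma> j) \<sigma>P) has_sum e ?N \<sigma>N + - 1 * e ?N \<sigma>P) In"
    using s by (intro has_sum_add has_sum_cmult_right hs) auto
  moreover have "j \<notin> Ip" if "j \<in> In" for j using that disjoint_I by auto
  ultimately have 2: "((\<lambda>i. intW \<kappa> Ip In chiP chiN \<gamma> i) has_sum e ?N \<sigma>N + - 1 * e ?N \<sigma>P) In"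
    using s by (subst has_sum_cong[where g="\<lambda>j. e (\<gamma> j) \<sigma>N + - 1 * e (\<gamma> j) \<sigma>P"]) (auto simp: intW_eq alpha_def bf_def e_mzero)
  have "(e ?P \<sigma>P + - 1 * e ?P \<sigma>N) + (e ?N \<sigma>N + - 1 * e ?N \<sigma>P)
      = (vnorm2 \<kappa> Ip In \<gamma> + real_of_ereal (Ginf \<kappa> Ip In A chiP chiN a g (Ip \<union> In))) / 2"
    using p chi_energy unfolding Ginf_eq vnorm2_def vmut_eq[OF adm_\<gamma> adm_\<gamma>] Gchi_eq[OF adm_\<gamma>]
    by (simp add: bf_def \<sigma>P_def \<sigma>N_def e_madd_right)
  with has_sum_Un_disjoint[OF 1 2 disjoint_I] show ?thesis by (simp only:)
qed

end

section \<open>The inequality nearly everywhere and uniqueness\<close>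

context minimizing_net
begin

lemma g_integral:
  assumes i: "i \<in> Ip \<union> In" and m: "fradon m" "concentrated m (A i)"
    and r: "(\<integral>\<^sup>+ x. ennreal (g x) \<partial>m) = ennreal r" "0 \<le> r"
  shows "integrable m (\<lambda>x. indicator (A i) x *\<^sub>R g x)" "(\<integral>x. indicator (A i) x *\<^sub>R g x \<partial>m) = r"
proof -
  have gm: "(\<lambda>x. indicator (A i) x *\<^sub>R g x) \<in> borel_measurable m"
    using g_measurable[OF i] fradon_sets[OF m(1)] by (simp cong: measurable_cong_sets)
  have nn: "0 \<le> indicator (A i) x *\<^sub>R g x" for x
    using c_le[OF i, of x] c_pos by (auto split: split_indicator)
  have eq: "(\<integral>\<^sup>+ x. ennreal (indicator (A i) x *\<^sub>R g x) \<partial>m) = ennreal r"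
    using r g_integral_cong[OF fradon_sets[OF m(1)] m(2)] by simp
  show "integrable m (\<lambda>x. indicator (A i) x *\<^sub>R g x)"
    using eq nn by (intro integrableI_nonneg[OF gm]) auto
  show "(\<integral>x. indicator (A i) x *\<^sub>R g x \<partial>m) = r"
    using eq nn r(2) gm by (subst integral_eq_nn_integral[OF gm]) auto
qed

text \<open>If the exceptional set had positive capacity, it would carry a unit measure of finite
  energy. Cut down and rescaled to satisfy the constraint, this measure becomes a direction
  \<open>\<nu>\<close> whose integrated strict inequality contradicts
  \<open>variational_inequality\<close>.\<close>

lemma W_lower_bound:
  assumes i: "i \<in> Ip \<union> In"
  shows "nearly_everywhere \<kappa> (A i) (\<lambda>x. ereal (a i) * W i x \<ge> ereal (intW \<kappa> Ip In chiP chiN \<gamma> i * g x))"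
proof (rule nearly_everywhereI)
  let ?\<eta> = "intW \<kappa> Ip In chiP chiN \<gamma> i"
  let ?E = "{x\<in>A i. \<not> ereal (a i) * W i x \<ge> ereal (?\<eta> * g x)}"
  fix m assume "m \<in> Eplus \<kappa>" and conE: "concentrated m ?E" and one: "emeasure m UNIV = 1"
  then have m: "m \<in> \<E>" by (simp add: Eplus_def \<E>_def fradon_def)
  have f: "fradon m" using m by (rule energy_fradon)
  note s = fradon_sets[OF f]
  interpret finite_measure m using f by (rule fradon_finite_measure)
  let ?g = "\<lambda>x. indicator (A i) x *\<^sub>R g x"
  have gm[measurable]: "?g \<in> borel_measurable borel" using i by (rule g_measurable)
  have Am[measurable]: "A i \<in> sets borel" using closed_A[OF i] by simp
  have aeE: "AE x in m. x \<in> ?E" by (rule concentrated_AE[OF s conE])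
  have mA: "emeasure m (A i) = 1"
  proof -
    have "AE x in m. x \<in> A i" using aeE by eventually_elim simp
    then have "emeasure m (A i) = emeasure m (space m)"
      using s by (intro emeasure_eq_AE) auto
    then show ?thesis using one fradon_space[OF f] by simp
  qed
  \<comment> \<open>The integral of \<open>g\<close> against \<open>m\<close> may be infinite. The
    sets where \<open>g\<close> is at most \<open>n\<close> exhaust \<open>A i\<close>, so one of
    them has positive mass and makes the integral finite.\<close>
  define B where "B n = {x\<in>A i. ?g x \<le> real n}" for n :: nat
  have Bm[measurable]: "B n \<in> sets borel" for n unfolding B_def by measurable
  have "\<exists>n. emeasure m (B n) \<noteq> 0"
  proof (rule ccontr)
    assume "\<not> ?thesis"
    then have "(\<Union>n. B n) \<in> null_sets m" using s by (intro null_sets_UN) auto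
    moreover have "(\<Union>n. B n) = A i" unfolding B_def using real_arch_simple by auto
    ultimately show False using mA by auto
  qed
  then obtain n where n: "emeasure m (B n) \<noteq> 0" by blast
  define m1 where "m1 = restr m (B n)"
  have m1: "m1 \<in> \<E>" "fradon m1" unfolding m1_def using energy_restr[OF m Bm] energy_fradon by auto
  note s1 = fradon_sets[OF m1(2)]
  have m1U: "emeasure m1 UNIV = emeasure m (B n)" unfolding m1_def using s by (simp add: emeasure_restr)
  have ae1: "AE x in m1. x \<in> ?E \<and> x \<in> B n"
  proof -
    have "AE x in m. 0 < (indicator (B n) x :: ennreal) \<longrightarrow> x \<in> ?E \<and> x \<in> B n"
      using aeE by eventually_elim (simp add: indicator_def)
    then show ?thesis unfolding m1_def restr_def using s by (subst AE_density) auto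
  qed
  have con1: "concentrated m1 (A i)"
    using ae1 by (intro AE_concentrated s1) (auto elim: eventually_mono)
  have gle: "(\<integral>\<^sup>+ x. ennreal (g x) \<partial>m1) \<le> (\<integral>\<^sup>+ x. ennreal n \<partial>m1)"
  proof (rule nn_integral_mono_AE, use ae1 in eventually_elim)
    case (elim x)
    then have "x \<in> A i" "?g x \<le> real n" by (auto simp: B_def)
    then show ?case by (simp add: ennreal_leI)
  qed
  have gge: "(\<integral>\<^sup>+ x. ennreal c \<partial>m1) \<le> (\<integral>\<^sup>+ x. ennreal (g x) \<partial>m1)"
    using ae1 c_le[OF i] by (intro nn_integral_mono_AE) (auto elim!: eventually_mono intro!: ennreal_leI)
  have "(\<integral>\<^sup>+ x. ennreal (g x) \<partial>m1) < top"
    using gle m1(2) fradon_space[OF m1(2)] by (auto simp: fradon_def ennreal_mult_less_top intro: le_less_trans)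
  then obtain r where r: "(\<integral>\<^sup>+ x. ennreal (g x) \<partial>m1) = ennreal r" "0 \<le> r"
    by (cases "\<integral>\<^sup>+ x. ennreal (g x) \<partial>m1") auto
  have rpos: "r > 0"
  proof (rule ccontr)
    assume "\<not> r > 0"
    then have "r = 0" using r by simp
    then show False using r gge n c_pos m1U fradon_space[OF m1(2)] by simp
  qed
  note gi = g_integral[OF i m1(2) con1 r]
  have W1: "AE x in m1. W i x = ereal (Wr i x)" by (rule W_AE_real[OF m1(1)])
  have "(\<integral>x. a i * Wr i x \<partial>m1) < (\<integral>x. ?\<eta> * ?g x \<partial>m1)"
  proof (rule finite_measure.integral_less_AE_space[OF fradon_finite_measure[OF m1(2)]])
    show "integrable m1 (\<lambda>x. a i * Wr i x)" using Wr_integral(1)[OF m1(1)] by simp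
    show "integrable m1 (\<lambda>x. ?\<eta> * ?g x)" using gi(1) by (intro integrable_mult_right) auto
    show "AE x in m1. a i * Wr i x < ?\<eta> * ?g x"
      using ae1 W1 by eventually_elim auto
    show "emeasure m1 (space m1) \<noteq> 0" using n m1U fradon_space[OF m1(2)] by simp
  qed
  then have lt: "a i * (alpha Ip i * bf m1 mzero \<sigma>P \<sigma>N) < ?\<eta> * r"
    using gi Wr_integral[OF m1(1), of i] by simp
  \<comment> \<open>As \<open>r\<close> is the integral of \<open>g\<close> against
    \<open>m1\<close>, this factor produces exactly the constraint value \<open>a i\<close>.\<close>
  define \<nu> where "\<nu> = scale_measure (ennreal (a i / r)) m1"
  have ar: "0 < a i / r" using a_pos[OF i] rpos by simp
  have "?\<eta> \<le> alpha Ip i * bf \<nu> mzero \<sigma>P \<sigma>N"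
    unfolding intW_eq[OF i]
  proof (rule variational_inequality[OF i])
    show "\<nu> \<in> \<E>" unfolding \<nu>_def using m1 by (intro energy_scale) auto
    have s\<nu>: "sets \<nu> = sets borel" using s1 by (simp add: \<nu>_def)
    show con\<nu>: "concentrated \<nu> (A i)"
      using con1 s\<nu> s1 concentrated_iff[OF i] by (simp add: \<nu>_def)
    have "(\<integral>\<^sup>+ x. ennreal (g x) \<partial>\<nu>) = (\<integral>\<^sup>+ x. ennreal (?g x) \<partial>\<nu>)"
      by (rule g_integral_cong[OF s\<nu> con\<nu>])
    also have "\<dots> = ennreal (a i / r) * (\<integral>\<^sup>+ x. ennreal (?g x) \<partial>m1)"
      unfolding \<nu>_def using gm s1 by (intro nn_integral_scale_measure) (simp cong: measurable_cong_sets)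
    also have "\<dots> = ennreal (a i / r) * ennreal r" using r g_integral_cong[OF s1 con1] by simp
    also have "\<dots> = ennreal (a i)" using ar rpos by (simp flip: ennreal_mult)
    finally show "(\<integral>\<^sup>+ x. ennreal (g x) \<partial>\<nu>) = ennreal (a i)" .
  qed
  also have "bf \<nu> mzero \<sigma>P \<sigma>N = a i / r * bf m1 mzero \<sigma>P \<sigma>N"
    using m1 \<sigma>_energy ar unfolding \<nu>_def bf_def by (simp add: e_scale_left e_mzero less_imp_le algebra_simps)
  finally have "?\<eta> * r \<le> a i * (alpha Ip i * bf m1 mzero \<sigma>P \<sigma>N)"
    using rpos by (simp add: field_simps)
  then show False using lt by simp
qed

text \<open>The inequality is integrated against \<open>\<mu> i\<close>, where the constraint turns
  the right side into exactly \<open>\<eta> * a i\<close>; for \<open>\<gamma> i\<close> that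
  integral of \<open>g\<close> could be smaller. The potential is fixed, so weak convergence of the
  component suffices.\<close>

lemma lower_bound_le_intW:
  assumes i: "i \<in> Ip \<union> In"
    and ne: "nearly_everywhere \<kappa> (A i) (\<lambda>x. ereal (a i) * W i x \<ge> ereal (\<eta> * g x))"
  shows "\<eta> \<le> intW \<kappa> Ip In chiP chiN \<gamma> i"
proof -
  let ?g = "\<lambda>x. indicator (A i) x *\<^sub>R g x"
  have [measurable]: "?g \<in> borel_measurable borel" "A i \<in> sets borel" "W i \<in> borel_measurable borel"
    using g_measurable[OF i] closed_A[OF i] W_measurable by auto
  \<comment> \<open>Within \<open>A i\<close> the function \<open>g\<close> agrees with its Borel
    version, which makes the exceptional set Borel.\<close>
  have "{x\<in>A i. \<not> ereal (a i) * W i x \<ge> ereal (\<eta> * g x)} = {x\<in>A i. \<not> ereal (a i) * W i x \<ge> ereal (\<eta> * ?g x)}"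
    by auto
  also have "\<dots> \<in> sets borel" by measurable
  finally have E: "{x\<in>A i. \<not> ereal (a i) * W i x \<ge> ereal (\<eta> * g x)} \<in> sets borel" .
  have "\<forall>\<^sub>F \<mu> in F. \<eta> \<le> alpha Ip i * bf (\<mu> i) mzero \<sigma>P \<sigma>N"
    using ev_adm
  proof eventually_elim
    case (elim \<mu>)
    then have adm: "adm \<mu>" and con: "concentrated (\<mu> i) (A i)" and gi: "(\<integral>\<^sup>+ x. ennreal (g x) \<partial>\<mu> i) = ennreal (a i)"
      using i by (auto simp: EplusAag_def EplusA_def intro!: adm_EplusAag)
    have m: "\<mu> i \<in> \<E>" using adm i by (rule adm_energy)
    note G = g_integral[OF i energy_fradon[OF m] con gi less_imp_le[OF a_pos[OF i]]]
    have "(\<integral>x. \<eta> * ?g x \<partial>\<mu> i) \<le> (\<integral>x. a i * Wr i x \<partial>\<mu> i)"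
    proof (rule integral_mono_AE)
      show "integrable (\<mu> i) (\<lambda>x. \<eta> * ?g x)" using G(1) by (intro integrable_mult_right) auto
      show "integrable (\<mu> i) (\<lambda>x. a i * Wr i x)" using Wr_integral(1)[OF m] by simp
      show "AE x in \<mu> i. \<eta> * ?g x \<le> a i * Wr i x"
        using nearly_everywhere_AE[OF ne m con E] W_AE_real[OF m, of i] by eventually_elim auto
    qed
    then have "a i * \<eta> \<le> a i * (alpha Ip i * bf (\<mu> i) mzero \<sigma>P \<sigma>N)"
      using G Wr_integral[OF m, of i] by (simp add: mult.commute)
    then show ?case using a_pos[OF i] by simp
  qed
  moreover have "((\<lambda>\<mu>. alpha Ip i * bf (\<mu> i) mzero \<sigma>P \<sigma>N) \<longlongrightarrow> alpha Ip i * bf (\<gamma> i) mzero \<sigma>P \<sigma>N) F"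
  proof -
    have "((\<lambda>\<mu>. alpha Ip i * (e (\<mu> i) \<sigma>P - e (\<mu> i) \<sigma>N)) \<longlongrightarrow> alpha Ip i * (e (\<gamma> i) \<sigma>P - e (\<gamma> i) \<sigma>N)) F"
      by (intro tendsto_intros component_weak_limit[OF i] \<sigma>_energy)
    then show ?thesis using \<sigma>_energy by (simp add: bf_def e_mzero)
  qed
  ultimately show ?thesis unfolding intW_eq[OF i] using tendsto_lowerbound F_nonbot by blast
qed

text \<open>All differences between the integrals and \<open>\<eta>\<close> are nonnegative and sum
  to 0, so a finite partial sum, here a single term, cannot be positive.\<close>

lemma intW_unique:
  assumes sum: "(\<eta> has_sum (vnorm2 \<kappa> Ip In \<gamma> + real_of_ereal (Ginf \<kappa> Ip In A chiP chiN a g (Ip \<union> In))) / 2) (Ip \<union> In)"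
    and ne: "\<And>i. i \<in> Ip \<union> In \<Longrightarrow> nearly_everywhere \<kappa> (A i) (\<lambda>x. ereal (a i) * W i x \<ge> ereal (\<eta> i * g x))"
    and i: "i \<in> Ip \<union> In"
  shows "\<eta> i = intW \<kappa> Ip In chiP chiN \<gamma> i"
proof -
  define v where "v = (vnorm2 \<kappa> Ip In \<gamma> + real_of_ereal (Ginf \<kappa> Ip In A chiP chiN a g (Ip \<union> In))) / 2"
  have "((\<lambda>i. intW \<kappa> Ip In chiP chiN \<gamma> i + - 1 * \<eta> i) has_sum v + - 1 * v) (Ip \<union> In)"
    unfolding v_def by (rule has_sum_add[OF intW_has_sum has_sum_cmult_right[OF sum]])
  then have "((\<lambda>i. intW \<kappa> Ip In chiP chiN \<gamma> i + - 1 * \<eta> i) has_sum 0) (Ip \<union> In)" by simp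
  then have "(\<Sum>j\<in>{i}. intW \<kappa> Ip In chiP chiN \<gamma> j + - 1 * \<eta> j) \<le> 0"
    using i lower_bound_le_intW[OF _ ne] by (intro finite_sum_le_has_sum) auto
  then show ?thesis using lower_bound_le_intW[OF i ne[OF i]] by simp
qed

end

theorem theorem12p1:
  fixes \<kappa> :: "'a::t2_space \<Rightarrow> 'a \<Rightarrow> ennreal" and h :: real
    and Ip In :: "'i set" and A :: "'i \<Rightarrow> 'a set"
    and chiP chiN :: "'a measure" and g :: "'a \<Rightarrow> real" and a :: "'i \<Rightarrow> real"
    and \<gamma> :: "'i \<Rightarrow> 'a measure"
  assumes X: "locally_compact_space (euclidean :: 'a topology)" "\<not> compact (UNIV :: 'a set)"
    and kernel: "admissible_kernel \<kappa> h"
    and cond: "condenser \<kappa> Ip In A"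
    and field: "external_field \<kappa> Ip In A chiP chiN"
    and gass: "admissible_g \<kappa> (Ip \<union> In) A g"
    and apos: "\<forall>i\<in>Ip \<union> In. a i > 0" and asum: "a summable_on (Ip \<union> In)"
    and Gfin: "Ginf \<kappa> Ip In A chiP chiN a g (Ip \<union> In) < \<infinity>"
    and ext: "\<gamma> \<in> extremal \<kappa> h Ip In A chiP chiN a g (Ip \<union> In)"
  shows "((\<lambda>i. intW \<kappa> Ip In chiP chiN \<gamma> i) has_sum
            (vnorm2 \<kappa> Ip In \<gamma> + real_of_ereal (Ginf \<kappa> Ip In A chiP chiN a g (Ip \<union> In))) / 2) (Ip \<union> In)
    \<and> (\<forall>i\<in>Ip \<union> In. nearly_everywhere \<kappa> (A i)
            (\<lambda>x. ereal (a i) * Wpot \<kappa> Ip In chiP chiN \<gamma> i x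
                   \<ge> ereal (intW \<kappa> Ip In chiP chiN \<gamma> i * g x)))
    \<and> (\<forall>\<eta> :: 'i \<Rightarrow> real.
         (\<eta> has_sum (vnorm2 \<kappa> Ip In \<gamma> + real_of_ereal (Ginf \<kappa> Ip In A chiP chiN a g (Ip \<union> In))) / 2) (Ip \<union> In)
         \<longrightarrow> (\<forall>i\<in>Ip \<union> In. nearly_everywhere \<kappa> (A i)
               (\<lambda>x. ereal (a i) * Wpot \<kappa> Ip In chiP chiN \<gamma> i x \<ge> ereal (\<eta> i * g x)))
         \<longrightarrow> (\<forall>i\<in>Ip \<union> In. \<eta> i = intW \<kappa> Ip In chiP chiN \<gamma> i))"
proof -
  obtain c where c: "c > 0" "\<And>x. x \<in> (\<Union>i\<in>Ip \<union> In. A i) \<Longrightarrow> c \<le> g x" and gc: "continuous_on (\<Union>i\<in>Ip \<union> In. A i) g"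
    using gass unfolding admissible_g_def by blast
  obtain F where F: "F \<noteq> bot"
    and ev: "\<forall>\<^sub>F \<mu> in F. \<mu> \<in> EplusAag \<kappa> Ip In A a g (Ip \<union> In)
            \<and> (\<Sum>\<^sub>\<infinity>i\<in>Ip \<union> In. emeasure (\<mu> i) UNIV) \<le> ennreal (Hconst h (Ip \<union> In) A chiP a g (Ip \<union> In))"
    and lims: "((\<lambda>\<mu>. ereal (Gchi \<kappa> Ip In chiP chiN \<mu>)) \<longlongrightarrow> Ginf \<kappa> Ip In A chiP chiN a g (Ip \<union> In)) F"
      "((\<lambda>\<mu>. vdist \<kappa> Ip In \<mu> \<gamma>) \<longlongrightarrow> 0) F"
      "\<forall>i\<in>Ip \<union> In. \<forall>f\<in>Cc. ((\<lambda>\<mu>. \<integral>x. f x \<partial>(\<mu> i)) \<longlongrightarrow> (\<integral>x. f x \<partial>(\<gamma> i))) F"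
    and \<gamma>: "\<gamma> \<in> EplusA \<kappa> Ip In A"
    using ext unfolding extremal_def by blast
  interpret minimizing_net \<kappa> h Ip In A chiP chiN g a \<gamma> F c
  proof
    show "\<forall>\<^sub>F \<mu> in F. \<mu> \<in> EplusAag \<kappa> Ip In A a g (Ip \<union> In)" using ev by eventually_elim simp
  qed (use X kernel cond field c gc apos asum F lims \<gamma> in auto)
  show ?thesis using intW_has_sum W_lower_bound intW_unique by blast
qed

end
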